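(* Fix $d \geq 2$. Let $\mathcal{Y}_d(n) = \big(Y_d(n,0) \subseteq Y_d(n,1) \subseteq \cdots \subseteq Y_d(n,\binom{n}{d+1})\big)$ be the Linial--Meshulam stochastic process. With high probability (i.e. with probability tending to $1$ as $n \to \infty$), the hitting time for the property that no $(d-1)$-dimensional face is isolated coincides exactly with the hitting time for the property $H_{d-1}(\,\cdot\,;\mathbb{Z}) = 0$. That is, with high probability, $H_{d-1}(Y_d(n,m);\mathbb{Z})$ first vanishes exactly at the step $m$ at which the last isolated $(d-1)$-dimensional face becomes covered by a $d$-dimensional face.
   Context: The Linial--Meshulam stochastic process $\mathcal{Y}_d(n)$ is the Markov process in which $Y_d(n,0)$ is the complete $(d-1)$-dimensional complex on $n$ vertices (the $(d-1)$-skeleton of the $(n-1)$-simplex), and $Y_d(n,k)$ is obtained from $Y_d(n,k-1)$ by adding one $d$-dimensional face chosen uniformly at random among all $d$-dimensional faces (of the simplex on the $n$ vertices) not already in $Y_d(n,k-1)$. For a property $P$, the hitting time of $P$ is the minimal $m$ such that $Y_d(n,m)$ has $P$. A $(d-1)$-dimensional face is isolated if it is not contained in any $d$-dimensional face of the complex. *)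

theory Defs
  imports Complex_Main
begin

definition faces :: "nat \<Rightarrow> nat \<Rightarrow> nat set set" where
  "faces n k = {S. S \<subseteq> {0..<n} \<and> card S = Suc k}"

text \<open>Incidence number [sigma : tau] of the simplicial boundary map with the standard
  orientation by the vertex order: (-1)^i where i is the position of the removed vertex.\<close>
definition incid :: "nat set \<Rightarrow> nat set \<Rightarrow> int" where
  "incid \<sigma> \<tau> = (if \<tau> \<subseteq> \<sigma> \<and> card \<sigma> = Suc (card \<tau>)
      then (-1) ^ card {y \<in> \<tau>. y < the_elem (\<sigma> - \<tau>)} else 0)"

text \<open>The complex: complete (d-1)-skeleton on n vertices plus the set F of d-faces.
  H_{d-1}(complex; Z) = 0 : every integral (d-1)-cycle is a boundary of a d-chain
  supported on F.\<close>
definition homology_vanishes :: "nat \<Rightarrow> nat \<Rightarrow> nat set set \<Rightarrow> bool" where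
  "homology_vanishes n d F \<longleftrightarrow>
     (\<forall>c :: nat set \<Rightarrow> int.
        (\<forall>\<rho> \<in> faces n (d - 2). (\<Sum>\<tau> \<in> faces n (d - 1). c \<tau> * incid \<tau> \<rho>) = 0)
        \<longrightarrow> (\<exists>b :: nat set \<Rightarrow> int.
               \<forall>\<tau> \<in> faces n (d - 1). (\<Sum>\<sigma> \<in> F. b \<sigma> * incid \<sigma> \<tau>) = c \<tau>))"

definition no_isolated :: "nat \<Rightarrow> nat \<Rightarrow> nat set set \<Rightarrow> bool" where
  "no_isolated n d F \<longleftrightarrow> (\<forall>\<tau> \<in> faces n (d - 1). \<exists>\<sigma> \<in> F. \<tau> \<subseteq> \<sigma>)"

text \<open>The Linial--Meshulam process is determined by a uniformly random ordering of all
  d-faces; Y_d(n,m) consists of the first m of them (plus the full (d-1)-skeleton).\<close>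
definition orderings :: "nat \<Rightarrow> nat \<Rightarrow> nat set list set" where
  "orderings n d = {xs. distinct xs \<and> set xs = faces n d}"

definition LM_step :: "nat set list \<Rightarrow> nat \<Rightarrow> nat set set" where
  "LM_step xs m = set (take m xs)"

definition hitting_time :: "(nat set set \<Rightarrow> bool) \<Rightarrow> nat set list \<Rightarrow> nat" where
  "hitting_time P xs = (LEAST m. m \<le> length xs \<and> P (LM_step xs m))"

definition LM_prob :: "nat \<Rightarrow> nat \<Rightarrow> (nat set list \<Rightarrow> bool) \<Rightarrow> real" where
  "LM_prob n d E = real (card {xs \<in> orderings n d. E xs}) / real (card (orderings n d))"

end

theory Submission
  imports Defs "HOL-Combinatorics.Multiset_Permutations" "HOL-Real_Asymp.Real_Asymp"
begin

text \<open>
  If the homology of the complex with set of \<open>d\<close>-faces \<open>F\<close> does not vanish, then the universal cochain, with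
  values in the chains modulo the boundaries of \<open>F\<close>, is a cocycle on \<open>F\<close> but not a coboundary. Take a cohomologous
  cochain of minimal support \<open>S\<close>. As the group of values is out of control, the union bound runs over supports only and
  uses two conditions that do not mention the values: no face of \<open>F\<close> contains exactly one element of \<open>S\<close>; and around
  every minimal set \<open>\<alpha>\<close> in which \<open>S\<close> has large codegree, the boundaries of the faces of \<open>F\<close>, localized at
  \<open>\<alpha>\<close>, generate a subgroup that misses a positive proportion of the star of \<open>\<alpha>\<close>, by a local version of the
  Meshulam--Wallach expansion argument.

  The second condition is very unlikely. As long as it holds, a random face enlarges the subgroup of \<open>\<int>\<^sup>k\<close> with
  probability bounded below, whereas \<open>t\<close> enlargements by vectors of bounded norm produce \<open>2\<^sup>t\<close> distinct vectors of norm
  \<open>O(t)\<close>, so that \<open>t = O(k)\<close>; torsion does not matter here. The \<open>s\<close> elements of \<open>S\<close> outside these dense spots can be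
  chosen in about \<open>(n\<^sup>d / s)\<^sup>s\<close> ways, or \<open>(n s)\<^sup>s\<close> ways for small connected \<open>S\<close>, while by the first condition they
  contribute a probability of about \<open>n\<^sup>-\<^sup>d\<^sup>s\<close>. All this is applied slightly before the last isolated face is
  covered, at a time when isolated faces still exist by the second moment method.
\<close>

section \<open>Cochains and local expansion\<close>

text \<open>The moment at which the last isolated face is covered is random, so one fixed earlier
  time \<open>m\<close> has to control all later complexes. This works because both conditions on a
  support are inherited by subsets of the set of \<open>d\<close>-faces: an obstruction in a later
  complex is already visible at time \<open>m\<close>, unless it is a single face, which a later
  complex without isolated faces rules out. The exponents leave room at each step. With about (d -
  1/10) (ln n / n) M faces, the expected number of isolated faces is of order n^(1/10). A support
  element outside the dense spots costs about n^-(d - 1/8), and still n^-(d - 1/4) after a small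
  share \<theta> of the exponent is spent on the dense spots. The sum over all supports then lives
  on sizes of order n^(1/4), so all sizes above sqrt n are harmless. Below sqrt n this count cannot
  tell small supports from isolated faces. There each further face of a connected support brings a
  factor of about n^(1/2) n n^-(d - 1/8) \<le> n^(-3/8), by d \<ge> 2.\<close>

lemma finite_faces [simp]: "finite (faces n k)"
  by (auto simp: faces_def)

lemma face_finite: "\<sigma> \<in> faces n k \<Longrightarrow> finite \<sigma>"
  by (auto simp: faces_def intro: finite_subset)

lemma face_subset_eq: "\<tau> \<in> faces n k \<Longrightarrow> \<tau>' \<in> faces n k \<Longrightarrow> \<tau> \<subseteq> \<tau>' \<Longrightarrow> \<tau> = \<tau>'"
  using card_subset_eq[of \<tau>' \<tau>] face_finite[of \<tau>' n k] by (simp add: faces_def)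

lemma card_faces: "card (faces n k) = n choose Suc k"
  unfolding faces_def using n_subsets[of "{0..<n}" "Suc k"] by simp

lemma incid_nonzero: "incid \<sigma> \<tau> \<noteq> 0 \<longleftrightarrow> \<tau> \<subseteq> \<sigma> \<and> card \<sigma> = Suc (card \<tau>)"
  by (auto simp: incid_def)

lemma incid_not_subset: "\<not> \<tau> \<subseteq> \<sigma> \<Longrightarrow> incid \<sigma> \<tau> = 0"
  by (auto simp: incid_def)

lemma incid_insert:
  assumes "finite \<rho>" "v \<notin> \<rho>"
  shows "incid (insert v \<rho>) \<rho> = (-1) ^ card {y \<in> \<rho>. y < v}"
proof -
  have "insert v \<rho> - \<rho> = {v}" using assms by auto
  then show ?thesis using assms by (auto simp: incid_def)
qed

lemma incid_square: "incid \<sigma> \<tau> \<noteq> 0 \<Longrightarrow> incid \<sigma> \<tau> * incid \<sigma> \<tau> = 1"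
  by (auto simp: incid_def power_add[symmetric] simp flip: power_mult_distrib split: if_splits)

lemma abs_incid_le: "\<bar>incid \<sigma> \<tau>\<bar> \<le> 1"
  by (auto simp: incid_def power_abs)

text \<open>The sign rule behind the vanishing of double boundaries. For \<open>u < v\<close> the
  vertex \<open>u\<close> shifts the position of \<open>v\<close> by one, while \<open>v\<close>
  does not shift \<open>u\<close>; so the two ways down to \<open>\<rho>\<close> differ by one
  sign.\<close>

lemma incid_swap:
  assumes "finite \<rho>" "u \<notin> \<rho>" "v \<notin> \<rho>" "u \<noteq> v"
  shows "incid (insert u (insert v \<rho>)) (insert u \<rho>) * incid (insert u \<rho>) \<rho>
       = - (incid (insert u (insert v \<rho>)) (insert v \<rho>) * incid (insert v \<rho>) \<rho>)"
  using assms
proof (induction u v rule: linorder_wlog)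
  case (le u v)
  have e1: "{y \<in> insert u \<rho>. y < v} = insert u {y \<in> \<rho>. y < v}" using le by auto
  have e2: "{y \<in> insert v \<rho>. y < u} = {y \<in> \<rho>. y < u}" using le by auto
  have a: "incid (insert u (insert v \<rho>)) (insert u \<rho>) = - ((-1) ^ card {y \<in> \<rho>. y < v})"
    using incid_insert[of "insert u \<rho>" v] le unfolding e1 by (simp add: insert_commute)
  have b: "incid (insert u (insert v \<rho>)) (insert v \<rho>) = (-1) ^ card {y \<in> \<rho>. y < u}"
    using incid_insert[of "insert v \<rho>" u] le by (simp only: e2) auto
  show ?case using le by (simp add: a b incid_insert)
next
  case (sym v u)
  then show ?case by (simp add: insert_commute)
qed

text \<open>Cochains with values in an abelian group are represented by maps into functions \<open>'b \<Rightarrow> int\<close>, to be read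
  modulo a subgroup \<open>H\<close>. In \<open>cobd n d \<alpha>\<close> only the faces containing \<open>\<alpha>\<close> count, which is the coboundary in the link
  of \<open>\<alpha>\<close> up to sign.\<close>

definition cobd :: "nat \<Rightarrow> nat \<Rightarrow> nat set \<Rightarrow> (nat set \<Rightarrow> 'b \<Rightarrow> int) \<Rightarrow> nat set \<Rightarrow> 'b \<Rightarrow> int" where
  "cobd n d \<alpha> \<phi> \<sigma> = (\<lambda>x. \<Sum>\<tau> | \<tau> \<in> faces n (d - 1) \<and> \<alpha> \<subseteq> \<tau>. incid \<sigma> \<tau> * \<phi> \<tau> x)"

text \<open>An additive subgroup, encoded by closure under finite integer combinations. The index
  type is that of families of faces, since all combinations below run over faces.\<close>

definition zsubmod :: "('b \<Rightarrow> int) set \<Rightarrow> bool" where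
  "zsubmod H \<longleftrightarrow> (\<forall>(I :: nat set set) c a. finite I \<longrightarrow> (\<forall>i\<in>I. a i \<in> H)
     \<longrightarrow> (\<lambda>x. \<Sum>i\<in>I. c i * a i x) \<in> H)"

lemma zsubmodD: "zsubmod H \<Longrightarrow> finite I \<Longrightarrow> (\<And>i. i \<in> I \<Longrightarrow> a i \<in> H) \<Longrightarrow>
    (\<lambda>x. \<Sum>i\<in>I. c i * a i x) \<in> H" for I :: "nat set set"
  unfolding zsubmod_def by blast

lemma zsubmod_zero: "zsubmod H \<Longrightarrow> (\<lambda>x. 0) \<in> H"
  using zsubmodD[of H "{}"] by simp

lemma zsubmod_scale: "zsubmod H \<Longrightarrow> a \<in> H \<Longrightarrow> (\<lambda>x. k * a x) \<in> H"
  using zsubmodD[of H "{{}}" "\<lambda>_. a" "\<lambda>_. k"] by simp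

lemma zsubmod_add: "zsubmod H \<Longrightarrow> a \<in> H \<Longrightarrow> b \<in> H \<Longrightarrow> (\<lambda>x. k * a x + l * b x) \<in> H"
  \<comment> \<open>\<open>{}\<close> and \<open>{0}\<close> are just two distinct indices.\<close>
  using zsubmodD[of H "{{}, {0}}" "\<lambda>i. if i = {} then a else b" "\<lambda>i. if i = {} then k else l"]
  by simp

definition minimal_support :: "nat \<Rightarrow> nat \<Rightarrow> ('b \<Rightarrow> int) set \<Rightarrow> (nat set \<Rightarrow> 'b \<Rightarrow> int) \<Rightarrow> bool" where
  "minimal_support n d H \<phi> \<longleftrightarrow> (\<forall>\<psi>. card {\<tau> \<in> faces n (d - 1). \<phi> \<tau> \<notin> H} \<le>
      card {\<tau> \<in> faces n (d - 1). (\<lambda>x. \<phi> \<tau> x - (\<Sum>\<rho>\<in>faces n (d - 2). incid \<tau> \<rho> * \<psi> \<rho> x)) \<notin> H})"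

text \<open>Subtracting the coboundary of the cochain \<open>\<rho> \<mapsto> [v\<rho> : \<rho>] \<phi>(v\<rho>)\<close> clears the star of
  \<open>v\<close> inside the star of \<open>\<alpha>\<close> and leaves \<open>\<plusminus>(\<delta>\<^sub>\<alpha> \<phi>)(v\<tau>)\<close> at \<open>\<tau>\<close>; minimality compares the two supports.\<close>

lemma local_expansion_vertex:
  fixes \<phi> :: "nat set \<Rightarrow> 'b \<Rightarrow> int"
  assumes H: "zsubmod H" and d: "d \<ge> 2" and v: "v \<in> {0..<n} - \<alpha>"
    and min: "minimal_support n d H \<phi>"
  shows "card {\<tau> \<in> faces n (d - 1). \<alpha> \<subseteq> \<tau> \<and> \<phi> \<tau> \<notin> H}
    \<le> card {\<tau> \<in> faces n (d - 1). \<alpha> \<subseteq> \<tau> \<and> v \<notin> \<tau> \<and> cobd n d \<alpha> \<phi> (insert v \<tau>) \<notin> H}"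
proof -
  define \<psi> :: "nat set \<Rightarrow> 'b \<Rightarrow> int" where
    "\<psi> \<rho> x = (if \<alpha> \<subseteq> \<rho> \<and> v \<notin> \<rho> then incid (insert v \<rho>) \<rho> * \<phi> (insert v \<rho>) x else 0)" for \<rho> x
  define new where "new \<tau> = (\<lambda>x. \<phi> \<tau> x - (\<Sum>\<rho>\<in>faces n (d - 2). incid \<tau> \<rho> * \<psi> \<rho> x))" for \<tau>
  have mf: "\<tau> \<in> faces n (d - 1) \<longleftrightarrow> \<tau> \<subseteq> {0..<n} \<and> card \<tau> = d" for \<tau>
    using d by (auto simp: faces_def)
  note mfs = mf mf[unfolded One_nat_def]
  have mr: "\<rho> \<in> faces n (d - 2) \<longleftrightarrow> \<rho> \<subseteq> {0..<n} \<and> card \<rho> = d - 1" for \<rho>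
    using d by (auto simp: faces_def)
  have fin: "finite \<tau>" if "\<tau> \<subseteq> {0..<n}" for \<tau> :: "nat set" using that finite_subset by blast
  have out: "new \<tau> = \<phi> \<tau>" if "\<not> \<alpha> \<subseteq> \<tau>" for \<tau>
  proof -
    have "(\<Sum>\<rho>\<in>faces n (d - 2). incid \<tau> \<rho> * \<psi> \<rho> x) = 0" for x
    proof (intro sum.neutral ballI)
      fix \<rho>
      show "incid \<tau> \<rho> * \<psi> \<rho> x = 0"
        using that by (cases "\<rho> \<subseteq> \<tau>") (auto simp: \<psi>_def incid_not_subset)
    qed
    then show ?thesis by (auto simp: new_def)
  qed
  have inv: "new \<tau> \<in> H" if \<tau>: "\<tau> \<in> faces n (d - 1)" "\<alpha> \<subseteq> \<tau>" "v \<in> \<tau>" for \<tau>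
  proof -
    let ?r = "\<tau> - {v}"
    have r: "?r \<in> faces n (d - 2)" using \<tau> d by (auto simp: mfs mr fin)
    have ne: "incid \<tau> ?r \<noteq> 0" using \<tau> d by (auto simp: incid_nonzero mfs fin)
    have "(\<Sum>\<rho>\<in>faces n (d - 2). incid \<tau> \<rho> * \<psi> \<rho> x) = \<phi> \<tau> x" for x
    proof -
      have "(\<Sum>\<rho>\<in>faces n (d - 2). incid \<tau> \<rho> * \<psi> \<rho> x) = (\<Sum>\<rho>\<in>{?r}. incid \<tau> \<rho> * \<psi> \<rho> x)"
      proof (rule sum.mono_neutral_right)
        show "\<forall>\<rho>\<in>faces n (d - 2) - {?r}. incid \<tau> \<rho> * \<psi> \<rho> x = 0"
        proof
          fix \<rho> assume \<rho>: "\<rho> \<in> faces n (d - 2) - {?r}"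
          have "v \<in> \<rho> \<or> \<not> \<rho> \<subseteq> \<tau>"
          proof (rule ccontr)
            assume "\<not> (v \<in> \<rho> \<or> \<not> \<rho> \<subseteq> \<tau>)"
            then have "\<rho> \<subseteq> ?r" by auto
            then show False using \<rho> r face_subset_eq by blast
          qed
          then show "incid \<tau> \<rho> * \<psi> \<rho> x = 0"
            by (cases "\<rho> \<subseteq> \<tau>") (auto simp: \<psi>_def incid_not_subset)
        qed
      qed (use r in auto)
      also have "\<dots> = (incid \<tau> ?r * incid \<tau> ?r) * \<phi> \<tau> x"
        using \<tau> v by (auto simp: \<psi>_def insert_absorb)
      finally show ?thesis using incid_square[OF ne] by simp
    qed
    then have "new \<tau> = (\<lambda>x. 0)" by (auto simp: new_def)
    then show ?thesis using zsubmod_zero[OF H] by simp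
  qed
  have offv: "new \<tau> = (\<lambda>x. incid (insert v \<tau>) \<tau> * cobd n d \<alpha> \<phi> (insert v \<tau>) x)"
    if \<tau>: "\<tau> \<in> faces n (d - 1)" "\<alpha> \<subseteq> \<tau>" "v \<notin> \<tau>" for \<tau>
  proof
    fix x
    let ?s = "insert v \<tau>"
    have ne: "incid ?s \<tau> \<noteq> 0" using \<tau> by (auto simp: incid_nonzero mfs fin)
    let ?A = "{\<tau>'. \<tau>' \<in> faces n (d - 1) \<and> \<alpha> \<subseteq> \<tau>'}"
    let ?R = "{\<rho> \<in> faces n (d - 2). \<alpha> \<subseteq> \<rho> \<and> v \<notin> \<rho>}"
    let ?f = "\<lambda>\<tau>'. incid ?s \<tau>' * \<phi> \<tau>' x"
    have "cobd n d \<alpha> \<phi> ?s x = sum ?f ?A" by (simp add: cobd_def)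
    also have "\<dots> = sum ?f {\<tau>'\<in>?A. v \<in> \<tau>'} + sum ?f {\<tau>'\<in>?A. v \<notin> \<tau>'}"
      by (subst sum.union_disjoint[symmetric]) (auto intro!: sum.cong)
    also have "sum ?f {\<tau>'\<in>?A. v \<notin> \<tau>'} = sum ?f {\<tau>}"
    proof (rule sum.mono_neutral_right)
      show "\<forall>\<tau>'\<in>{\<tau>'\<in>?A. v \<notin> \<tau>'} - {\<tau>}. ?f \<tau>' = 0"
      proof
        fix \<tau>' assume t: "\<tau>' \<in> {\<tau>'\<in>?A. v \<notin> \<tau>'} - {\<tau>}"
        have "\<not> \<tau>' \<subseteq> ?s" using t \<tau> face_subset_eq[of \<tau>' n "d - 1" \<tau>] by auto
        then show "?f \<tau>' = 0" by (simp add: incid_not_subset)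
      qed
    qed (use \<tau> in auto)
    also have "sum ?f {\<tau>'\<in>?A. v \<in> \<tau>'} = sum (\<lambda>\<rho>. ?f (insert v \<rho>)) ?R"
    proof (rule sum.reindex_bij_witness[of _ "insert v" "\<lambda>\<tau>'. \<tau>' - {v}"])
      fix a assume "a \<in> {\<tau>' \<in> ?A. v \<in> \<tau>'}"
      then show "insert v (a - {v}) = a" "a - {v} \<in> ?R" using v by (auto simp: mfs mr fin)
      show "?f (insert v (a - {v})) = ?f a" using \<open>insert v (a - {v}) = a\<close> by simp
    next
      fix b assume b: "b \<in> ?R"
      then show "insert v b - {v} = b" by auto
      show "insert v b \<in> {\<tau>' \<in> ?A. v \<in> \<tau>'}" using b v d by (auto simp: mfs mr fin)
    qed
    \<comment> \<open>The faces of \<open>insert v \<tau>\<close> through \<open>v\<close> are the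
      cones \<open>insert v \<rho>\<close>; \<open>incid_swap\<close> turns each of their terms into
      a term of the coboundary of \<open>\<psi>\<close> at \<open>\<tau>\<close>, up to a sign
      common to all.\<close>
    also have "\<dots> = sum (\<lambda>\<rho>. - (incid ?s \<tau> * (incid \<tau> \<rho> * \<psi> \<rho> x))) ?R"
    proof (rule sum.cong[OF refl])
      fix \<rho> assume \<rho>: "\<rho> \<in> ?R"
      show "?f (insert v \<rho>) = - (incid ?s \<tau> * (incid \<tau> \<rho> * \<psi> \<rho> x))"
      proof (cases "\<rho> \<subseteq> \<tau>")
        case False
        then have "\<not> insert v \<rho> \<subseteq> ?s" using \<rho> by auto
        with False show ?thesis by (simp add: incid_not_subset)
      next
        case True
        have fr: "finite \<rho>" using \<rho> by (auto simp: mr fin)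
        have "card (\<tau> - \<rho>) = 1" using True \<rho> \<tau> d fr by (auto simp: mfs mr card_Diff_subset)
        then obtain u where u: "\<tau> - \<rho> = {u}" by (auto simp: card_1_singleton_iff)
        have t: "\<tau> = insert u \<rho>" "u \<notin> \<rho>" using u True by auto
        have "u \<noteq> v" using t \<tau> by auto
        have r: "incid ?s (insert v \<rho>) * incid (insert v \<rho>) \<rho> = - (incid ?s \<tau> * incid \<tau> \<rho>)"
          using incid_swap[OF fr, of v u] \<rho> t \<open>u \<noteq> v\<close> by auto
        have "incid (insert v \<rho>) \<rho> \<noteq> 0" using \<rho> fr by (auto simp: incid_nonzero)
        then have sq: "incid (insert v \<rho>) \<rho> * incid (insert v \<rho>) \<rho> = 1" by (rule incid_square)
        have "?f (insert v \<rho>) = incid ?s (insert v \<rho>)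
            * ((incid (insert v \<rho>) \<rho> * incid (insert v \<rho>) \<rho>) * \<phi> (insert v \<rho>) x)"
          unfolding sq by simp
        also have "\<dots> = (incid ?s (insert v \<rho>) * incid (insert v \<rho>) \<rho>)
            * (incid (insert v \<rho>) \<rho> * \<phi> (insert v \<rho>) x)"
          by (simp only: mult.assoc)
        finally have "?f (insert v \<rho>) = (incid ?s (insert v \<rho>) * incid (insert v \<rho>) \<rho>)
            * (incid (insert v \<rho>) \<rho> * \<phi> (insert v \<rho>) x)" .
        then show ?thesis using \<rho> by (simp add: r \<psi>_def)
      qed
    qed
    also have "\<dots> = - (incid ?s \<tau> * (\<Sum>\<rho>\<in>?R. incid \<tau> \<rho> * \<psi> \<rho> x))"
      by (simp add: sum_negf sum_distrib_left)
    also have "(\<Sum>\<rho>\<in>?R. incid \<tau> \<rho> * \<psi> \<rho> x) = (\<Sum>\<rho>\<in>faces n (d - 2). incid \<tau> \<rho> * \<psi> \<rho> x)"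
      by (rule sum.mono_neutral_left) (auto simp: \<psi>_def)
    finally have e: "cobd n d \<alpha> \<phi> ?s x = incid ?s \<tau> * new \<tau> x"
      by (simp add: new_def algebra_simps)
    have "incid ?s \<tau> * cobd n d \<alpha> \<phi> ?s x = (incid ?s \<tau> * incid ?s \<tau>) * new \<tau> x"
      unfolding e by simp
    then show "new \<tau> x = incid ?s \<tau> * cobd n d \<alpha> \<phi> ?s x"
      using incid_square[OF ne] by simp
  qed
  let ?S = "{\<tau> \<in> faces n (d - 1). \<phi> \<tau> \<notin> H}"
  let ?Sa = "{\<tau> \<in> faces n (d - 1). \<alpha> \<subseteq> \<tau> \<and> \<phi> \<tau> \<notin> H}"
  let ?B = "{\<tau> \<in> faces n (d - 1). \<alpha> \<subseteq> \<tau> \<and> v \<notin> \<tau> \<and> cobd n d \<alpha> \<phi> (insert v \<tau>) \<notin> H}"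
  have sub: "{\<tau> \<in> faces n (d - 1). new \<tau> \<notin> H} \<subseteq> (?S - ?Sa) \<union> ?B"
  proof
    fix \<tau> assume t: "\<tau> \<in> {\<tau> \<in> faces n (d - 1). new \<tau> \<notin> H}"
    show "\<tau> \<in> (?S - ?Sa) \<union> ?B"
    proof (cases "\<alpha> \<subseteq> \<tau>")
      case False then show ?thesis using t out[of \<tau>] by auto
    next
      case True
      then have "v \<notin> \<tau>" using t inv by auto
      moreover have "cobd n d \<alpha> \<phi> (insert v \<tau>) \<notin> H"
        using t offv[of \<tau>] True \<open>v \<notin> \<tau>\<close> zsubmod_scale[OF H] by auto
      ultimately show ?thesis using t True by auto
    qed
  qed
  have "card ?S \<le> card {\<tau> \<in> faces n (d - 1). new \<tau> \<notin> H}"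
    using min unfolding minimal_support_def new_def by blast
  also have "\<dots> \<le> card ((?S - ?Sa) \<union> ?B)" using sub by (intro card_mono) auto
  also have "\<dots> \<le> card (?S - ?Sa) + card ?B" by (rule card_Un_le)
  also have "card (?S - ?Sa) = card ?S - card ?Sa" by (rule card_Diff_subset) auto
  finally have "card ?S \<le> card ?S - card ?Sa + card ?B" .
  moreover have "card ?Sa \<le> card ?S" by (intro card_mono) auto
  ultimately show ?thesis by linarith
qed

text \<open>Averages \<open>local_expansion_vertex\<close> over all cone vertices \<open>v\<close>
  outside \<open>\<alpha>\<close>: a face \<open>\<sigma>\<close> of the star is reached at most
  once from each of its \<open>d + 1 - card \<alpha>\<close> vertices outside
  \<open>\<alpha>\<close>.\<close>

lemma local_expansion:
  fixes \<phi> :: "nat set \<Rightarrow> 'b \<Rightarrow> int"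
  assumes H: "zsubmod H" and d: "d \<ge> 2" and \<alpha>: "\<alpha> \<subseteq> {0..<n}"
    and min: "minimal_support n d H \<phi>"
  shows "(n - card \<alpha>) * card {\<tau> \<in> faces n (d - 1). \<alpha> \<subseteq> \<tau> \<and> \<phi> \<tau> \<notin> H}
    \<le> (d + 1 - card \<alpha>) * card {\<sigma> \<in> faces n d. \<alpha> \<subseteq> \<sigma> \<and> cobd n d \<alpha> \<phi> \<sigma> \<notin> H}"
proof -
  let ?Sa = "{\<tau> \<in> faces n (d - 1). \<alpha> \<subseteq> \<tau> \<and> \<phi> \<tau> \<notin> H}"
  let ?B = "\<lambda>v. {\<tau> \<in> faces n (d - 1). \<alpha> \<subseteq> \<tau> \<and> v \<notin> \<tau> \<and> cobd n d \<alpha> \<phi> (insert v \<tau>) \<notin> H}"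
  let ?U = "{\<sigma> \<in> faces n d. \<alpha> \<subseteq> \<sigma> \<and> cobd n d \<alpha> \<phi> \<sigma> \<notin> H}"
  let ?V = "{0..<n} - \<alpha>"
  have fa: "finite \<alpha>" using \<alpha> finite_subset by blast
  have "(n - card \<alpha>) * card ?Sa = (\<Sum>v\<in>?V. card ?Sa)"
    using \<alpha> fa by (simp add: card_Diff_subset)
  also have "\<dots> \<le> (\<Sum>v\<in>?V. card (?B v))"
    by (intro sum_mono local_expansion_vertex[OF H d _ min]) auto
  also have "\<dots> = card (SIGMA v:?V. ?B v)" by (subst card_SigmaI) auto
  also have "\<dots> \<le> card (SIGMA \<sigma>:?U. \<sigma> - \<alpha>)"
  proof (rule card_inj_on_le)
    show "inj_on (\<lambda>(v, \<tau>). (insert v \<tau>, v)) (SIGMA v:?V. ?B v)"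
      by (clarsimp simp: inj_on_def) (metis insert_ident)
    have ins: "insert v \<tau> \<in> faces n d" if "\<tau> \<in> faces n (d - 1)" "v < n" "v \<notin> \<tau>" for v \<tau>
      using that d face_finite[OF that(1)] by (auto simp: faces_def)
    show "(\<lambda>(v, \<tau>). (insert v \<tau>, v)) ` (SIGMA v:?V. ?B v) \<subseteq> (SIGMA \<sigma>:?U. \<sigma> - \<alpha>)"
      using ins by (auto simp del: One_nat_def)
    show "finite (SIGMA \<sigma>:?U. \<sigma> - \<alpha>)" using face_finite by (intro finite_SigmaI) auto
  qed
  also have "\<dots> = (\<Sum>\<sigma>\<in>?U. card (\<sigma> - \<alpha>))" using face_finite by (subst card_SigmaI) auto
  also have "\<dots> = (\<Sum>\<sigma>\<in>?U. d + 1 - card \<alpha>)"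
    by (intro sum.cong) (auto simp: card_Diff_subset fa faces_def)
  finally show ?thesis by (simp add: mult.commute)
qed

section \<open>Supports of cochains that obstruct the vanishing of homology\<close>

lemma incid_codim1:
  assumes "finite \<sigma>" "\<tau> \<subseteq> \<sigma>" "card \<sigma> = Suc (card \<tau>)"
  obtains u where "u \<notin> \<tau>" "\<sigma> = insert u \<tau>"
proof -
  have "card (\<sigma> - \<tau>) = 1" using assms finite_subset[of \<tau> \<sigma>] by (simp add: card_Diff_subset)
  then obtain u where "\<sigma> - \<tau> = {u}" by (auto simp: card_1_singleton_iff)
  then show thesis using that[of u] assms(2) by auto
qed

lemma boundary_boundary:
  assumes d: "d \<ge> 2" and \<sigma>: "\<sigma> \<in> faces n d" and \<rho>: "\<rho> \<in> faces n (d - 2)"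
  shows "(\<Sum>\<tau>\<in>faces n (d - 1). incid \<sigma> \<tau> * incid \<tau> \<rho>) = 0"
proof (cases "\<rho> \<subseteq> \<sigma>")
  case False
  then have "incid \<sigma> \<tau> * incid \<tau> \<rho> = 0" for \<tau>
    using incid_not_subset[of \<tau> \<sigma>] incid_not_subset[of \<rho> \<tau>] by fastforce
  then show ?thesis by (intro sum.neutral) blast
next
  case True
  have f: "finite \<sigma>" "finite \<rho>" using \<sigma> \<rho> face_finite by auto
  have c: "card \<sigma> = Suc d" "card \<rho> = d - 1" "\<sigma> \<subseteq> {0..<n}" using \<sigma> \<rho> d by (auto simp: faces_def)
  have "card (\<sigma> - \<rho>) = 2" using c f True d by (simp add: card_Diff_subset)
  then obtain u v where uv: "\<sigma> - \<rho> = {u, v}" "u \<noteq> v" by (auto simp: card_2_iff)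
  have s: "\<sigma> = insert u (insert v \<rho>)" "u \<notin> \<rho>" "v \<notin> \<rho>" using uv True by auto
  let ?f = "\<lambda>\<tau>. incid \<sigma> \<tau> * incid \<tau> \<rho>"
  have "(\<Sum>\<tau>\<in>faces n (d - 1). ?f \<tau>) = (\<Sum>\<tau>\<in>{insert u \<rho>, insert v \<rho>}. ?f \<tau>)"
  proof (rule sum.mono_neutral_right)
    show "{insert u \<rho>, insert v \<rho>} \<subseteq> faces n (d - 1)"
      using c s f d by (auto simp: faces_def)
    show "\<forall>\<tau>\<in>faces n (d - 1) - {insert u \<rho>, insert v \<rho>}. ?f \<tau> = 0"
    proof
      fix \<tau> assume t: "\<tau> \<in> faces n (d - 1) - {insert u \<rho>, insert v \<rho>}"
      show "?f \<tau> = 0"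
      proof (rule ccontr)
        assume "?f \<tau> \<noteq> 0"
        then have "incid \<sigma> \<tau> \<noteq> 0" "incid \<tau> \<rho> \<noteq> 0" by auto
        then have sub: "\<tau> \<subseteq> \<sigma>" "\<rho> \<subseteq> \<tau>" "card \<tau> = Suc (card \<rho>)" by (auto simp: incid_nonzero)
        obtain w where "w \<notin> \<rho>" "\<tau> = insert w \<rho>"
          using incid_codim1[of \<tau> \<rho>] sub t face_finite by blast
        then show False using t sub s by auto
      qed
    qed
  qed simp
  also have "\<dots> = ?f (insert u \<rho>) + ?f (insert v \<rho>)"
    using s uv(2) by (subst sum.insert) auto
  also have "\<dots> = 0" using incid_swap[of \<rho> u v] f s uv(2) by simp
  finally show ?thesis .
qed

text \<open>The boundaries of \<open>F\<close>, where chains that agree on the faces containing \<open>\<alpha>\<close> are identified.\<close>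

definition bd_span :: "nat \<Rightarrow> nat \<Rightarrow> nat set \<Rightarrow> nat set set \<Rightarrow> (nat set \<Rightarrow> int) set" where
  "bd_span n d \<alpha> F = {v. \<exists>b. \<forall>\<tau>\<in>faces n (d - 1). \<alpha> \<subseteq> \<tau> \<longrightarrow> v \<tau> = (\<Sum>\<sigma>\<in>F. b \<sigma> * incid \<sigma> \<tau>)}"

lemma zsubmod_bd_span: "zsubmod (bd_span n d \<alpha> F)"
  unfolding zsubmod_def
proof (intro allI impI)
  fix I :: "nat set set" and c :: "nat set \<Rightarrow> int" and a :: "nat set \<Rightarrow> nat set \<Rightarrow> int"
  assume "finite I" and "\<forall>i\<in>I. a i \<in> bd_span n d \<alpha> F"
  then have "\<forall>i\<in>I. \<exists>b. \<forall>\<tau>\<in>faces n (d - 1). \<alpha> \<subseteq> \<tau> \<longrightarrow> a i \<tau> = (\<Sum>\<sigma>\<in>F. b \<sigma> * incid \<sigma> \<tau>)"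
    by (auto simp: bd_span_def)
  then obtain b where b: "\<And>i \<tau>. i \<in> I \<Longrightarrow> \<tau> \<in> faces n (d - 1) \<Longrightarrow> \<alpha> \<subseteq> \<tau> \<Longrightarrow>
      a i \<tau> = (\<Sum>\<sigma>\<in>F. b i \<sigma> * incid \<sigma> \<tau>)"
    by metis
  have "(\<Sum>i\<in>I. c i * a i \<tau>) = (\<Sum>\<sigma>\<in>F. (\<Sum>i\<in>I. c i * b i \<sigma>) * incid \<sigma> \<tau>)"
    if "\<tau> \<in> faces n (d - 1)" "\<alpha> \<subseteq> \<tau>" for \<tau>
  proof -
    have "(\<Sum>i\<in>I. c i * a i \<tau>) = (\<Sum>i\<in>I. \<Sum>\<sigma>\<in>F. c i * (b i \<sigma> * incid \<sigma> \<tau>))"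
      using b that by (simp add: sum_distrib_left)
    also have "\<dots> = (\<Sum>\<sigma>\<in>F. \<Sum>i\<in>I. c i * (b i \<sigma> * incid \<sigma> \<tau>))" by (rule sum.swap)
    finally show ?thesis by (simp add: sum_distrib_right mult.assoc)
  qed
  then show "(\<lambda>x. \<Sum>i\<in>I. c i * a i x) \<in> bd_span n d \<alpha> F"
    unfolding bd_span_def
    by (intro CollectI exI[of _ "\<lambda>\<sigma>. \<Sum>i\<in>I. c i * b i \<sigma>"] ballI impI) blast
qed

lemma bd_span_mem:
  assumes "finite F" "f \<in> F"
  shows "incid f \<in> bd_span n d \<alpha> F"
proof -
  have "(\<Sum>\<sigma>\<in>F. (if \<sigma> = f then 1 else 0) * incid \<sigma> \<tau>) = (\<Sum>\<sigma>\<in>F. if \<sigma> = f then incid \<sigma> \<tau> else 0)" for \<tau>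
    by (rule sum.cong) auto
  then have "(\<Sum>\<sigma>\<in>F. (if \<sigma> = f then 1 else 0) * incid \<sigma> \<tau>) = incid f \<tau>" for \<tau>
    using assms by simp
  then show ?thesis
    unfolding bd_span_def by (intro CollectI exI[of _ "\<lambda>\<sigma>. if \<sigma> = f then 1 else 0"]) simp
qed

lemma bd_span_mono:
  assumes "F \<subseteq> F'" "finite F'"
  shows "bd_span n d \<alpha> F \<subseteq> bd_span n d \<alpha> F'"
proof
  fix v assume "v \<in> bd_span n d \<alpha> F"
  then obtain b where b: "\<forall>\<tau>\<in>faces n (d - 1). \<alpha> \<subseteq> \<tau> \<longrightarrow> v \<tau> = (\<Sum>\<sigma>\<in>F. b \<sigma> * incid \<sigma> \<tau>)"
    by (auto simp: bd_span_def)
  have "(\<Sum>\<sigma>\<in>F. b \<sigma> * incid \<sigma> \<tau>) = (\<Sum>\<sigma>\<in>F'. (if \<sigma> \<in> F then b \<sigma> else 0) * incid \<sigma> \<tau>)" for \<tau>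
    using assms by (intro sum.mono_neutral_cong_left) auto
  then show "v \<in> bd_span n d \<alpha> F'" using b unfolding bd_span_def
    by (intro CollectI exI[of _ "\<lambda>\<sigma>. if \<sigma> \<in> F then b \<sigma> else 0"]) auto
qed

lemma bd_span_cong:
  assumes "\<And>\<tau>. \<tau> \<in> faces n (d - 1) \<Longrightarrow> \<alpha> \<subseteq> \<tau> \<Longrightarrow> v \<tau> = w \<tau>"
  shows "v \<in> bd_span n d \<alpha> F \<longleftrightarrow> w \<in> bd_span n d \<alpha> F"
proof -
  have "(\<forall>\<tau>\<in>faces n (d - 1). \<alpha> \<subseteq> \<tau> \<longrightarrow> v \<tau> = s \<tau>) \<longleftrightarrow> (\<forall>\<tau>\<in>faces n (d - 1). \<alpha> \<subseteq> \<tau> \<longrightarrow> w \<tau> = s \<tau>)"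
    for s :: "nat set \<Rightarrow> int"
    by (intro ball_cong imp_cong refl) (simp only: assms)
  then show ?thesis by (simp add: bd_span_def)
qed

section \<open>Cones over the vertex 0 and the vanishing of homology\<close>

lemma incid_zero: "finite \<tau> \<Longrightarrow> 0 \<notin> \<tau> \<Longrightarrow> incid (insert 0 \<tau>) \<tau> = 1"
  by (simp add: incid_insert)

text \<open>The vertex \<open>0\<close> precedes all others, so coning moves every position up by
  one and reverses the sign.\<close>

lemma cone_incid:
  assumes "finite \<tau>" "0 \<notin> \<tau>" "0 \<notin> \<rho>"
  shows "incid (insert 0 \<tau>) (insert 0 \<rho>) = - incid \<tau> \<rho>"
proof (cases "\<rho> \<subseteq> \<tau> \<and> card \<tau> = Suc (card \<rho>)")
  case True
  then obtain u where u: "u \<notin> \<rho>" "\<tau> = insert u \<rho>" using incid_codim1 assms by metis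
  then have f: "finite \<rho>" using assms by auto
  have "u \<noteq> 0" using assms u by auto
  have a: "incid (insert u (insert 0 \<rho>)) (insert u \<rho>) = 1"
    using incid_zero[of \<tau>] assms u by (simp add: insert_commute)
  have b: "incid (insert 0 \<rho>) \<rho> = 1" using incid_zero[of \<rho>] assms f by simp
  show ?thesis
    using incid_swap[OF f u(1) assms(3) \<open>u \<noteq> 0\<close>] unfolding a b u(2)
    by (simp add: insert_commute)
next
  case False
  have f: "finite \<rho>" if "\<rho> \<subseteq> \<tau>" using that assms finite_subset by blast
  have "incid \<tau> \<rho> = 0" using False incid_nonzero by blast
  moreover have "incid (insert 0 \<tau>) (insert 0 \<rho>) = 0"
  proof (rule ccontr)
    assume "incid (insert 0 \<tau>) (insert 0 \<rho>) \<noteq> 0"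
    then have *: "insert 0 \<rho> \<subseteq> insert 0 \<tau>" "card (insert 0 \<tau>) = Suc (card (insert 0 \<rho>))"
      by (auto simp: incid_nonzero)
    then have "\<rho> \<subseteq> \<tau>" using assms by auto
    then show False using False * f assms by auto
  qed
  ultimately show ?thesis by simp
qed

text \<open>A cycle \<open>c\<close> is the boundary of its cone over the vertex \<open>0\<close>.\<close>

lemma homology_vanishesI:
  assumes d: "d \<ge> 2" and n: "n \<ge> 1"
    and span: "\<And>\<sigma>. \<sigma> \<in> faces n d \<Longrightarrow> incid \<sigma> \<in> bd_span n d {} F"
  shows "homology_vanishes n d F"
  unfolding homology_vanishes_def
proof (intro allI impI)
  fix c :: "nat set \<Rightarrow> int"
  assume cyc: "\<forall>\<rho>\<in>faces n (d - 2). (\<Sum>\<tau>\<in>faces n (d - 1). c \<tau> * incid \<tau> \<rho>) = 0"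
  let ?I = "{\<tau> \<in> faces n (d - 1). 0 \<notin> \<tau>}"
  have fin: "finite \<tau>" if "\<tau> \<in> faces n (d - 1)" for \<tau> using that by (rule face_finite)
  have cone: "(\<Sum>\<tau>'\<in>?I. c \<tau>' * incid (insert 0 \<tau>') \<tau>) = c \<tau>" if t: "\<tau> \<in> faces n (d - 1)" for \<tau>
  proof (cases "0 \<in> \<tau>")
    case False
    have "(\<Sum>\<tau>'\<in>?I. c \<tau>' * incid (insert 0 \<tau>') \<tau>) = (\<Sum>\<tau>'\<in>{\<tau>}. c \<tau>' * incid (insert 0 \<tau>') \<tau>)"
    proof (rule sum.mono_neutral_right)
      show "\<forall>\<tau>'\<in>?I - {\<tau>}. c \<tau>' * incid (insert 0 \<tau>') \<tau> = 0"
      proof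
        fix \<tau>' assume t': "\<tau>' \<in> ?I - {\<tau>}"
        have "\<not> \<tau> \<subseteq> insert 0 \<tau>'" using t t' False face_subset_eq[of \<tau> n "d - 1" \<tau>'] by auto
        then show "c \<tau>' * incid (insert 0 \<tau>') \<tau> = 0" by (simp add: incid_not_subset)
      qed
    qed (use t False in auto)
    then show ?thesis using incid_zero[OF fin[OF t] False] by simp
  next
    case True
    \<comment> \<open>The cycle condition at \<open>\<rho>\<close> determines
      \<open>c \<tau>\<close>, because \<open>\<tau>\<close> is the only face through
      \<open>0\<close> that contains \<open>\<rho>\<close>.\<close>
    define \<rho> where "\<rho> = \<tau> - {0}"
    have r: "\<tau> = insert 0 \<rho>" "0 \<notin> \<rho>" using True by (auto simp: \<rho>_def)
    have fr: "finite \<rho>" using fin[OF t] by (simp add: \<rho>_def)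
    have rf: "\<rho> \<in> faces n (d - 2)" using t d fin[OF t] True by (auto simp: faces_def \<rho>_def)
    have "0 = (\<Sum>\<tau>\<in>faces n (d - 1). c \<tau> * incid \<tau> \<rho>)" using cyc rf by simp
    also have "\<dots> = (\<Sum>\<tau>'\<in>?I. c \<tau>' * incid \<tau>' \<rho>) + (\<Sum>\<tau>'\<in>{\<tau>'\<in>faces n (d - 1). 0 \<in> \<tau>'}. c \<tau>' * incid \<tau>' \<rho>)"
      by (subst sum.union_disjoint[symmetric]) (auto intro!: sum.cong)
    also have "(\<Sum>\<tau>'\<in>{\<tau>'\<in>faces n (d - 1). 0 \<in> \<tau>'}. c \<tau>' * incid \<tau>' \<rho>)
        = (\<Sum>\<tau>'\<in>{\<tau>}. c \<tau>' * incid \<tau>' \<rho>)"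
    proof (rule sum.mono_neutral_right)
      show "\<forall>\<tau>'\<in>{\<tau>'\<in>faces n (d - 1). 0 \<in> \<tau>'} - {\<tau>}. c \<tau>' * incid \<tau>' \<rho> = 0"
      proof
        fix \<tau>' assume t': "\<tau>' \<in> {\<tau>'\<in>faces n (d - 1). 0 \<in> \<tau>'} - {\<tau>}"
        have "\<not> \<rho> \<subseteq> \<tau>'" using t t' r face_subset_eq[of \<tau> n "d - 1" \<tau>'] by auto
        then show "c \<tau>' * incid \<tau>' \<rho> = 0" by (simp add: incid_not_subset)
      qed
    qed (use t True in auto)
    also have "\<dots> = c \<tau>" using incid_zero[OF fr r(2)] r by simp
    also have "(\<Sum>\<tau>'\<in>?I. c \<tau>' * incid \<tau>' \<rho>) = - (\<Sum>\<tau>'\<in>?I. c \<tau>' * incid (insert 0 \<tau>') \<tau>)"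
      unfolding sum_negf[symmetric]
    proof (rule sum.cong[OF refl])
      fix \<tau>' assume "\<tau>' \<in> ?I"
      then show "c \<tau>' * incid \<tau>' \<rho> = - (c \<tau>' * incid (insert 0 \<tau>') \<tau>)"
        using cone_incid[of \<tau>' \<rho>] fin[of \<tau>'] r by simp
    qed
    finally show ?thesis by simp
  qed
  have "(\<lambda>x. \<Sum>\<tau>'\<in>?I. c \<tau>' * incid (insert 0 \<tau>') x) \<in> bd_span n d {} F"
  proof (rule zsubmodD[OF zsubmod_bd_span])
    fix \<tau>' assume t: "\<tau>' \<in> ?I"
    then have "insert 0 \<tau>' \<in> faces n d" using n d fin[of \<tau>'] by (auto simp: faces_def)
    then show "incid (insert 0 \<tau>') \<in> bd_span n d {} F" by (rule span)
  qed simp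
  then have "c \<in> bd_span n d {} F" using bd_span_cong[of n d "{}" "\<lambda>x. \<Sum>\<tau>'\<in>?I. c \<tau>' * incid (insert 0 \<tau>') x" c F] cone
    by blast
  then show "\<exists>b. \<forall>\<tau>\<in>faces n (d - 1). (\<Sum>\<sigma>\<in>F. b \<sigma> * incid \<sigma> \<tau>) = c \<tau>"
    unfolding bd_span_def by (auto simp: eq_commute)
qed

text \<open>The boundary of any \<open>d\<close>-simplex through \<open>\<tau>\<close> is a cycle
  with a nonzero coefficient at \<open>\<tau>\<close>; if \<open>\<tau>\<close> is isolated, no
  boundary of a chain on \<open>F\<close> has one.\<close>

lemma homology_vanishes_imp_no_isolated:
  assumes d: "d \<ge> 2" and n: "n > d" and hv: "homology_vanishes n d F"
  shows "no_isolated n d F"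
  unfolding no_isolated_def
proof
  fix \<tau> assume t: "\<tau> \<in> faces n (d - 1)"
  have tc: "\<tau> \<subseteq> {0..<n}" "card \<tau> = d" using t d by (auto simp: faces_def)
  have ft: "finite \<tau>" using t by (rule face_finite)
  have "\<tau> \<noteq> {0..<n}" using tc n by auto
  then obtain v where "v \<in> {0..<n} - \<tau>" using tc by blast
  then have v: "v < n" "v \<notin> \<tau>" by auto
  let ?s = "insert v \<tau>"
  have s: "?s \<in> faces n d" using v tc ft by (auto simp: faces_def)
  have "\<forall>\<rho>\<in>faces n (d - 2). (\<Sum>\<tau>\<in>faces n (d - 1). incid ?s \<tau> * incid \<tau> \<rho>) = 0"
    using boundary_boundary[OF d s] by simp
  with hv obtain b where "\<forall>\<tau>\<in>faces n (d - 1). (\<Sum>\<sigma>\<in>F. b \<sigma> * incid \<sigma> \<tau>) = incid ?s \<tau>"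
    unfolding homology_vanishes_def by blast
  then have "(\<Sum>\<sigma>\<in>F. b \<sigma> * incid \<sigma> \<tau>) = incid ?s \<tau>" using t by blast
  moreover have "incid ?s \<tau> \<noteq> 0" using v ft by (auto simp: incid_nonzero)
  ultimately have "(\<Sum>\<sigma>\<in>F. b \<sigma> * incid \<sigma> \<tau>) \<noteq> 0" by simp
  then obtain \<sigma> where "\<sigma> \<in> F" "b \<sigma> * incid \<sigma> \<tau> \<noteq> 0" by (rule sum.not_neutral_contains_not_neutral)
  then show "\<exists>\<sigma>\<in>F. \<tau> \<subseteq> \<sigma>" using incid_nonzero[of \<sigma> \<tau>] by auto
qed

text \<open>The universal cochain \<open>\<tau> \<mapsto> [\<tau>]\<close> with values in the quotient of the \<open>(d-1)\<close>-chains by the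
  boundaries of \<open>F\<close>, here represented by chains and the subgroup \<open>bd_span n d {} F\<close>, is a cocycle on \<open>F\<close>.
  It is a global cocycle only if all boundaries of \<open>d\<close>-faces are boundaries of \<open>F\<close>.\<close>

lemma minimal_cochain:
  assumes d: "d \<ge> 2" and n: "n \<ge> 1" and F: "F \<subseteq> faces n d" and nv: "\<not> homology_vanishes n d F"
  obtains \<phi> :: "nat set \<Rightarrow> nat set \<Rightarrow> int" and H where "zsubmod H"
    "\<And>f. f \<in> F \<Longrightarrow> cobd n d {} \<phi> f \<in> H"
    "\<exists>\<sigma>\<in>faces n d. cobd n d {} \<phi> \<sigma> \<notin> H"
    "minimal_support n d H \<phi>"
proof -
  define H where "H = bd_span n d {} F"
  \<comment> \<open>\<open>P \<psi>\<close> is the universal cochain minus the coboundary of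
    \<open>\<psi>\<close>; its value at \<open>\<tau>\<close> is a chain, with \<open>x\<close> as
    its argument.\<close>
  define P :: "(nat set \<Rightarrow> nat set \<Rightarrow> int) \<Rightarrow> nat set \<Rightarrow> nat set \<Rightarrow> int" where
    "P \<psi> \<tau> = (\<lambda>x. (if x = \<tau> then 1 else 0) - (\<Sum>\<rho>\<in>faces n (d - 2). incid \<tau> \<rho> * \<psi> \<rho> x))" for \<psi> \<tau>
  have finF: "finite F" using F by (rule finite_subset) simp
  define N where "N \<psi> = card {\<tau> \<in> faces n (d - 1). P \<psi> \<tau> \<notin> H}" for \<psi>
  obtain \<psi>0 where \<psi>0: "\<And>\<psi>. N \<psi>0 \<le> N \<psi>"
    using ex_has_least_nat[of "\<lambda>_. True" undefined N] by blast
  define \<phi> where "\<phi> = P \<psi>0"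
  \<comment> \<open>The coboundary of the universal cochain at \<open>\<sigma>\<close> is the chain
    \<open>incid \<sigma>\<close>, the boundary of \<open>\<sigma>\<close>; the subtracted
    coboundary contributes nothing because double boundaries vanish.\<close>
  have cobd: "cobd n d {} \<phi> \<sigma> x = incid \<sigma> x" if s: "\<sigma> \<in> faces n d" and x: "x \<in> faces n (d - 1)" for \<sigma> x
  proof -
    have "cobd n d {} \<phi> \<sigma> x = (\<Sum>\<tau>\<in>faces n (d - 1). incid \<sigma> \<tau> * (if x = \<tau> then 1 else 0))
       - (\<Sum>\<tau>\<in>faces n (d - 1). \<Sum>\<rho>\<in>faces n (d - 2). incid \<sigma> \<tau> * (incid \<tau> \<rho> * \<psi>0 \<rho> x))"
      by (simp add: cobd_def \<phi>_def P_def right_diff_distrib sum_subtractf sum_distrib_left)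
    also have "(\<Sum>\<tau>\<in>faces n (d - 1). incid \<sigma> \<tau> * (if x = \<tau> then 1 else 0)) = incid \<sigma> x"
      using x by (simp add: if_distrib cong: if_cong)
    also have "(\<Sum>\<tau>\<in>faces n (d - 1). \<Sum>\<rho>\<in>faces n (d - 2). incid \<sigma> \<tau> * (incid \<tau> \<rho> * \<psi>0 \<rho> x))
       = (\<Sum>\<rho>\<in>faces n (d - 2). (\<Sum>\<tau>\<in>faces n (d - 1). incid \<sigma> \<tau> * incid \<tau> \<rho>) * \<psi>0 \<rho> x)"
      by (subst sum.swap) (simp add: sum_distrib_right mult.assoc)
    also have "\<dots> = 0" using boundary_boundary[OF d s] by simp
    finally show ?thesis by simp
  qed
  have cobH: "cobd n d {} \<phi> \<sigma> \<in> H \<longleftrightarrow> incid \<sigma> \<in> H" if "\<sigma> \<in> faces n d" for \<sigma>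
    unfolding H_def using cobd that by (intro bd_span_cong) auto
  show thesis
  proof (rule that[of H \<phi>])
    show "zsubmod H" unfolding H_def by (rule zsubmod_bd_span)
    show "cobd n d {} \<phi> f \<in> H" if "f \<in> F" for f
      using cobH[of f] that F bd_span_mem[OF finF that] by (auto simp: H_def)
    show "\<exists>\<sigma>\<in>faces n d. cobd n d {} \<phi> \<sigma> \<notin> H"
      using homology_vanishesI[OF d n, of F] nv cobH by (auto simp: H_def)
    \<comment> \<open>Subtracting the coboundary of a further \<open>\<psi>\<close> replaces
      \<open>\<psi>0\<close> by the sum of \<open>\<psi>0\<close> and \<open>\<psi>\<close>, so the
      choice of \<open>\<psi>0\<close> covers all competitors.\<close>
    have "(\<lambda>x. \<phi> \<tau> x - (\<Sum>\<rho>\<in>faces n (d - 2). incid \<tau> \<rho> * \<psi> \<rho> x)) = P (\<lambda>\<rho> x. \<psi>0 \<rho> x + \<psi> \<rho> x) \<tau>" for \<tau> \<psi>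
      by (auto simp: \<phi>_def P_def algebra_simps sum.distrib)
    then show "minimal_support n d H \<phi>"
      using \<psi>0 by (simp add: minimal_support_def N_def \<phi>_def)
  qed
qed

text \<open>If exactly one facet of \<open>\<sigma>\<close> has a nonzero value, the coboundary at
  \<open>\<sigma>\<close> is plus or minus that value and cannot vanish. Hence these faces are
  forbidden for \<open>F\<close>.\<close>

definition exposed :: "nat \<Rightarrow> nat \<Rightarrow> nat set set \<Rightarrow> nat set set" where
  "exposed n d S = {\<sigma> \<in> faces n d. card {\<tau> \<in> S. \<tau> \<subseteq> \<sigma>} = 1}"

text \<open>The cocycle condition on a face of the star of \<open>\<alpha>\<close> gives the
  condition localized at \<open>\<alpha>\<close> if all support elements below the face contain
  \<open>\<alpha>\<close>. The faces of the star that violate this are split off here; the others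
  are \<open>clean\<close>.\<close>

definition mixed :: "nat \<Rightarrow> nat \<Rightarrow> nat set \<Rightarrow> nat set set \<Rightarrow> nat set set" where
  "mixed n d \<alpha> S = {\<sigma> \<in> faces n d. \<alpha> \<subseteq> \<sigma> \<and> (\<exists>\<tau>\<in>S. \<tau> \<subseteq> \<sigma> \<and> \<not> \<alpha> \<subseteq> \<tau>)}"

definition clean :: "nat \<Rightarrow> nat \<Rightarrow> nat set \<Rightarrow> nat set set \<Rightarrow> nat set set" where
  "clean n d \<alpha> S = {\<sigma> \<in> faces n d. \<alpha> \<subseteq> \<sigma>} - mixed n d \<alpha> S"

text \<open>The clean faces whose addition to \<open>F\<close> would enlarge the group generated by
  the localized boundaries. Every other clean face has its localized coboundary forced to zero by
  \<open>F\<close>.\<close>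

definition fresh :: "nat \<Rightarrow> nat \<Rightarrow> nat set \<Rightarrow> nat set set \<Rightarrow> nat set set \<Rightarrow> nat set set" where
  "fresh n d \<alpha> S F = {\<sigma> \<in> clean n d \<alpha> S. incid \<sigma> \<notin> bd_span n d \<alpha> (F \<inter> clean n d \<alpha> S)}"

lemma zsubmod_incid_sum:
  assumes "zsubmod H" "finite A" "\<And>\<tau>. \<tau> \<in> A \<Longrightarrow> \<tau> \<subseteq> \<sigma> \<Longrightarrow> \<phi> \<tau> \<in> H"
  shows "(\<lambda>x. \<Sum>\<tau>\<in>A. incid \<sigma> \<tau> * \<phi> \<tau> x) \<in> H"
proof -
  have "(\<lambda>x. \<Sum>\<tau>\<in>A. incid \<sigma> \<tau> * (if \<tau> \<subseteq> \<sigma> then \<phi> \<tau> else (\<lambda>_. 0)) x) \<in> H"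
    using assms zsubmod_zero by (intro zsubmodD) auto
  moreover have "(\<lambda>x. \<Sum>\<tau>\<in>A. incid \<sigma> \<tau> * (if \<tau> \<subseteq> \<sigma> then \<phi> \<tau> else (\<lambda>_. 0)) x)
     = (\<lambda>x. \<Sum>\<tau>\<in>A. incid \<sigma> \<tau> * \<phi> \<tau> x)"
    by (intro ext sum.cong) (auto simp: incid_not_subset)
  ultimately show ?thesis by simp
qed

lemma cobd_split:
  "cobd n d {} \<phi> \<sigma> = (\<lambda>x. cobd n d \<alpha> \<phi> \<sigma> x + (\<Sum>\<tau> | \<tau> \<in> faces n (d - 1) \<and> \<not> \<alpha> \<subseteq> \<tau>. incid \<sigma> \<tau> * \<phi> \<tau> x))"
  unfolding cobd_def by (subst sum.union_disjoint[symmetric]) (auto intro!: sum.cong)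

text \<open>All conditions on the support \<open>S\<close> are free of the values of the cochain; this is what makes a
  union bound over supports possible for coefficients in an arbitrary abelian group.\<close>

lemma nonvanishing_support:
  assumes d: "d \<ge> 2" and n: "n \<ge> 1" and F: "F \<subseteq> faces n d" and nv: "\<not> homology_vanishes n d F"
  obtains S where "S \<subseteq> faces n (d - 1)" "S \<noteq> {}" "F \<inter> exposed n d S = {}"
    "\<And>\<alpha>. \<alpha> \<subseteq> {0..<n} \<Longrightarrow> (n - card \<alpha>) * card {\<tau> \<in> S. \<alpha> \<subseteq> \<tau>}
       \<le> (d + 1 - card \<alpha>) * (card (fresh n d \<alpha> S F) + card (mixed n d \<alpha> S))"
proof (rule minimal_cochain[OF assms])
  fix \<phi> :: "nat set \<Rightarrow> nat set \<Rightarrow> int" and H assume H: "zsubmod H"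
    and cF: "\<And>f. f \<in> F \<Longrightarrow> cobd n d {} \<phi> f \<in> H"
    and ne: "\<exists>\<sigma>\<in>faces n d. cobd n d {} \<phi> \<sigma> \<notin> H"
    and min: "minimal_support n d H \<phi>"
  define S where "S = {\<tau> \<in> faces n (d - 1). \<phi> \<tau> \<notin> H}"
  show thesis
  proof (rule that[of S])
    show "S \<subseteq> faces n (d - 1)" by (auto simp: S_def)
    show "S \<noteq> {}"
    proof
      assume "S = {}"
      then have "cobd n d {} \<phi> \<sigma> \<in> H" for \<sigma>
        unfolding cobd_def by (intro zsubmod_incid_sum[OF H]) (auto simp: S_def)
      then show False using ne by blast
    qed
    show "F \<inter> exposed n d S = {}"
    proof (rule ccontr)
      assume "F \<inter> exposed n d S \<noteq> {}"
      then obtain \<sigma> where s: "\<sigma> \<in> F" "card {\<tau> \<in> S. \<tau> \<subseteq> \<sigma>} = 1" "\<sigma> \<in> faces n d" by (auto simp: exposed_def)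
      then obtain \<tau> where t: "{\<tau> \<in> S. \<tau> \<subseteq> \<sigma>} = {\<tau>}" by (auto simp: card_1_singleton_iff)
      then have tS: "\<tau> \<in> S" "\<tau> \<subseteq> \<sigma>" by auto
      then have tf: "\<tau> \<in> faces n (d - 1)" "\<phi> \<tau> \<notin> H" by (auto simp: S_def)
      have i: "incid \<sigma> \<tau> \<noteq> 0" using tS tf s d by (auto simp: incid_nonzero faces_def)
      let ?r = "\<lambda>x. \<Sum>\<tau>'\<in>faces n (d - 1) - {\<tau>}. incid \<sigma> \<tau>' * \<phi> \<tau>' x"
      have r: "?r \<in> H" using t by (intro zsubmod_incid_sum[OF H]) (auto simp: S_def)
      have c: "cobd n d {} \<phi> \<sigma> x = incid \<sigma> \<tau> * \<phi> \<tau> x + ?r x" for x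
        using sum.remove[OF _ tf(1), of "\<lambda>\<tau>. incid \<sigma> \<tau> * \<phi> \<tau> x"] by (simp add: cobd_def)
      have "\<phi> \<tau> = (\<lambda>x. incid \<sigma> \<tau> * cobd n d {} \<phi> \<sigma> x + (- incid \<sigma> \<tau>) * ?r x)"
      proof
        fix x
        have "incid \<sigma> \<tau> * cobd n d {} \<phi> \<sigma> x + (- incid \<sigma> \<tau>) * ?r x = (incid \<sigma> \<tau> * incid \<sigma> \<tau>) * \<phi> \<tau> x"
          unfolding c by (simp add: algebra_simps)
        then show "\<phi> \<tau> x = incid \<sigma> \<tau> * cobd n d {} \<phi> \<sigma> x + (- incid \<sigma> \<tau>) * ?r x"
          using incid_square[OF i] by simp
      qed
      moreover have "(\<lambda>x. incid \<sigma> \<tau> * cobd n d {} \<phi> \<sigma> x + (- incid \<sigma> \<tau>) * ?r x) \<in> H"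
        using zsubmod_add[OF H cF[OF s(1)] r] .
      ultimately show False using tf by simp
    qed
    fix \<alpha> :: "nat set" assume \<alpha>: "\<alpha> \<subseteq> {0..<n}"
    let ?U = "{\<sigma> \<in> faces n d. \<alpha> \<subseteq> \<sigma> \<and> cobd n d \<alpha> \<phi> \<sigma> \<notin> H}"
    have loc: "cobd n d \<alpha> \<phi> f \<in> H" if f: "f \<in> F" "f \<in> clean n d \<alpha> S" for f
    proof -
      let ?r = "\<lambda>x. \<Sum>\<tau> | \<tau> \<in> faces n (d - 1) \<and> \<not> \<alpha> \<subseteq> \<tau>. incid f \<tau> * \<phi> \<tau> x"
      have "?r \<in> H" using f by (intro zsubmod_incid_sum[OF H]) (auto simp: S_def clean_def mixed_def)
      then have "(\<lambda>x. 1 * cobd n d {} \<phi> f x + (- 1) * ?r x) \<in> H" by (rule zsubmod_add[OF H cF[OF f(1)]])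
      moreover have "(\<lambda>x. 1 * cobd n d {} \<phi> f x + (- 1) * ?r x) = cobd n d \<alpha> \<phi> f"
        by (simp add: cobd_split[of n d \<phi> f \<alpha>])
      ultimately show ?thesis by simp
    qed
    \<comment> \<open>A clean face that is not fresh has a localized boundary generated by those of
      clean faces of \<open>F\<close>. Linearity carries the same combination over to the localized
      coboundary, which therefore lies in \<open>H\<close>.\<close>
    have "?U \<subseteq> fresh n d \<alpha> S F \<union> mixed n d \<alpha> S"
    proof
      fix \<sigma> assume s: "\<sigma> \<in> ?U"
      show "\<sigma> \<in> fresh n d \<alpha> S F \<union> mixed n d \<alpha> S"
      proof (rule ccontr)
        assume a: "\<sigma> \<notin> fresh n d \<alpha> S F \<union> mixed n d \<alpha> S"
        then have "incid \<sigma> \<in> bd_span n d \<alpha> (F \<inter> clean n d \<alpha> S)" using s by (auto simp: fresh_def clean_def)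
        then obtain b where b: "\<And>\<tau>. \<tau> \<in> faces n (d - 1) \<Longrightarrow> \<alpha> \<subseteq> \<tau> \<Longrightarrow>
            incid \<sigma> \<tau> = (\<Sum>f\<in>F \<inter> clean n d \<alpha> S. b f * incid f \<tau>)"
          by (auto simp: bd_span_def)
        have "cobd n d \<alpha> \<phi> \<sigma> = (\<lambda>x. \<Sum>f\<in>F \<inter> clean n d \<alpha> S. b f * cobd n d \<alpha> \<phi> f x)"
        proof
          fix x
          have "cobd n d \<alpha> \<phi> \<sigma> x = (\<Sum>\<tau> | \<tau> \<in> faces n (d - 1) \<and> \<alpha> \<subseteq> \<tau>.
              \<Sum>f\<in>F \<inter> clean n d \<alpha> S. b f * (incid f \<tau> * \<phi> \<tau> x))"
            unfolding cobd_def by (intro sum.cong) (auto simp: b sum_distrib_right mult.assoc)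
          also have "\<dots> = (\<Sum>f\<in>F \<inter> clean n d \<alpha> S. b f * cobd n d \<alpha> \<phi> f x)"
            by (subst sum.swap) (simp add: cobd_def sum_distrib_left)
          finally show "cobd n d \<alpha> \<phi> \<sigma> x = (\<Sum>f\<in>F \<inter> clean n d \<alpha> S. b f * cobd n d \<alpha> \<phi> f x)" .
        qed
        moreover have "\<dots> \<in> H" using F finite_subset[OF F] by (intro zsubmodD[OF H]) (auto simp: loc)
        ultimately show False using s by simp
      qed
    qed
    then have "card ?U \<le> card (fresh n d \<alpha> S F \<union> mixed n d \<alpha> S)"
      by (intro card_mono) (auto simp: fresh_def clean_def mixed_def)
    also have "\<dots> \<le> card (fresh n d \<alpha> S F) + card (mixed n d \<alpha> S)" by (rule card_Un_le)
    finally have U: "card ?U \<le> card (fresh n d \<alpha> S F) + card (mixed n d \<alpha> S)" .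
    have "{\<tau> \<in> S. \<alpha> \<subseteq> \<tau>} = {\<tau> \<in> faces n (d - 1). \<alpha> \<subseteq> \<tau> \<and> \<phi> \<tau> \<notin> H}" by (auto simp: S_def)
    then have "(n - card \<alpha>) * card {\<tau> \<in> S. \<alpha> \<subseteq> \<tau>} \<le> (d + 1 - card \<alpha>) * card ?U"
      using local_expansion[OF H d \<alpha> min] by simp
    also have "\<dots> \<le> (d + 1 - card \<alpha>) * (card (fresh n d \<alpha> S F) + card (mixed n d \<alpha> S))"
      using U by (rule mult_le_mono2)
    finally show "(n - card \<alpha>) * card {\<tau> \<in> S. \<alpha> \<subseteq> \<tau>}
       \<le> (d + 1 - card \<alpha>) * (card (fresh n d \<alpha> S F) + card (mixed n d \<alpha> S))" .
  qed
qed

section \<open>Random prefixes and chains of subgroups\<close>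

definition prefix :: "'a set \<Rightarrow> nat \<Rightarrow> 'a list set" where
  "prefix X m = {ys. length ys = m \<and> distinct ys \<and> set ys \<subseteq> X}"

lemma finite_prefix [simp]: "finite X \<Longrightarrow> finite (prefix X m)"
  unfolding prefix_def by (rule finite_subset[OF _ finite_lists_length_eq[of X m]]) auto

lemma prefix_0 [simp]: "prefix X 0 = {[]}"
  by (auto simp: prefix_def)

text \<open>Lists grow at the head, in line with the recursion of \<open>drops\<close>, so the
  newest face comes first. For the process only the set of entries matters.\<close>

lemma prefix_Suc: "prefix X (Suc m) = (\<lambda>(ys, y). y # ys) ` (SIGMA ys:prefix X m. X - set ys)"
proof
  show "prefix X (Suc m) \<subseteq> (\<lambda>(ys, y). y # ys) ` (SIGMA ys:prefix X m. X - set ys)"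
  proof
    fix zs assume z: "zs \<in> prefix X (Suc m)"
    then obtain y ys where "zs = y # ys" by (cases zs) (auto simp: prefix_def)
    then show "zs \<in> (\<lambda>(ys, y). y # ys) ` (SIGMA ys:prefix X m. X - set ys)"
      using z by (intro image_eqI[of _ _ "(ys, y)"]) (auto simp: prefix_def)
  qed
qed (auto simp: prefix_def)

lemma sum_prefix_Suc:
  fixes f :: "'a list \<Rightarrow> 'b::comm_monoid_add"
  assumes "finite X"
  shows "sum f (prefix X (Suc m)) = (\<Sum>ys\<in>prefix X m. \<Sum>y\<in>X - set ys. f (y # ys))"
proof -
  have "inj_on (\<lambda>(ys, y). y # ys) (SIGMA ys:prefix X m. X - set ys)" by (auto simp: inj_on_def)
  then have "sum f (prefix X (Suc m)) = (\<Sum>(ys, y)\<in>(SIGMA ys:prefix X m. X - set ys). f (y # ys))"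
    unfolding prefix_Suc by (subst sum.reindex) (auto simp: case_prod_beta o_def)
  also have "\<dots> = (\<Sum>ys\<in>prefix X m. \<Sum>y\<in>X - set ys. f (y # ys))"
    using assms by (intro sum.Sigma[symmetric]) auto
  finally show ?thesis .
qed

lemma card_Diff_prefix: "finite X \<Longrightarrow> ys \<in> prefix X m \<Longrightarrow> card (X - set ys) = card X - m"
  by (auto simp: prefix_def card_Diff_subset distinct_card)

lemma card_prefix: "finite X \<Longrightarrow> card (prefix X m) = (\<Prod>i<m. card X - i)"
proof (induction m)
  case (Suc m)
  have "card (prefix X (Suc m)) = (\<Sum>ys\<in>prefix X m. \<Sum>y\<in>X - set ys. 1)"
    using sum_prefix_Suc[OF Suc.prems, of "\<lambda>_. 1::nat" m] by simp
  also have "\<dots> = (\<Sum>ys\<in>prefix X m. card X - m)"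
    using Suc.prems by (intro sum.cong) (auto simp: card_Diff_prefix)
  finally show ?case using Suc by simp
qed simp

lemma prefix_avoid: "{ys \<in> prefix X m. set ys \<inter> B = {}} = prefix (X - B) m"
  by (auto simp: prefix_def)

text \<open>Without replacement, each factor (M - b - i) / (M - i) is at most 1 - b / M, the factor
  of sampling with replacement.\<close>

lemma card_avoid_le:
  assumes X: "finite X" and B: "B \<subseteq> X"
  shows "real (card {ys \<in> prefix X m. set ys \<inter> B = {}})
    \<le> exp (- (real (card B) * real m / real (card X))) * real (card (prefix X m))"
proof (cases "card X = 0")
  case True
  then have "B = {}" "X = {}" using X B by auto
  then show ?thesis by simp
next
  case False
  define M where "M = card X"
  define b where "b = card B"
  have bM: "b \<le> M" unfolding M_def b_def using X B by (intro card_mono)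
  have c: "card (X - B) = M - b" using X B finite_subset[of B X] by (simp add: M_def b_def card_Diff_subset)
  have step: "real (M - b - i) \<le> exp (- (real b / real M)) * real (M - i)" for i
  proof (cases "M - b - i = 0")
    case True then show ?thesis by simp
  next
    case False2: False
    have "real (M - b - i) = real (M - i) - real b" using False2 by simp
    also have "\<dots> \<le> real (M - i) - real b * (real (M - i) / real M)"
      using False mult_left_le[of "real (M - i) / real M" "real b"] by (simp add: M_def divide_le_eq)
    also have "\<dots> = (1 - real b / real M) * real (M - i)" by (simp add: algebra_simps)
    also have "\<dots> \<le> exp (- (real b / real M)) * real (M - i)"
      using exp_ge_add_one_self[of "- (real b / real M)"] by (intro mult_right_mono) auto
    finally show ?thesis .
  qed
  have "real (card {ys \<in> prefix X m. set ys \<inter> B = {}}) = (\<Prod>i<m. real (M - b - i))"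
    unfolding prefix_avoid using X by (simp add: card_prefix c)
  also have "\<dots> \<le> (\<Prod>i<m. exp (- (real b / real M)) * real (M - i))"
    by (intro prod_mono conjI step) simp
  also have "\<dots> = exp (- (real b * real m / real M)) * real (card (prefix X m))"
    using X by (simp add: card_prefix prod.distrib M_def flip: exp_of_nat_mult)
  finally show ?thesis by (simp add: M_def b_def)
qed

text \<open>Counts the entries that lie in the value of \<open>G\<close> on the set of earlier
  entries. For \<open>G = fresh n d \<alpha> S\<close> these are the steps at which the localized
  group of boundaries grows.\<close>

fun drops :: "('a set \<Rightarrow> 'a set) \<Rightarrow> 'a list \<Rightarrow> nat" where
  "drops G [] = 0"
| "drops G (y # ys) = drops G ys + (if y \<in> G (set ys) then 1 else 0)"

text \<open>An exponential supermartingale. While \<open>G\<close> has at least \<open>g\<close>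
  elements, the next entry hits it with probability at least g / M, with M the size of
  \<open>X\<close>, and a hit costs a third of the weight; so the mean weight loses a factor exp (-
  g / (3 M)) per step. As \<open>G\<close> decreases, being large at the end means being large
  throughout.\<close>

lemma sum_drops_le:
  assumes X: "finite X" "X \<noteq> {}"
    and anti: "\<And>Y Y'. Y \<subseteq> Y' \<Longrightarrow> Y' \<subseteq> X \<Longrightarrow> G Y' \<subseteq> G Y"
    and sub: "\<And>Y. Y \<subseteq> X \<Longrightarrow> G Y \<subseteq> X - Y" and g: "g \<ge> 0"
  shows "(\<Sum>ys | ys \<in> prefix X m \<and> g \<le> real (card (G (set ys))). (2/3::real) ^ drops G ys)
    \<le> exp (- (g * real m / (3 * real (card X)))) * real (card (prefix X m))"
proof (induction m)
  case 0
  have "{ys. ys \<in> prefix X 0 \<and> g \<le> real (card (G (set ys)))} \<subseteq> {[]}" by auto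
  then have "(\<Sum>ys | ys \<in> prefix X 0 \<and> g \<le> real (card (G (set ys))). (2/3::real) ^ drops G ys)
     \<le> (\<Sum>ys\<in>{[]}. (2/3::real) ^ drops G ys)" by (intro sum_mono2) auto
  then show ?case by simp
next
  case (Suc m)
  define M where "M = real (card X)"
  have M: "M > 0" using X by (simp add: M_def card_gt_0_iff)
  let ?P = "\<lambda>ys. g \<le> real (card (G (set ys)))"
  have step: "(\<Sum>y\<in>X - set ys. if ?P (y # ys) then (2/3::real) ^ drops G (y # ys) else 0)
     \<le> (if ?P ys then (2/3) ^ drops G ys * ((M - real m) * exp (- (g / (3 * M)))) else 0)"
    if ys: "ys \<in> prefix X m" for ys
  proof -
    have sX: "set ys \<subseteq> X" using ys by (auto simp: prefix_def)
    have Gs: "G (set ys) \<subseteq> X - set ys" using sub[OF sX] .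
    have mono: "?P ys" if "?P (y # ys)" "y \<in> X - set ys" for y
    proof -
      have "G (set (y # ys)) \<subseteq> G (set ys)" using that sX by (intro anti) auto
      then have "card (G (set (y # ys))) \<le> card (G (set ys))"
        using X Gs by (intro card_mono) (auto intro: finite_subset)
      then show ?thesis using that by linarith
    qed
    show ?thesis
    proof (cases "?P ys")
      case False
      then have "(\<Sum>y\<in>X - set ys. if ?P (y # ys) then (2/3::real) ^ drops G (y # ys) else 0) = 0"
        using mono by (intro sum.neutral) auto
      then show ?thesis using False by simp
    next
      case True
      have mM: "real m \<le> M" using ys X unfolding M_def prefix_def
        by (metis (mono_tags, lifting) card_mono distinct_card mem_Collect_eq of_nat_le_iff)
      have cX: "real (card (X - set ys)) = M - real m"
        using card_Diff_prefix[OF X(1) ys] mM by (simp add: M_def)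
      have "(\<Sum>y\<in>X - set ys. if ?P (y # ys) then (2/3::real) ^ drops G (y # ys) else 0)
         \<le> (\<Sum>y\<in>X - set ys. (2/3) ^ drops G ys * (1 - (if y \<in> G (set ys) then 1/3 else 0)))"
        by (intro sum_mono) auto
      also have "\<dots> = (2/3) ^ drops G ys * (\<Sum>y\<in>X - set ys. (1 - (if y \<in> G (set ys) then 1/3 else 0)))"
        by (simp add: sum_distrib_left)
      also have "(\<Sum>y\<in>X - set ys. (1 - (if y \<in> G (set ys) then 1/3 else 0::real)))
          = real (card (X - set ys)) - (\<Sum>y\<in>X - set ys. (if y \<in> G (set ys) then 1/3 else 0))"
        by (simp add: sum_subtractf)
      also have "(\<Sum>y\<in>X - set ys. (if y \<in> G (set ys) then 1/3 else 0::real)) = real (card (G (set ys))) / 3"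
        using X Gs by (simp add: sum.If_cases Int_absorb1)
      also have "real (card (X - set ys)) - real (card (G (set ys))) / 3 \<le> (M - real m) - g / 3"
        using True cX by simp
      also have "(M - real m) - g / 3 \<le> (M - real m) * (1 - g / (3 * M))"
      proof -
        have "g * (M - real m) \<le> g * M" using g by (intro mult_left_mono) auto
        then have "(M - real m) * (g / (3 * M)) \<le> g / 3" using M by (simp add: field_simps)
        then show ?thesis by (simp add: algebra_simps)
      qed
      also have "\<dots> \<le> (M - real m) * exp (- (g / (3 * M)))"
        using mM exp_ge_add_one_self[of "- (g / (3 * M))"] by (intro mult_left_mono) auto
      finally show ?thesis using True by simp
    qed
  qed
  have "(\<Sum>ys | ys \<in> prefix X (Suc m) \<and> ?P ys. (2/3::real) ^ drops G ys)
     = (\<Sum>ys\<in>prefix X (Suc m). if ?P ys then (2/3) ^ drops G ys else 0)"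
    using X by (simp add: sum.inter_filter[symmetric])
  also have "\<dots> = (\<Sum>ys\<in>prefix X m. \<Sum>y\<in>X - set ys. if ?P (y # ys) then (2/3) ^ drops G (y # ys) else 0)"
    by (rule sum_prefix_Suc[OF X(1)])
  also have "\<dots> \<le> (\<Sum>ys\<in>prefix X m. if ?P ys then (2/3) ^ drops G ys * ((M - real m) * exp (- (g / (3 * M)))) else 0)"
    by (intro sum_mono step)
  also have "\<dots> = (\<Sum>ys | ys \<in> prefix X m \<and> ?P ys. (2/3) ^ drops G ys) * ((M - real m) * exp (- (g / (3 * M))))"
    using X by (simp add: sum.inter_filter[symmetric] sum_distrib_right)
  finally have 1: "(\<Sum>ys | ys \<in> prefix X (Suc m) \<and> ?P ys. (2/3::real) ^ drops G ys)
    \<le> (\<Sum>ys | ys \<in> prefix X m \<and> ?P ys. (2/3) ^ drops G ys) * ((M - real m) * exp (- (g / (3 * M))))" .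
  show ?case
  proof (cases "m \<le> card X")
    \<comment> \<open>Beyond \<open>card X\<close> steps no prefix is left, and the factor
      \<open>M - real m\<close> would be negative.\<close>
    case False
    then have "card (prefix X (Suc m)) = 0" using X by (auto simp: card_prefix intro!: bexI[of _ "card X"])
    then have "prefix X (Suc m) = {}" using X by simp
    then show ?thesis by simp
  next
    case True
    have "(\<Sum>ys | ys \<in> prefix X m \<and> ?P ys. (2/3) ^ drops G ys) * ((M - real m) * exp (- (g / (3 * M))))
      \<le> (exp (- (g * real m / (3 * M))) * real (card (prefix X m))) * ((M - real m) * exp (- (g / (3 * M))))"
      using Suc True by (intro mult_right_mono) (auto simp: M_def)
    also have "\<dots> = (exp (- (g * real m / (3 * M))) * exp (- (g / (3 * M)))) * (real (card (prefix X m)) * (M - real m))"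
      by simp
    also have "exp (- (g * real m / (3 * M))) * exp (- (g / (3 * M))) = exp (- (g * real (Suc m) / (3 * M)))"
      unfolding exp_add[symmetric] by (simp add: add_divide_distrib ring_distribs)
    also have "real (card (prefix X m)) * (M - real m) = real (card (prefix X (Suc m)))"
      using True X by (simp add: card_prefix M_def)
    finally show ?thesis using 1 by (simp add: M_def)
  qed
qed

text \<open>A cap on the number of drops gives every prefix a weight of at least
  \<open>1 / K\<close>, which turns the weighted sum of \<open>sum_drops_le\<close> into a
  count.\<close>

lemma card_drops_le:
  assumes X: "finite X" "X \<noteq> {}"
    and anti: "\<And>Y Y'. Y \<subseteq> Y' \<Longrightarrow> Y' \<subseteq> X \<Longrightarrow> G Y' \<subseteq> G Y"
    and sub: "\<And>Y. Y \<subseteq> X \<Longrightarrow> G Y \<subseteq> X - Y" and g: "g \<ge> 0"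
    and K: "\<And>ys. ys \<in> prefix X m \<Longrightarrow> (3/2) ^ drops G ys \<le> K"
  shows "real (card {ys \<in> prefix X m. g \<le> real (card (G (set ys)))})
    \<le> K * exp (- (g * real m / (3 * real (card X)))) * real (card (prefix X m))"
proof -
  let ?Q = "{ys. ys \<in> prefix X m \<and> g \<le> real (card (G (set ys)))}"
  have w: "1 \<le> K * (2/3::real) ^ drops G ys" if "ys \<in> prefix X m" for ys
  proof -
    have "1 = (3/2) ^ drops G ys * (2/3::real) ^ drops G ys" by (simp flip: power_mult_distrib)
    also have "\<dots> \<le> K * (2/3::real) ^ drops G ys" using K[OF that] by (intro mult_right_mono) auto
    finally show ?thesis .
  qed
  show ?thesis
  proof (cases "prefix X m = {}")
    case True then show ?thesis by simp
  next
    case False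
    then obtain ys0 where "ys0 \<in> prefix X m" by blast
    then have "(3/2) ^ drops G ys0 \<le> K" by (rule K)
    then have K0: "K \<ge> 0" by (rule order_trans[rotated]) simp
    have "real (card ?Q) = (\<Sum>ys\<in>?Q. 1)" by simp
    also have "\<dots> \<le> (\<Sum>ys\<in>?Q. K * (2/3::real) ^ drops G ys)" using w by (intro sum_mono) auto
    also have "\<dots> = K * (\<Sum>ys\<in>?Q. (2/3::real) ^ drops G ys)" by (simp add: sum_distrib_left)
    also have "\<dots> \<le> K * (exp (- (g * real m / (3 * real (card X)))) * real (card (prefix X m)))"
      by (intro mult_left_mono sum_drops_le[OF X anti sub g] K0)
    finally show ?thesis by (simp add: mult.assoc)
  qed
qed

lemma drops_Union_le:
  "finite A \<Longrightarrow> drops (\<lambda>Y. \<Union>a\<in>A. G a Y) ys \<le> (\<Sum>a\<in>A. drops (G a) ys)"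
proof (induction ys)
  case (Cons y ys)
  have "(if y \<in> (\<Union>a\<in>A. G a (set ys)) then 1 else 0) \<le> (\<Sum>a\<in>A. if y \<in> G a (set ys) then 1 else 0::nat)"
  proof (cases "y \<in> (\<Union>a\<in>A. G a (set ys))")
    case True
    then obtain a where "a \<in> A" "y \<in> G a (set ys)" by blast
    then show ?thesis using Cons.prems
      using member_le_sum[of a A "\<lambda>a. if y \<in> G a (set ys) then 1 else 0::nat"] by simp
  qed simp
  then show ?case using Cons by (simp add: sum.distrib)
qed simp

section \<open>Counting integer vectors of bounded norm\<close>

lemma sum_geometric_abs_le:
  assumes "0 < x" "x < (1::real)"
  shows "(\<Sum>z\<in>{-int s..int s}. x ^ nat \<bar>z\<bar>) \<le> 2 / (1 - x)"
proof -
  have geo: "(\<Sum>k\<le>s. x ^ k) \<le> 1 / (1 - x)"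
  proof -
    have "(1 - x) * (\<Sum>k\<le>s. x ^ k) \<le> 1" using assms sum_gp_basic[of x s] by simp
    then show ?thesis using assms by (simp add: pos_le_divide_eq mult.commute)
  qed
  have "{-int s..int s} \<subseteq> int ` {..s} \<union> (\<lambda>k. - int k) ` {..s}"
  proof
    fix z assume z: "z \<in> {-int s..int s}"
    show "z \<in> int ` {..s} \<union> (\<lambda>k. - int k) ` {..s}"
    proof (cases "z \<ge> 0")
      case True then have "z = int (nat z)" "nat z \<le> s" using z by auto
      then show ?thesis by blast
    next
      case False then have "z = - int (nat (- z))" "nat (- z) \<le> s" using z by auto
      then show ?thesis by blast
    qed
  qed
  then have "(\<Sum>z\<in>{-int s..int s}. x ^ nat \<bar>z\<bar>) \<le> (\<Sum>z\<in>int ` {..s} \<union> (\<lambda>k. - int k) ` {..s}. x ^ nat \<bar>z\<bar>)"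
    using assms by (intro sum_mono2) auto
  also have "\<dots> \<le> (\<Sum>z\<in>int ` {..s}. x ^ nat \<bar>z\<bar>) + (\<Sum>z\<in>(\<lambda>k. - int k) ` {..s}. x ^ nat \<bar>z\<bar>)"
    using assms by (subst sum_Un) (auto intro!: sum_nonneg)
  also have "\<dots> = (\<Sum>k\<le>s. x ^ k) + (\<Sum>k\<le>s. x ^ k)"
    by (subst (1 2) sum.reindex) (auto simp: inj_on_def)
  finally show ?thesis using geo by simp
qed

text \<open>Generating function bound: a vector of norm at most \<open>s\<close> contributes at
  least \<open>x ^ s\<close> to the product, over the coordinates, of the sums of x^|z|.\<close>

lemma card_l1_ball_le:
  fixes Q :: "('a \<Rightarrow> int) set"
  assumes I: "finite I" and x: "0 < x" "x < (1::real)"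
    and Q: "\<And>q. q \<in> Q \<Longrightarrow> (\<Sum>\<tau>\<in>I. \<bar>q \<tau>\<bar>) \<le> int s" "\<And>q \<tau>. q \<in> Q \<Longrightarrow> \<tau> \<notin> I \<Longrightarrow> q \<tau> = 0"
  shows "real (card Q) * x ^ s \<le> (2 / (1 - x)) ^ card I"
proof -
  let ?P = "PiE I (\<lambda>_. {-int s..int s})"
  have inj: "inj_on (\<lambda>q. restrict q I) Q"
  proof (rule inj_onI)
    fix p q assume a: "p \<in> Q" "q \<in> Q" "restrict p I = restrict q I"
    show "p = q"
    proof
      fix \<tau> show "p \<tau> = q \<tau>" using Q(2)[OF a(1), of \<tau>] Q(2)[OF a(2), of \<tau>] fun_cong[OF a(3), of \<tau>]
        by (cases "\<tau> \<in> I") simp_all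
    qed
  qed
  have sub: "(\<lambda>q. restrict q I) ` Q \<subseteq> ?P"
  proof (rule image_subsetI)
    fix q assume q: "q \<in> Q"
    have "\<bar>q \<tau>\<bar> \<le> int s" if "\<tau> \<in> I" for \<tau>
      using member_le_sum[OF that, of "\<lambda>\<tau>. \<bar>q \<tau>\<bar>"] I Q(1)[OF q] by simp
    then show "restrict q I \<in> ?P" by (force simp: abs_le_iff)
  qed
  have fP: "finite ?P" using I by (intro finite_PiE) auto
  have fQ: "finite Q" using finite_imageD[OF finite_subset[OF sub fP] inj] .
  have w: "x ^ s \<le> (\<Prod>\<tau>\<in>I. x ^ nat \<bar>q \<tau>\<bar>)" if q: "q \<in> Q" for q
  proof -
    have "int (\<Sum>\<tau>\<in>I. nat \<bar>q \<tau>\<bar>) = (\<Sum>\<tau>\<in>I. \<bar>q \<tau>\<bar>)" by simp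
    then have "(\<Sum>\<tau>\<in>I. nat \<bar>q \<tau>\<bar>) \<le> s" using Q(1)[OF q] by linarith
    then have "x ^ s \<le> x ^ (\<Sum>\<tau>\<in>I. nat \<bar>q \<tau>\<bar>)" using x by (intro power_decreasing) auto
    then show ?thesis by (simp add: power_sum)
  qed
  have "real (card Q) * x ^ s = (\<Sum>q\<in>Q. x ^ s)" by simp
  also have "\<dots> \<le> (\<Sum>q\<in>Q. \<Prod>\<tau>\<in>I. x ^ nat \<bar>q \<tau>\<bar>)" using w by (intro sum_mono)
  also have "\<dots> = (\<Sum>q\<in>Q. \<Prod>\<tau>\<in>I. x ^ nat \<bar>restrict q I \<tau>\<bar>)" by (intro sum.cong prod.cong) auto
  also have "\<dots> = (\<Sum>p\<in>(\<lambda>q. restrict q I) ` Q. \<Prod>\<tau>\<in>I. x ^ nat \<bar>p \<tau>\<bar>)"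
    by (subst sum.reindex[OF inj]) simp
  also have "\<dots> \<le> (\<Sum>p\<in>?P. \<Prod>\<tau>\<in>I. x ^ nat \<bar>p \<tau>\<bar>)"
    using sub fP x by (intro sum_mono2) (auto intro!: prod_nonneg)
  also have "\<dots> = (\<Prod>\<tau>\<in>I. \<Sum>z\<in>{-int s..int s}. x ^ nat \<bar>z\<bar>)"
    using I by (subst prod_sum_PiE) auto
  also have "\<dots> \<le> (\<Prod>\<tau>\<in>I. 2 / (1 - x))"
    using sum_geometric_abs_le[OF x] x by (intro prod_mono) (auto intro!: sum_nonneg)
  finally show ?thesis by simp
qed

abbreviation costar :: "nat \<Rightarrow> nat \<Rightarrow> nat set \<Rightarrow> nat set set" where
  "costar n d \<alpha> \<equiv> {\<tau> \<in> faces n (d - 1). \<alpha> \<subseteq> \<tau>}"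

lemma sum_abs_incid_le:
  assumes d: "d \<ge> 1" and \<sigma>: "\<sigma> \<in> faces n d"
  shows "(\<Sum>\<tau>\<in>costar n d \<alpha>. \<bar>incid \<sigma> \<tau>\<bar>) \<le> int (d + 1)"
proof -
  let ?T = "{\<tau>. \<tau> \<subseteq> \<sigma> \<and> card \<tau> = d}"
  have f: "finite \<sigma>" "card \<sigma> = Suc d" using face_finite[OF \<sigma>] \<sigma> by (auto simp: faces_def)
  have fT: "finite ?T" using f by auto
  have "(\<Sum>\<tau>\<in>costar n d \<alpha>. \<bar>incid \<sigma> \<tau>\<bar>) \<le> (\<Sum>\<tau>\<in>costar n d \<alpha>. if \<tau> \<in> ?T then 1 else 0)"
  proof (rule sum_mono)
    fix \<tau> assume "\<tau> \<in> costar n d \<alpha>"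
    then have "card \<tau> = d" using d by (auto simp: faces_def)
    then show "\<bar>incid \<sigma> \<tau>\<bar> \<le> (if \<tau> \<in> ?T then 1 else 0)"
      using abs_incid_le[of \<sigma> \<tau>] by (cases "\<tau> \<subseteq> \<sigma>") (simp_all add: incid_not_subset)
  qed
  also have "\<dots> = int (card (costar n d \<alpha> \<inter> ?T))" by (simp add: sum.If_cases)
  also have "\<dots> \<le> int (card ?T)" using fT by (simp add: card_mono)
  also have "card ?T = d + 1" using n_subsets[OF f(1), of d] f by simp
  finally show ?thesis .
qed

text \<open>The \<open>2 ^ t\<close> subset sums of the vectors added at the \<open>t\<close> drops are pairwise distinct, because each of these
  vectors lies outside the subgroup generated by its predecessors; but all of them have small norm.\<close>

lemma drops_subset_sums:
  assumes d: "d \<ge> 1" and ys: "set ys \<subseteq> faces n d"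
  shows "\<exists>Q. finite Q \<and> card Q = 2 ^ drops (fresh n d \<alpha> S) ys \<and> Q \<subseteq> bd_span n d \<alpha> (set ys \<inter> clean n d \<alpha> S)
    \<and> (\<forall>q\<in>Q. (\<forall>\<tau>. \<tau> \<notin> costar n d \<alpha> \<longrightarrow> q \<tau> = 0)
         \<and> (\<Sum>\<tau>\<in>costar n d \<alpha>. \<bar>q \<tau>\<bar>) \<le> int ((d + 1) * drops (fresh n d \<alpha> S) ys))"
  using ys
proof (induction ys)
  case Nil
  show ?case
    by (intro exI[of _ "{\<lambda>_. 0}"]) (auto simp: bd_span_def)
next
  case (Cons y ys)
  let ?G = "fresh n d \<alpha> S" and ?I = "costar n d \<alpha>"
  let ?L = "bd_span n d \<alpha> (set ys \<inter> clean n d \<alpha> S)" and ?L' = "bd_span n d \<alpha> (set (y # ys) \<inter> clean n d \<alpha> S)"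
  have LL': "?L \<subseteq> ?L'" by (rule bd_span_mono) auto
  obtain Q where Q: "finite Q" "card Q = 2 ^ drops ?G ys" "Q \<subseteq> ?L"
    and Q0: "\<And>q \<tau>. q \<in> Q \<Longrightarrow> \<tau> \<notin> ?I \<Longrightarrow> q \<tau> = 0"
    and Q1: "\<And>q. q \<in> Q \<Longrightarrow> (\<Sum>\<tau>\<in>?I. \<bar>q \<tau>\<bar>) \<le> int ((d + 1) * drops ?G ys)"
    using Cons by auto
  show ?case
  proof (cases "y \<in> ?G (set ys)")
    case False
    then show ?thesis using Q Q0 Q1 LL' by (intro exI[of _ Q]) auto
  next
    case True
    then have yS: "y \<in> clean n d \<alpha> S" "y \<in> faces n d" and yL: "incid y \<notin> ?L"
      by (auto simp: fresh_def clean_def)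
    \<comment> \<open>Cutting the boundary of \<open>y\<close> off outside the star of
      \<open>\<alpha>\<close> does not affect membership in the spans, and it keeps the subset sums
      supported on \<open>costar n d \<alpha>\<close>.\<close>
    define v where "v \<tau> = (if \<tau> \<in> ?I then incid y \<tau> else 0)" for \<tau>
    have vL: "v \<in> bd_span n d \<alpha> F \<longleftrightarrow> incid y \<in> bd_span n d \<alpha> F" for F
      by (rule bd_span_cong) (auto simp: v_def)
    have vL': "v \<in> ?L'" unfolding vL using yS by (intro bd_span_mem) auto
    let ?a = "\<lambda>q \<tau>. q \<tau> + v \<tau>"
    have inj: "inj_on ?a Q" by (auto simp: inj_on_def fun_eq_iff)
    have disj: "Q \<inter> ?a ` Q = {}"
    proof (rule ccontr)
      assume "Q \<inter> ?a ` Q \<noteq> {}"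
      then obtain p q where pq: "p \<in> Q" "q \<in> Q" "p = (\<lambda>\<tau>. q \<tau> + v \<tau>)" by auto
      have "(\<lambda>\<tau>. 1 * p \<tau> + (- 1) * q \<tau>) \<in> ?L" using pq Q(3) by (intro zsubmod_add zsubmod_bd_span) auto
      moreover have "(\<lambda>\<tau>. 1 * p \<tau> + (- 1) * q \<tau>) = v" using pq(3) by auto
      ultimately show False using yL vL by simp
    qed
    have vn: "(\<Sum>\<tau>\<in>?I. \<bar>v \<tau>\<bar>) \<le> int (d + 1)"
      using sum_abs_incid_le[OF d yS(2), of \<alpha>] by (simp add: v_def)
    show ?thesis
    proof (intro exI[of _ "Q \<union> ?a ` Q"] conjI ballI allI impI)
      show "finite (Q \<union> ?a ` Q)" using Q by simp
      show "card (Q \<union> ?a ` Q) = 2 ^ drops ?G (y # ys)"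
        using Q disj True card_image[OF inj] by (simp add: card_Un_disjoint)
      show "Q \<union> ?a ` Q \<subseteq> ?L'"
      proof safe
        fix q assume "q \<in> Q"
        then have q: "q \<in> ?L'" using Q LL' by auto
        then show "q \<in> ?L'" .
        have "(\<lambda>\<tau>. 1 * q \<tau> + 1 * v \<tau>) \<in> ?L'" by (rule zsubmod_add[OF zsubmod_bd_span q vL'])
        then show "?a q \<in> ?L'" by simp
      qed
      fix q assume q: "q \<in> Q \<union> ?a ` Q"
      show "q \<tau> = 0" if t: "\<tau> \<notin> ?I" for \<tau>
      proof (cases "q \<in> Q")
        case True then show ?thesis using Q0 t by blast
      next
        case False
        then obtain p where p: "p \<in> Q" "q = ?a p" using q by auto
        have "v \<tau> = 0" using t unfolding v_def by (rule if_not_P)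
        then show ?thesis using Q0[OF p(1) t] p(2) by simp
      qed
      have "(\<Sum>\<tau>\<in>?I. \<bar>q \<tau>\<bar>) \<le> int ((d + 1) * drops ?G ys) + int (d + 1)"
      proof (cases "q \<in> Q")
        case True then show ?thesis using Q1[OF True] by simp
      next
        case False
        then obtain p where p: "p \<in> Q" "q = ?a p" using q by auto
        have "(\<Sum>\<tau>\<in>?I. \<bar>q \<tau>\<bar>) \<le> (\<Sum>\<tau>\<in>?I. \<bar>p \<tau>\<bar>) + (\<Sum>\<tau>\<in>?I. \<bar>v \<tau>\<bar>)"
          unfolding p sum.distrib[symmetric] by (intro sum_mono abs_triangle_ineq)
        then show ?thesis using Q1[OF p(1)] vn by simp
      qed
      then show "(\<Sum>\<tau>\<in>?I. \<bar>q \<tau>\<bar>) \<le> int ((d + 1) * drops ?G (y # ys))" using True by (simp add: algebra_simps)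
    qed
  qed
qed

text \<open>With k coordinates there are at most (8 (d + 1))^k (4/3)^t vectors of norm at most (d +
  1) t, yet t drops produce 2^t of them; so t is at most a multiple of k.\<close>

lemma drops_fresh_le:
  assumes d: "d \<ge> 1" and ys: "set ys \<subseteq> faces n d"
  shows "(3/2::real) ^ drops (fresh n d \<alpha> S) ys \<le> (8 * (real d + 1)) ^ card (costar n d \<alpha>)"
proof -
  define t where "t = drops (fresh n d \<alpha> S) ys"
  obtain Q where Q: "finite Q" "card Q = 2 ^ t"
    "\<And>q \<tau>. q \<in> Q \<Longrightarrow> \<tau> \<notin> costar n d \<alpha> \<Longrightarrow> q \<tau> = 0"
    "\<And>q. q \<in> Q \<Longrightarrow> (\<Sum>\<tau>\<in>costar n d \<alpha>. \<bar>q \<tau>\<bar>) \<le> int ((d + 1) * t)"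
    using drops_subset_sums[OF assms, of \<alpha> S] unfolding t_def by blast
  \<comment> \<open>Bernoulli's inequality makes \<open>x ^ (d + 1)\<close> at least 3/4, so that 2
    * 3/4 = 3/2, the inverse of the weight per drop in \<open>sum_drops_le\<close>, remains as
    base.\<close>
  define x where "x = 1 - 1 / (4 * (real d + 1))"
  have x: "0 < x" "x < 1" by (auto simp: x_def field_simps)
  have "1 + real (d + 1) * (- (1 / (4 * (real d + 1)))) \<le> (1 + (- (1 / (4 * (real d + 1))))) ^ (d + 1)"
    by (rule Bernoulli_inequality) (auto simp: field_simps)
  also have "1 + real (d + 1) * (- (1 / (4 * (real d + 1)))) = 3 / 4" by (simp add: field_simps)
  also have "(1 + (- (1 / (4 * (real d + 1))))) ^ (d + 1) = x ^ (d + 1)" by (simp add: x_def)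
  finally have b: "3 / 4 \<le> x ^ (d + 1)" .
  have "(3/2::real) ^ t \<le> (2 * x ^ (d + 1)) ^ t" using b by (intro power_mono) auto
  also have "\<dots> = real (card Q) * x ^ ((d + 1) * t)"
    by (simp only: Q(2) power_mult_distrib power_mult of_nat_power of_nat_numeral)
  also have "\<dots> \<le> (2 / (1 - x)) ^ card (costar n d \<alpha>)"
    by (rule card_l1_ball_le[OF _ x]) (use Q in auto)
  also have "2 / (1 - x) = 8 * (real d + 1)" by (simp add: x_def)
  finally show ?thesis by (simp add: t_def)
qed

lemma fresh_antimono: "Y \<subseteq> Y' \<Longrightarrow> Y' \<subseteq> faces n d \<Longrightarrow> fresh n d \<alpha> S Y' \<subseteq> fresh n d \<alpha> S Y"
  using bd_span_mono[of "Y \<inter> clean n d \<alpha> S" "Y' \<inter> clean n d \<alpha> S" n d \<alpha>] finite_subset[of Y' "faces n d"]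
  by (auto simp: fresh_def)

lemma fresh_disjoint: "Y \<subseteq> faces n d \<Longrightarrow> fresh n d \<alpha> S Y \<subseteq> faces n d - Y"
  using bd_span_mem[of "Y \<inter> clean n d \<alpha> S"] finite_subset[of Y "faces n d"]
  by (auto simp: fresh_def clean_def)

section \<open>From random orderings to random prefixes\<close>

lemma LM_prob_prefix:
  assumes "m \<le> card (faces n d)"
  shows "LM_prob n d (\<lambda>xs. E (set (take m xs)))
    = real (card {ys \<in> prefix (faces n d) m. E (set ys)}) / real (card (prefix (faces n d) m))"
proof -
  let ?X = "faces n d"
  have count: "card {xs \<in> orderings n d. E (set (take m xs))}
      = card {ys \<in> prefix ?X m. E (set ys)} * fact (card ?X - m)" for E
  proof -
    let ?A = "{xs \<in> orderings n d. E (set (take m xs))}"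
    let ?B = "SIGMA ys:{ys \<in> prefix ?X m. E (set ys)}. permutations_of_set (?X - set ys)"
    have "bij_betw (\<lambda>xs. (take m xs, drop m xs)) ?A ?B"
    proof (rule bij_betwI[where g = "\<lambda>(ys, zs). ys @ zs"])
      show "(\<lambda>xs. (take m xs, drop m xs)) \<in> ?A \<rightarrow> ?B"
      proof
        fix xs assume xs: "xs \<in> ?A"
        then have l: "length xs = card ?X" "distinct xs" "set xs = ?X"
          by (auto simp: orderings_def distinct_card[symmetric])
        have "distinct (take m xs @ drop m xs)" using l by simp
        then have disj: "set (take m xs) \<inter> set (drop m xs) = {}" by (simp only: distinct_append)
        have un: "set (take m xs) \<union> set (drop m xs) = ?X"
          using l by (metis append_take_drop_id set_append)
        have "take m xs \<in> prefix ?X m" using l assms un by (auto simp: prefix_def)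
        moreover have "drop m xs \<in> permutations_of_set (?X - set (take m xs))"
          using l disj un by (intro permutations_of_setI) auto
        ultimately show "(take m xs, drop m xs) \<in> ?B" using xs by auto
      qed
      show "(\<lambda>(ys, zs). ys @ zs) \<in> ?B \<rightarrow> ?A"
        by (auto simp: orderings_def prefix_def permutations_of_set_def)
    qed (auto simp: prefix_def)
    then have "card ?A = card ?B" by (rule bij_betw_same_card)
    also have "\<dots> = (\<Sum>ys\<in>{ys \<in> prefix ?X m. E (set ys)}. card (permutations_of_set (?X - set ys)))"
      by (intro card_SigmaI) auto
    also have "\<dots> = (\<Sum>ys\<in>{ys \<in> prefix ?X m. E (set ys)}. fact (card ?X - m))"
      by (intro sum.cong) (auto simp: card_Diff_prefix)
    finally show ?thesis by simp
  qed
  have "card (orderings n d) = card (prefix ?X m) * fact (card ?X - m)"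
    using count[of "\<lambda>_. True"] by simp
  then show ?thesis unfolding LM_prob_def count[of E] by simp
qed

section \<open>Dense spots and the light part of a support\<close>

definition codeg :: "nat set set \<Rightarrow> nat set \<Rightarrow> nat" where
  "codeg S \<alpha> = card {\<tau> \<in> S. \<alpha> \<subseteq> \<tau>}"

text \<open>The threshold is chosen such that, for a minimal heavy set \<open>\<alpha>\<close> and \<open>a \<in> \<alpha>\<close>, the faces that contain \<open>\<alpha> - {a}\<close>
  and an element of \<open>S\<close> not containing \<open>\<alpha>\<close> form a small part of the star of \<open>\<alpha>\<close>.\<close>

definition heavy :: "real \<Rightarrow> nat \<Rightarrow> nat \<Rightarrow> nat set set \<Rightarrow> nat set \<Rightarrow> bool" where
  "heavy \<kappa> n d S \<alpha> \<longleftrightarrow> \<alpha> \<subseteq> {0..<n} \<and> card \<alpha> < d \<and> (\<kappa> * real n) ^ (d - card \<alpha>) \<le> real (codeg S \<alpha>)"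

definition min_heavy :: "real \<Rightarrow> nat \<Rightarrow> nat \<Rightarrow> nat set set \<Rightarrow> nat set set" where
  "min_heavy \<kappa> n d S = {\<alpha>. heavy \<kappa> n d S \<alpha> \<and> (\<forall>\<beta>. \<beta> \<subset> \<alpha> \<longrightarrow> \<not> heavy \<kappa> n d S \<beta>)}"

text \<open>The condition \<open>card \<alpha> < d\<close> in \<open>heavy\<close> matters here: an
  element of \<open>S\<close> itself has codegree 1, which would reach the threshold with exponent
  0.\<close>

definition light :: "real \<Rightarrow> nat \<Rightarrow> nat \<Rightarrow> nat set set \<Rightarrow> nat set set" where
  "light \<kappa> n d S = {\<tau> \<in> S. \<forall>\<alpha>. \<alpha> \<subseteq> \<tau> \<longrightarrow> \<not> heavy \<kappa> n d S \<alpha>}"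

abbreviation small_sets :: "nat \<Rightarrow> nat \<Rightarrow> nat set set" where
  "small_sets n d \<equiv> {\<alpha>. \<alpha> \<subseteq> {0..<n} \<and> card \<alpha> < d}"

lemma finite_small_sets: "finite (small_sets n d)"
  by (rule finite_subset[of _ "Pow {0..<n}"]) auto

lemma min_heavy_subset: "min_heavy \<kappa> n d S \<subseteq> small_sets n d"
  by (auto simp: min_heavy_def heavy_def)

lemma finite_min_heavy [simp]: "finite (min_heavy \<kappa> n d S)"
  using min_heavy_subset finite_small_sets by (rule finite_subset)

lemma light_subset: "light \<kappa> n d S \<subseteq> S"
  by (auto simp: light_def)

lemma not_light_min_heavy:
  assumes "\<tau> \<in> S - light \<kappa> n d S" and "finite \<tau>"
  obtains \<alpha> where "\<alpha> \<in> min_heavy \<kappa> n d S" "\<alpha> \<subseteq> \<tau>"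
proof -
  let ?h = "\<lambda>\<alpha>. \<alpha> \<subseteq> \<tau> \<and> heavy \<kappa> n d S \<alpha>"
  obtain \<alpha> where "?h \<alpha>" using assms by (auto simp: light_def)
  then obtain \<alpha> where a: "?h \<alpha>" and min: "\<And>\<beta>. ?h \<beta> \<Longrightarrow> card \<alpha> \<le> card \<beta>"
    using ex_has_least_nat[of ?h \<alpha> card] by blast
  have "\<not> heavy \<kappa> n d S \<beta>" if "\<beta> \<subset> \<alpha>" for \<beta>
  proof
    assume h: "heavy \<kappa> n d S \<beta>"
    have "finite \<alpha>" using a assms finite_subset by blast
    then have "card \<beta> < card \<alpha>" using that by (rule psubset_card_mono)
    moreover have "card \<alpha> \<le> card \<beta>" using that a h by (intro min) auto
    ultimately show False by simp
  qed
  then show thesis using that a by (auto simp: min_heavy_def)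
qed

lemma subset_light_Un_costars:
  assumes "S \<subseteq> faces n (d - 1)"
  shows "S - light \<kappa> n d S \<subseteq> (\<Union>\<alpha>\<in>min_heavy \<kappa> n d S. costar n d \<alpha>)"
proof
  fix \<tau> assume t: "\<tau> \<in> S - light \<kappa> n d S"
  have "\<tau> \<in> faces n (d - 1)" using t assms by blast
  moreover from this have "finite \<tau>" by (rule face_finite)
  then obtain \<alpha> where "\<alpha> \<in> min_heavy \<kappa> n d S" "\<alpha> \<subseteq> \<tau>" using not_light_min_heavy[OF t] by blast
  ultimately show "\<tau> \<in> (\<Union>\<alpha>\<in>min_heavy \<kappa> n d S. costar n d \<alpha>)" by blast
qed

text \<open>A vertex \<open>v\<close> fails to make \<open>insert v \<tau>\<close> exposed only if
  another element of \<open>S\<close> is a cone from \<open>v\<close> over one of the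
  \<open>d\<close> facets of \<open>\<tau>\<close>, which happens at most \<open>K\<close> times per
  facet. An exposed face determines its element of \<open>S\<close>, so no pair of
  \<open>\<tau>\<close> and \<open>v\<close> is counted twice.\<close>

lemma card_exposed_ge:
  assumes d: "d \<ge> 2" and S: "S \<subseteq> faces n (d - 1)" and T: "T \<subseteq> S"
    and K: "\<And>\<tau> \<rho>. \<tau> \<in> T \<Longrightarrow> \<rho> \<subseteq> \<tau> \<Longrightarrow> card \<rho> = d - 1 \<Longrightarrow> real (codeg S \<rho>) \<le> K"
  shows "real (card T) * (real n - real d - real d * K) \<le> real (card (exposed n d S))"
proof -
  have mf: "\<tau> \<subseteq> {0..<n} \<and> card \<tau> = d \<and> finite \<tau>" if "\<tau> \<in> S" for \<tau>
    using S that d face_finite[of \<tau> n "d - 1"] by (auto simp: faces_def)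
  have fS: "finite S" using S by (auto intro: finite_subset[OF _ finite_faces])
  let ?good = "\<lambda>\<tau>. {v \<in> {0..<n} - \<tau>. insert v \<tau> \<in> exposed n d S}"
  have good: "real n - real d - real d * K \<le> real (card (?good \<tau>))" if t: "\<tau> \<in> T" for \<tau>
  proof -
    have tS: "\<tau> \<in> S" using t T by blast
    note m = mf[OF tS]
    let ?R = "{\<rho>. \<rho> \<subseteq> \<tau> \<and> card \<rho> = d - 1}"
    let ?N = "\<lambda>\<rho>. {v \<in> {0..<n} - \<tau>. insert v \<rho> \<in> S}"
    have "d choose (d - 1) = d" using d by (cases d) simp_all
    then have cR: "card ?R = d" using n_subsets[of \<tau> "d - 1"] m by simp
    have fR: "finite ?R" using m by auto
    have cN: "real (card (?N \<rho>)) \<le> K" if r: "\<rho> \<in> ?R" for \<rho>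
    proof -
      have "card (?N \<rho>) \<le> codeg S \<rho>" unfolding codeg_def
      proof (rule card_inj_on_le[of "\<lambda>v. insert v \<rho>"])
        show "inj_on (\<lambda>v. insert v \<rho>) (?N \<rho>)" using r by (auto simp: inj_on_def)
        show "(\<lambda>v. insert v \<rho>) ` ?N \<rho> \<subseteq> {\<tau> \<in> S. \<rho> \<subseteq> \<tau>}" by auto
      qed (use fS in auto)
      also have "real (codeg S \<rho>) \<le> K" using K[OF t] r by simp
      finally show ?thesis by simp
    qed
    have "{0..<n} - \<tau> \<subseteq> ?good \<tau> \<union> (\<Union>\<rho>\<in>?R. ?N \<rho>)"
    proof
      fix v assume v: "v \<in> {0..<n} - \<tau>"
      have vf: "insert v \<tau> \<in> faces n d" using v m by (auto simp: faces_def)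
      show "v \<in> ?good \<tau> \<union> (\<Union>\<rho>\<in>?R. ?N \<rho>)"
      proof (cases "{\<tau>' \<in> S. \<tau>' \<subseteq> insert v \<tau>} = {\<tau>}")
        case True
        then show ?thesis using v vf by (auto simp: exposed_def)
      next
        case False
        then obtain \<tau>' where t': "\<tau>' \<in> S" "\<tau>' \<subseteq> insert v \<tau>" "\<tau>' \<noteq> \<tau>" using tS by blast
        note m' = mf[OF t'(1)]
        have "v \<in> \<tau>'" using t' tS S face_subset_eq[of \<tau>' n "d - 1" \<tau>] by blast
        then have R: "\<tau>' - {v} \<in> ?R" "insert v (\<tau>' - {v}) = \<tau>'" using t' m' by auto
        then have "v \<in> ?N (\<tau>' - {v})" using v t' by simp
        then show ?thesis using R(1) by blast
      qed
    qed
    then have "card ({0..<n} - \<tau>) \<le> card (?good \<tau> \<union> (\<Union>\<rho>\<in>?R. ?N \<rho>))"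
      using fR by (intro card_mono) auto
    also have "\<dots> \<le> card (?good \<tau>) + card (\<Union>\<rho>\<in>?R. ?N \<rho>)" by (rule card_Un_le)
    also have "card (\<Union>\<rho>\<in>?R. ?N \<rho>) \<le> (\<Sum>\<rho>\<in>?R. card (?N \<rho>))" using fR by (rule card_UN_le)
    finally have "real (card ({0..<n} - \<tau>)) \<le> real (card (?good \<tau>)) + (\<Sum>\<rho>\<in>?R. real (card (?N \<rho>)))"
      by (simp flip: of_nat_add of_nat_sum)
    also have "(\<Sum>\<rho>\<in>?R. real (card (?N \<rho>))) \<le> (\<Sum>\<rho>\<in>?R. K)" using cN by (intro sum_mono) auto
    also have "\<dots> = real d * K" using cR by simp
    finally have "real (card ({0..<n} - \<tau>)) \<le> real (card (?good \<tau>)) + real d * K" by simp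
    moreover have "real n - real d \<le> real (card ({0..<n} - \<tau>))"
      using m by (simp add: card_Diff_subset)
    ultimately show ?thesis by simp
  qed
  have fT: "finite T" using T fS finite_subset by blast
  have "real (card T) * (real n - real d - real d * K) \<le> (\<Sum>\<tau>\<in>T. real (card (?good \<tau>)))"
    using sum_mono[OF good, of T "\<lambda>x. x"] by simp
  also have "\<dots> = real (card (SIGMA \<tau>:T. ?good \<tau>))" using fT by (subst card_SigmaI) auto
  also have "card (SIGMA \<tau>:T. ?good \<tau>) \<le> card (exposed n d S)"
  proof (rule card_inj_on_le[of "\<lambda>(\<tau>, v). insert v \<tau>"])
    show "inj_on (\<lambda>(\<tau>, v). insert v \<tau>) (SIGMA \<tau>:T. ?good \<tau>)"
    proof (rule inj_onI, clarsimp)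
      fix \<tau> v \<tau>' v'
      assume a: "\<tau> \<in> T" "v < n" "v \<notin> \<tau>" "insert v' \<tau>' \<in> exposed n d S" "\<tau>' \<in> T" "v' < n" "v' \<notin> \<tau>'"
        "insert v \<tau> = insert v' \<tau>'"
      have "card {\<rho> \<in> S. \<rho> \<subseteq> insert v \<tau>} = 1" using a by (simp add: exposed_def)
      then obtain \<rho> where "{\<rho> \<in> S. \<rho> \<subseteq> insert v \<tau>} = {\<rho>}" by (auto simp: card_1_singleton_iff)
      moreover have "\<tau> \<in> {\<rho> \<in> S. \<rho> \<subseteq> insert v \<tau>}" "\<tau>' \<in> {\<rho> \<in> S. \<rho> \<subseteq> insert v \<tau>}" using a T by auto
      ultimately have "\<tau> = \<tau>'" by auto
      then show "\<tau> = \<tau>' \<and> v = v'" using a by auto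
    qed
  qed (auto simp: exposed_def)
  finally show ?thesis by simp
qed

text \<open>The facets of a light element are not heavy, and for sets of size \<open>d - 1\<close>
  the threshold has exponent 1.\<close>

lemma card_exposed_light:
  assumes d: "d \<ge> 2" and S: "S \<subseteq> faces n (d - 1)"
  shows "real (card (light \<kappa> n d S)) * (real n - real d - real d * (\<kappa> * real n)) \<le> real (card (exposed n d S))"
proof (rule card_exposed_ge[OF d S light_subset])
  fix \<tau> \<rho> assume a: "\<tau> \<in> light \<kappa> n d S" "\<rho> \<subseteq> \<tau>" "card \<rho> = d - 1"
  have "\<tau> \<subseteq> {0..<n}" using a S by (auto simp: light_def faces_def)
  then have "\<rho> \<subseteq> {0..<n}" using a by blast
  moreover have "\<not> heavy \<kappa> n d S \<rho>" using a unfolding light_def by blast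
  ultimately have "\<not> (\<kappa> * real n) ^ (d - card \<rho>) \<le> real (codeg S \<rho>)" using a(3) d by (simp add: heavy_def)
  moreover have "d - card \<rho> = 1" using a d by simp
  ultimately show "real (codeg S \<rho>) \<le> \<kappa> * real n" by simp
qed

text \<open>A mixed face arises by adding some \<open>a \<in> \<alpha>\<close> to an element of
  \<open>S\<close> that contains \<open>\<alpha> - {a}\<close>. This smaller set is not heavy, and
  its threshold has one more factor \<open>\<kappa> * n\<close>.\<close>

lemma card_mixed_le:
  assumes d: "d \<ge> 2" and S: "S \<subseteq> faces n (d - 1)" and \<alpha>: "\<alpha> \<in> min_heavy \<kappa> n d S" and \<kappa>: "\<kappa> \<ge> 0"
  shows "real (card (mixed n d \<alpha> S)) \<le> real d * (\<kappa> * real n) * (\<kappa> * real n) ^ (d - card \<alpha>)"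
proof -
  have a: "\<alpha> \<subseteq> {0..<n}" "card \<alpha> < d" using \<alpha> by (auto simp: min_heavy_def heavy_def)
  have fa: "finite \<alpha>" using a finite_subset by blast
  have fS: "finite S" using S by (auto intro: finite_subset[OF _ finite_faces])
  have mf: "\<tau> \<subseteq> {0..<n} \<and> card \<tau> = d \<and> finite \<tau>" if "\<tau> \<in> S" for \<tau>
    using S that d face_finite[of \<tau> n "d - 1"] by (auto simp: faces_def)
  have sub: "mixed n d \<alpha> S \<subseteq> (\<Union>a\<in>\<alpha>. insert a ` {\<tau> \<in> S. \<alpha> - {a} \<subseteq> \<tau>})"
  proof
    fix \<sigma> assume "\<sigma> \<in> mixed n d \<alpha> S"
    then obtain \<tau> where t: "\<sigma> \<in> faces n d" "\<alpha> \<subseteq> \<sigma>" "\<tau> \<in> S" "\<tau> \<subseteq> \<sigma>" "\<not> \<alpha> \<subseteq> \<tau>" by (auto simp: mixed_def)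
    have "card \<sigma> = Suc (card \<tau>)" using t mf by (auto simp: faces_def)
    then obtain u where "u \<notin> \<tau>" "\<sigma> = insert u \<tau>" using incid_codim1 t face_finite by metis
    moreover from this have "u \<in> \<alpha>" "\<alpha> - {u} \<subseteq> \<tau>" using t by auto
    ultimately show "\<sigma> \<in> (\<Union>a\<in>\<alpha>. insert a ` {\<tau> \<in> S. \<alpha> - {a} \<subseteq> \<tau>})" using t by auto
  qed
  have "card (mixed n d \<alpha> S) \<le> card (\<Union>a\<in>\<alpha>. insert a ` {\<tau> \<in> S. \<alpha> - {a} \<subseteq> \<tau>})"
    using fa fS by (intro card_mono sub) auto
  also have "\<dots> \<le> (\<Sum>a\<in>\<alpha>. card (insert a ` {\<tau> \<in> S. \<alpha> - {a} \<subseteq> \<tau>}))" using fa by (rule card_UN_le)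
  also have "\<dots> \<le> (\<Sum>a\<in>\<alpha>. codeg S (\<alpha> - {a}))"
    unfolding codeg_def using fS by (intro sum_mono card_image_le) auto
  finally have "real (card (mixed n d \<alpha> S)) \<le> (\<Sum>a\<in>\<alpha>. real (codeg S (\<alpha> - {a})))"
    by (simp flip: of_nat_sum)
  also have "\<dots> \<le> (\<Sum>a\<in>\<alpha>. (\<kappa> * real n) * (\<kappa> * real n) ^ (d - card \<alpha>))"
  proof (rule sum_mono)
    fix x assume x: "x \<in> \<alpha>"
    have c: "card (\<alpha> - {x}) = card \<alpha> - 1" "card \<alpha> \<ge> 1" using x fa by (auto simp: Suc_le_eq card_gt_0_iff)
    have "\<alpha> - {x} \<subset> \<alpha>" using x by auto
    then have "\<not> heavy \<kappa> n d S (\<alpha> - {x})" using \<alpha> by (auto simp: min_heavy_def)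
    then have "\<not> (\<kappa> * real n) ^ (d - card (\<alpha> - {x})) \<le> real (codeg S (\<alpha> - {x}))"
      using a c by (auto simp: heavy_def)
    moreover have "d - card (\<alpha> - {x}) = Suc (d - card \<alpha>)" using c a by simp
    ultimately show "real (codeg S (\<alpha> - {x})) \<le> (\<kappa> * real n) * (\<kappa> * real n) ^ (d - card \<alpha>)" by simp
  qed
  also have "\<dots> = real (card \<alpha>) * ((\<kappa> * real n) * (\<kappa> * real n) ^ (d - card \<alpha>))" by simp
  also have "\<dots> \<le> real d * ((\<kappa> * real n) * (\<kappa> * real n) ^ (d - card \<alpha>))"
    using a \<kappa> by (intro mult_right_mono) auto
  finally show ?thesis by (simp add: mult.assoc)
qed

lemma card_costar_le:
  assumes "d \<ge> 1" "\<alpha> \<subseteq> {0..<n}" "card \<alpha> \<le> d"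
  shows "card (costar n d \<alpha>) \<le> n ^ (d - card \<alpha>)"
proof -
  have fa: "finite \<alpha>" using assms finite_subset by blast
  have "card (costar n d \<alpha>) \<le> card {\<beta>. \<beta> \<subseteq> {0..<n} \<and> card \<beta> = d - card \<alpha>}"
  proof (rule card_inj_on_le[of "\<lambda>\<tau>. \<tau> - \<alpha>"])
    show "inj_on (\<lambda>\<tau>. \<tau> - \<alpha>) (costar n d \<alpha>)" by (auto simp: inj_on_def)
    show "(\<lambda>\<tau>. \<tau> - \<alpha>) ` costar n d \<alpha> \<subseteq> {\<beta>. \<beta> \<subseteq> {0..<n} \<and> card \<beta> = d - card \<alpha>}"
      using assms fa by (auto simp: faces_def card_Diff_subset)
  qed auto
  also have "\<dots> = n choose (d - card \<alpha>)" using n_subsets[of "{0..<n}"] by simp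
  also have "\<dots> \<le> n ^ (d - card \<alpha>)" 
    using binomial_le_pow[of "d - card \<alpha>" n] by (cases "d - card \<alpha> \<le> n") (auto simp: binomial_eq_0)
  finally show ?thesis .
qed

lemma card_costar_ge:
  assumes d: "d \<ge> 1" and \<alpha>: "\<alpha> \<subseteq> {0..<n}" "card \<alpha> < d" and n: "n \<ge> d"
  shows "n - d \<le> card (costar n d \<alpha>)"
proof -
  have "\<exists>\<beta>. \<alpha> \<subseteq> \<beta> \<and> \<beta> \<subseteq> {0..<n} \<and> card \<beta> = d - 1"
    by (rule exists_subset_between) (use assms in auto)
  then obtain \<beta> where b: "\<alpha> \<subseteq> \<beta>" "\<beta> \<subseteq> {0..<n}" "card \<beta> = d - 1" by blast
  have fb: "finite \<beta>" using b finite_subset by blast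
  have "n - d \<le> card ({0..<n} - \<beta>)" using b fb by (simp add: card_Diff_subset)
  also have "\<dots> \<le> card (costar n d \<alpha>)"
  proof (rule card_inj_on_le[of "\<lambda>v. insert v \<beta>"])
    show "inj_on (\<lambda>v. insert v \<beta>) ({0..<n} - \<beta>)" by (auto simp: inj_on_def)
    show "(\<lambda>v. insert v \<beta>) ` ({0..<n} - \<beta>) \<subseteq> costar n d \<alpha>" using b fb d by (auto simp: faces_def)
  qed auto
  finally show ?thesis .
qed

text \<open>The number of coordinates in all localized groups together. It caps the drops and also,
  in powers of 2, the choices for the part of the support that is not light.\<close>

definition weight :: "nat \<Rightarrow> nat \<Rightarrow> nat set set \<Rightarrow> nat" where
  "weight n d A = (\<Sum>\<alpha>\<in>A. card (costar n d \<alpha>))"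

text \<open>The factor \<kappa>^d compares the threshold with the size of the costar, 4 (d + 1)
  comes from the expansion inequality, and 2^(d + 1) bounds the number of sets \<alpha> for which
  one \<open>d\<close>-face is fresh.\<close>

definition drop_const :: "real \<Rightarrow> nat \<Rightarrow> real" where
  "drop_const \<kappa> d = \<kappa> ^ d / (4 * (real d + 1) * 2 ^ (d + 1))"

text \<open>At a minimal heavy set the expansion inequality asks for many fresh or mixed faces, and
  the mixed ones are too few. What remains is a positive proportion of the star, since the threshold
  is a positive proportion of the largest possible codegree.\<close>

lemma card_Union_fresh_ge:
  assumes d: "d \<ge> 2" and n: "n \<ge> 2 * d" and \<kappa>: "0 < \<kappa>" "\<kappa> \<le> 1 / (4 * (real d + 1)\<^sup>2)"
    and S: "S \<subseteq> faces n (d - 1)"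
    and exp: "\<And>\<alpha>. \<alpha> \<subseteq> {0..<n} \<Longrightarrow> (n - card \<alpha>) * card {\<tau> \<in> S. \<alpha> \<subseteq> \<tau>}
       \<le> (d + 1 - card \<alpha>) * (card (fresh n d \<alpha> S F) + card (mixed n d \<alpha> S))"
  shows "drop_const \<kappa> d * real n * real (weight n d (min_heavy \<kappa> n d S)) \<le> real (card (\<Union>\<alpha>\<in>min_heavy \<kappa> n d S. fresh n d \<alpha> S F))"
proof -
  let ?A = "min_heavy \<kappa> n d S"
  let ?U = "\<Union>\<alpha>\<in>?A. fresh n d \<alpha> S F" and ?w = "\<lambda>\<alpha>. (\<kappa> * real n) ^ (d - card \<alpha>)"
  have k1: "\<kappa> \<le> 1"
  proof -
    have "1 \<le> (real d + 1)\<^sup>2" by (rule one_le_power) simp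
    then have "1 \<le> 4 * (real d + 1)\<^sup>2" by linarith
    then have "1 / (4 * (real d + 1)\<^sup>2) \<le> 1" by simp
    then show ?thesis using \<kappa> by linarith
  qed
  \<comment> \<open>This makes the mixed faces consume at most n/4 times the threshold, while n -
    |\<alpha>| \<ge> n/2; a quarter is left for the fresh faces.\<close>
  have kd: "(real d + 1) * (real d * \<kappa>) \<le> 1 / 4"
  proof -
    have "(real d + 1) * (real d * \<kappa>) \<le> (real d + 1) * ((real d + 1) * \<kappa>)"
      using \<kappa> by (intro mult_left_mono mult_right_mono) auto
    also have "\<dots> = (real d + 1)\<^sup>2 * \<kappa>" by (simp add: power2_eq_square)
    also have "\<dots> \<le> (real d + 1)\<^sup>2 * (1 / (4 * (real d + 1)\<^sup>2))" using \<kappa> by (intro mult_left_mono) auto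
    also have "\<dots> = 1 / 4" by (simp add: field_simps)
    finally show ?thesis .
  qed
  have one: "\<kappa> ^ d * real (card (costar n d \<alpha>)) * real n / (4 * (real d + 1)) \<le> real (card (fresh n d \<alpha> S F))"
    if \<alpha>: "\<alpha> \<in> ?A" for \<alpha>
  proof -
    have a: "\<alpha> \<subseteq> {0..<n}" "card \<alpha> < d" "?w \<alpha> \<le> real (card {\<tau> \<in> S. \<alpha> \<subseteq> \<tau>})"
      using \<alpha> by (auto simp: min_heavy_def heavy_def codeg_def)
    have w0: "?w \<alpha> \<ge> 0" using \<kappa> by simp
    have "real (n - card \<alpha>) * ?w \<alpha> \<le> real (n - card \<alpha>) * real (card {\<tau> \<in> S. \<alpha> \<subseteq> \<tau>})"
      using a by (intro mult_left_mono) auto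
    also have "\<dots> \<le> real (d + 1 - card \<alpha>) * (real (card (fresh n d \<alpha> S F)) + real (card (mixed n d \<alpha> S)))"
      using exp[OF a(1)] by (simp flip: of_nat_mult of_nat_add)
    also have "\<dots> \<le> (real d + 1) * (real (card (fresh n d \<alpha> S F)) + real d * (\<kappa> * real n) * ?w \<alpha>)"
      using card_mixed_le[OF d S \<alpha>] \<kappa> by (intro mult_mono add_mono) auto
    finally have 1: "real (n - card \<alpha>) * ?w \<alpha> \<le> (real d + 1) * real (card (fresh n d \<alpha> S F))
        + ((real d + 1) * (real d * \<kappa>)) * (real n * ?w \<alpha>)"
      by (simp add: algebra_simps)
    have "((real d + 1) * (real d * \<kappa>)) * (real n * ?w \<alpha>) \<le> 1 / 4 * (real n * ?w \<alpha>)"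
      using kd w0 by (intro mult_right_mono) auto
    moreover have "1 / 2 * (real n * ?w \<alpha>) \<le> real (n - card \<alpha>) * ?w \<alpha>"
    proof -
      have "1 / 2 * real n \<le> real (n - card \<alpha>)" using n a by (simp add: of_nat_diff)
      then have "(1 / 2 * real n) * ?w \<alpha> \<le> real (n - card \<alpha>) * ?w \<alpha>" using w0 by (rule mult_right_mono)
      then show ?thesis by simp
    qed
    ultimately have 2: "1 / 4 * (real n * ?w \<alpha>) \<le> (real d + 1) * real (card (fresh n d \<alpha> S F))"
      using 1 by linarith
    have "\<kappa> ^ d * real (card (costar n d \<alpha>)) \<le> \<kappa> ^ (d - card \<alpha>) * real n ^ (d - card \<alpha>)"
    proof (rule mult_mono)
      show "\<kappa> ^ d \<le> \<kappa> ^ (d - card \<alpha>)" using \<kappa> k1 by (intro power_decreasing) auto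
      have "real (card (costar n d \<alpha>)) \<le> real (n ^ (d - card \<alpha>))"
        using card_costar_le[of d \<alpha> n] a d by (intro of_nat_mono) auto
      then show "real (card (costar n d \<alpha>)) \<le> real n ^ (d - card \<alpha>)" by simp
    qed (use \<kappa> in auto)
    then have "\<kappa> ^ d * real (card (costar n d \<alpha>)) * real n \<le> ?w \<alpha> * real n"
      by (intro mult_right_mono) (auto simp: power_mult_distrib)
    then have "\<kappa> ^ d * real (card (costar n d \<alpha>)) * real n \<le> 4 * (real d + 1) * real (card (fresh n d \<alpha> S F))"
      using 2 by (simp add: algebra_simps)
    then show ?thesis by (subst pos_divide_le_eq) (simp_all add: algebra_simps)
  qed
  have fG: "finite (fresh n d \<alpha> S F)" for \<alpha> by (auto simp: fresh_def clean_def)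
  have "(\<Sum>\<alpha>\<in>?A. card (fresh n d \<alpha> S F)) = card (SIGMA \<alpha>:?A. fresh n d \<alpha> S F)"
    using fG by (subst card_SigmaI) auto
  also have "\<dots> \<le> card (SIGMA \<sigma>:?U. Pow \<sigma>)"
  proof (rule card_inj_on_le[of "\<lambda>(\<alpha>, \<sigma>). (\<sigma>, \<alpha>)"])
    show "(\<lambda>(\<alpha>, \<sigma>). (\<sigma>, \<alpha>)) ` (SIGMA \<alpha>:?A. fresh n d \<alpha> S F) \<subseteq> (SIGMA \<sigma>:?U. Pow \<sigma>)"
      by (auto simp: fresh_def clean_def)
    show "finite (SIGMA \<sigma>:?U. Pow \<sigma>)"
      using fG by (intro finite_SigmaI) (auto simp: fresh_def clean_def dest: face_finite)
  qed (auto simp: inj_on_def)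
  also have "\<dots> = (\<Sum>\<sigma>\<in>?U. card (Pow \<sigma>))"
    using fG by (intro card_SigmaI) (auto simp: fresh_def clean_def dest: face_finite)
  also have "\<dots> = (\<Sum>\<sigma>\<in>?U. 2 ^ (d + 1))"
    by (intro sum.cong refl) (auto simp: fresh_def clean_def faces_def card_Pow dest: finite_subset)
  also have "\<dots> = card ?U * 2 ^ (d + 1)" by simp
  finally have u: "real (\<Sum>\<alpha>\<in>?A. card (fresh n d \<alpha> S F)) \<le> real (card ?U) * 2 ^ (d + 1)"
    by (metis of_nat_le_iff of_nat_mult of_nat_numeral of_nat_power)
  have "\<kappa> ^ d * real n / (4 * (real d + 1)) * real (weight n d ?A)
     = (\<Sum>\<alpha>\<in>?A. \<kappa> ^ d * real (card (costar n d \<alpha>)) * real n / (4 * (real d + 1)))"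
    by (simp add: weight_def sum_distrib_left mult_ac)
  also have "\<dots> \<le> (\<Sum>\<alpha>\<in>?A. real (card (fresh n d \<alpha> S F)))" by (intro sum_mono one)
  also have "\<dots> \<le> real (card ?U) * 2 ^ (d + 1)" using u by simp
  finally have "\<kappa> ^ d * real n / (4 * (real d + 1)) * real (weight n d ?A) / 2 ^ (d + 1)
     \<le> real (card ?U)"
    by (simp add: divide_le_eq mult_ac)
  then show ?thesis by (simp add: drop_const_def mult_ac)
qed

text \<open>Sets grown by one adjacent face at a time, where two faces are adjacent if their union
  is a \<open>d\<close>-face. The index is one less than the size.\<close>

fun conn_sets :: "nat \<Rightarrow> nat \<Rightarrow> nat \<Rightarrow> nat set set set" where
  "conn_sets n d 0 = (\<lambda>\<tau>. {\<tau>}) ` faces n (d - 1)"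
| "conn_sets n d (Suc k) = {insert \<tau> S |S \<tau>. S \<in> conn_sets n d k \<and> \<tau> \<in> faces n (d - 1) - S
      \<and> (\<exists>\<tau>'\<in>S. card (\<tau> \<union> \<tau>') = d + 1)}"

lemma conn_sets_props: "S \<in> conn_sets n d k \<Longrightarrow> S \<subseteq> faces n (d - 1) \<and> card S = Suc k \<and> finite S"
proof (induction k arbitrary: S)
  case (Suc k)
  then obtain T \<tau> where "S = insert \<tau> T" "T \<in> conn_sets n d k" "\<tau> \<in> faces n (d - 1) - T" by auto
  then show ?case using Suc.IH[of T] by auto
qed auto

lemma card_neighbours_le:
  assumes d: "d \<ge> 1" and t: "\<tau>' \<in> faces n (d - 1)"
  shows "card {\<tau> \<in> faces n (d - 1). card (\<tau> \<union> \<tau>') = d + 1} \<le> d * n"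
proof -
  have t': "card \<tau>' = d" "finite \<tau>'" using t d face_finite[OF t] by (auto simp: faces_def)
  have "{\<tau> \<in> faces n (d - 1). card (\<tau> \<union> \<tau>') = d + 1} \<subseteq> (\<lambda>(a, v). insert v (\<tau>' - {a})) ` (\<tau>' \<times> {0..<n})"
  proof
    fix \<tau> assume a: "\<tau> \<in> {\<tau> \<in> faces n (d - 1). card (\<tau> \<union> \<tau>') = d + 1}"
    then have t: "\<tau> \<subseteq> {0..<n}" "card \<tau> = d" "finite \<tau>" using d face_finite[of \<tau> n "d - 1"] by (auto simp: faces_def)
    have un: "card (\<tau> \<union> \<tau>') = Suc d" using a by simp
    obtain v where v: "v \<notin> \<tau>'" "\<tau> \<union> \<tau>' = insert v \<tau>'"
      using incid_codim1[of "\<tau> \<union> \<tau>'" \<tau>'] un t t' by auto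
    obtain x where x: "x \<notin> \<tau>" "\<tau> \<union> \<tau>' = insert x \<tau>"
      using incid_codim1[of "\<tau> \<union> \<tau>'" \<tau>] un t t' by auto
    have "\<tau> = insert v (\<tau>' - {x})" "x \<in> \<tau>'" "v \<in> \<tau>" using v x by auto
    then show "\<tau> \<in> (\<lambda>(a, v). insert v (\<tau>' - {a})) ` (\<tau>' \<times> {0..<n})" using t by blast
  qed
  then have "card {\<tau> \<in> faces n (d - 1). card (\<tau> \<union> \<tau>') = d + 1}
     \<le> card ((\<lambda>(a, v). insert v (\<tau>' - {a})) ` (\<tau>' \<times> {0..<n}))" using t' by (intro card_mono) auto
  also have "\<dots> \<le> card (\<tau>' \<times> {0..<n})" using t' by (intro card_image_le) auto
  finally show ?thesis using t' by (simp add: card_cartesian_product)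
qed

text \<open>In each step the new face is a neighbour of one of at most \<open>r\<close> faces, each
  with at most \<open>d * n\<close> neighbours. For \<open>r\<close> well below n this is far
  smaller than the number of all (d-1)-faces.\<close>

lemma card_conn_sets_le:
  assumes d: "d \<ge> 1"
  shows "k < r \<Longrightarrow> finite (conn_sets n d k) \<and> card (conn_sets n d k) \<le> (n choose d) * (r * d * n) ^ k"
proof (induction k)
  case 0
  have "card ((\<lambda>\<tau>. {\<tau>}) ` faces n (d - 1)) \<le> card (faces n (d - 1))" by (rule card_image_le) simp
  also have "\<dots> = n choose d" using card_faces[of n "d - 1"] d by simp
  finally show ?case by simp
next
  case (Suc k)
  let ?N = "\<lambda>S. \<Union>\<tau>'\<in>S. {\<tau> \<in> faces n (d - 1). card (\<tau> \<union> \<tau>') = d + 1}"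
  have fin: "finite (conn_sets n d k)" and IH: "card (conn_sets n d k) \<le> (n choose d) * (r * d * n) ^ k"
    using Suc by auto
  have cN: "card (?N S) \<le> r * d * n" if S: "S \<in> conn_sets n d k" for S
  proof -
    note p = conn_sets_props[OF S]
    have "card (?N S) \<le> (\<Sum>\<tau>'\<in>S. card {\<tau> \<in> faces n (d - 1). card (\<tau> \<union> \<tau>') = d + 1})"
      using p by (intro card_UN_le) auto
    also have "\<dots> \<le> (\<Sum>\<tau>'\<in>S. d * n)" using p card_neighbours_le[OF d] by (intro sum_mono) blast
    also have "\<dots> = Suc k * (d * n)" using p by simp
    also have "\<dots> \<le> r * (d * n)" using Suc.prems by (intro mult_le_mono1) simp
    finally show ?thesis by (simp add: mult.assoc)
  qed
  have sub: "conn_sets n d (Suc k) \<subseteq> (\<lambda>(S, \<tau>). insert \<tau> S) ` (SIGMA S:conn_sets n d k. ?N S)"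
    by (auto simp: image_iff)
  have finS: "finite (SIGMA S:conn_sets n d k. ?N S)" using fin conn_sets_props by (intro finite_SigmaI) auto
  have "card (conn_sets n d (Suc k)) \<le> card ((\<lambda>(S, \<tau>). insert \<tau> S) ` (SIGMA S:conn_sets n d k. ?N S))"
    using finS by (intro card_mono sub) auto
  also have "\<dots> \<le> card (SIGMA S:conn_sets n d k. ?N S)" using finS by (rule card_image_le)
  also have "\<dots> = (\<Sum>S\<in>conn_sets n d k. card (?N S))" using fin conn_sets_props by (intro card_SigmaI) auto
  also have "\<dots> \<le> (\<Sum>S\<in>conn_sets n d k. r * d * n)" using cN by (intro sum_mono)
  also have "\<dots> = card (conn_sets n d k) * (r * d * n)" by simp
  also have "\<dots> \<le> ((n choose d) * (r * d * n) ^ k) * (r * d * n)" using IH by (rule mult_le_mono1)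
  finally show ?case using finite_subset[OF sub] finS by (simp add: mult_ac)
qed

text \<open>A connected subset of maximal size admits no neighbour from the rest of
  \<open>S\<close>. Two facets of one \<open>d\<close>-face are adjacent, so a face exposed for this
  component contains no other element of \<open>S\<close>.\<close>

lemma exists_conn_sets_component:
  assumes d: "d \<ge> 2" and S: "S \<subseteq> faces n (d - 1)" "S \<noteq> {}"
  obtains k S' where "S' \<in> conn_sets n d k" "S' \<subseteq> S" "exposed n d S' \<subseteq> exposed n d S"
proof -
  have fS: "finite S" using S by (auto intro: finite_subset[OF _ finite_faces])
  let ?P = "\<lambda>k. \<exists>S'\<in>conn_sets n d k. S' \<subseteq> S"
  obtain \<tau> where "\<tau> \<in> S" using S by blast
  then have P0: "?P 0" using S by auto
  have bd: "k \<le> card S" if P: "?P k" for k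
  proof -
    obtain S' where "S' \<in> conn_sets n d k" "S' \<subseteq> S" using P by blast
    then have "Suc k \<le> card S" using conn_sets_props card_mono[OF fS] by metis
    then show ?thesis by simp
  qed
  obtain k where k: "?P k" and max: "\<And>j. ?P j \<Longrightarrow> j \<le> k"
    using Nat.ex_has_greatest_nat[of ?P 0 "card S"] P0 bd by blast
  then obtain S' where S': "S' \<in> conn_sets n d k" "S' \<subseteq> S" by blast
  have closed: "\<tau> \<in> S'" if t: "\<tau> \<in> S" "\<tau>' \<in> S'" "card (\<tau> \<union> \<tau>') = d + 1" for \<tau> \<tau>'
  proof (rule ccontr)
    assume "\<tau> \<notin> S'"
    then have "\<tau> \<in> faces n (d - 1) - S'" using t S by blast
    then have "insert \<tau> S' \<in> conn_sets n d (Suc k)" using t S' by (simp only: conn_sets.simps) blast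
    then have "?P (Suc k)" using S' t by blast
    then have "Suc k \<le> k" by (rule max)
    then show False by simp
  qed
  have "exposed n d S' \<subseteq> exposed n d S"
  proof
    fix \<sigma> assume s: "\<sigma> \<in> exposed n d S'"
    then obtain \<tau>' where t': "{\<tau> \<in> S'. \<tau> \<subseteq> \<sigma>} = {\<tau>'}" and sf: "\<sigma> \<in> faces n d"
      by (auto simp: exposed_def card_1_singleton_iff)
    have "\<tau> = \<tau>'" if t: "\<tau> \<in> S" "\<tau> \<subseteq> \<sigma>" for \<tau>
    proof (rule ccontr)
      assume ne: "\<tau> \<noteq> \<tau>'"
      have t'S: "\<tau>' \<in> S'" "\<tau>' \<subseteq> \<sigma>" using t' by auto
      have fs: "finite \<sigma>" "card \<sigma> = Suc d" using sf face_finite[OF sf] by (auto simp: faces_def)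
      have c: "card \<tau> = d" "card \<tau>' = d" using t t'S S S' d by (auto simp: faces_def)
      have ft: "finite \<tau>" "finite \<tau>'" using finite_subset[OF t(2) fs(1)] finite_subset[OF t'S(2) fs(1)] .
      have "\<not> \<tau> \<subseteq> \<tau>'" using ne c ft card_subset_eq[of \<tau>' \<tau>] by auto
      then have "card \<tau>' < card (\<tau> \<union> \<tau>')" using ft by (intro psubset_card_mono) auto
      moreover have "card (\<tau> \<union> \<tau>') \<le> card \<sigma>" using t t'S fs by (intro card_mono) auto
      ultimately have "card (\<tau> \<union> \<tau>') = d + 1" using c fs by simp
      then have "\<tau> \<in> S'" using closed t t'S by blast
      then show False using t' t ne by blast
    qed
    then have "{\<tau> \<in> S. \<tau> \<subseteq> \<sigma>} = {\<tau>'}" using t' S' by blast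
    then show "\<sigma> \<in> exposed n d S" using sf by (simp add: exposed_def)
  qed
  then show thesis using that S' by blast
qed

section \<open>Union bounds\<close>

text \<open>Both conditions persist when \<open>F\<close> shrinks, the second by
  \<open>fresh_antimono\<close>; so they may be tested at one fixed time.\<close>

definition large_bad :: "real \<Rightarrow> nat \<Rightarrow> nat \<Rightarrow> nat set set \<Rightarrow> nat set set \<Rightarrow> bool" where
  "large_bad \<kappa> n d S F \<longleftrightarrow> F \<inter> exposed n d S = {} \<and>
     drop_const \<kappa> d * real n * real (weight n d (min_heavy \<kappa> n d S)) \<le> real (card (\<Union>\<alpha>\<in>min_heavy \<kappa> n d S. fresh n d \<alpha> S F))"

lemma drop_const_nonneg: "\<kappa> \<ge> 0 \<Longrightarrow> drop_const \<kappa> d \<ge> 0"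
  by (simp add: drop_const_def)

lemma faces_nonempty: "n > d \<Longrightarrow> faces n d \<noteq> {}"
  using card_faces[of n d] by (metis card.empty not_le binomial_eq_0_iff Suc_leI)

lemma drops_Union_fresh_le:
  assumes d: "d \<ge> 1" and A: "finite A" and ys: "set ys \<subseteq> faces n d"
  shows "(3/2::real) ^ drops (\<lambda>F. \<Union>\<alpha>\<in>A. fresh n d \<alpha> S F) ys \<le> (8 * (real d + 1)) ^ weight n d A"
proof -
  have "(3/2::real) ^ drops (\<lambda>F. \<Union>\<alpha>\<in>A. fresh n d \<alpha> S F) ys \<le> (3/2) ^ (\<Sum>\<alpha>\<in>A. drops (fresh n d \<alpha> S) ys)"
    by (intro power_increasing drops_Union_le A) auto
  also have "\<dots> = (\<Prod>\<alpha>\<in>A. (3/2) ^ drops (fresh n d \<alpha> S) ys)" by (simp add: power_sum)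
  also have "\<dots> \<le> (\<Prod>\<alpha>\<in>A. (8 * (real d + 1)) ^ card (costar n d \<alpha>))"
    using drops_fresh_le[OF d ys] by (intro prod_mono) auto
  also have "\<dots> = (8 * (real d + 1)) ^ weight n d A" by (simp add: power_sum weight_def)
  finally show ?thesis .
qed

text \<open>Both conditions of \<open>large_bad\<close> give a bound for the probability; they are combined by
  \<open>min p q \<le> p\<^sup>1\<^sup>-\<^sup>\<theta> q\<^sup>\<theta>\<close>.\<close>

lemma card_large_bad_le:
  assumes d: "d \<ge> 2" and n: "n > d" and \<kappa>: "\<kappa> \<ge> 0" and S: "S \<subseteq> faces n (d - 1)"
    and \<theta>: "0 \<le> \<theta>" "\<theta> \<le> 1"
    and A: "A \<le> (real n - real d - real d * (\<kappa> * real n)) * (real m / real (card (faces n d)))"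
    and B: "B \<le> drop_const \<kappa> d * real n * (real m / (3 * real (card (faces n d)))) - ln (8 * (real d + 1))"
  shows "real (card {ys \<in> prefix (faces n d) m. large_bad \<kappa> n d S (set ys)})
    \<le> exp (- ((1 - \<theta>) * A)) ^ card (light \<kappa> n d S) * exp (- (\<theta> * B)) ^ weight n d (min_heavy \<kappa> n d S)
      * real (card (prefix (faces n d) m))"
proof -
  let ?X = "faces n d" and ?s = "card (light \<kappa> n d S)" and ?y = "weight n d (min_heavy \<kappa> n d S)"
  let ?L = "real (card (prefix ?X m))"
  let ?E = "{ys \<in> prefix ?X m. large_bad \<kappa> n d S (set ys)}"
  let ?G = "\<lambda>F. \<Union>\<alpha>\<in>min_heavy \<kappa> n d S. fresh n d \<alpha> S F"
  have X: "finite ?X" "?X \<noteq> {}" using faces_nonempty[OF n] by auto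
  have 1: "real (card ?E) \<le> exp (- (real ?s * A)) * ?L"
  proof -
    have "card ?E \<le> card {ys \<in> prefix ?X m. set ys \<inter> exposed n d S = {}}"
      using X by (intro card_mono) (auto simp: large_bad_def)
    then have "real (card ?E) \<le> real (card {ys \<in> prefix ?X m. set ys \<inter> exposed n d S = {}})" by simp
    also have "\<dots> \<le> exp (- (real (card (exposed n d S)) * real m / real (card ?X))) * ?L"
      by (rule card_avoid_le) (auto simp: exposed_def)
    also have "\<dots> \<le> exp (- (real ?s * A)) * ?L"
    proof -
      have "real ?s * A \<le> real ?s * ((real n - real d - real d * (\<kappa> * real n)) * (real m / real (card ?X)))"
        using A by (intro mult_left_mono) auto
      also have "\<dots> = (real ?s * (real n - real d - real d * (\<kappa> * real n))) * (real m / real (card ?X))" by simp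
      also have "\<dots> \<le> real (card (exposed n d S)) * (real m / real (card ?X))"
        by (intro mult_right_mono card_exposed_light d S) auto
      finally show ?thesis by (intro mult_right_mono) auto
    qed
    finally show ?thesis .
  qed
  have 2: "real (card ?E) \<le> exp (- (real ?y * B)) * ?L"
  proof -
    let ?g = "drop_const \<kappa> d * real n * real ?y" and ?K = "8 * (real d + 1)"
    have "card ?E \<le> card {ys \<in> prefix ?X m. ?g \<le> real (card (?G (set ys)))}"
      using X by (intro card_mono) (auto simp: large_bad_def)
    then have "real (card ?E) \<le> real (card {ys \<in> prefix ?X m. ?g \<le> real (card (?G (set ys)))})" by simp
    also have "\<dots> \<le> ?K ^ ?y * exp (- (?g * real m / (3 * real (card ?X)))) * ?L"
    proof (rule card_drops_le[OF X])
      show "?G Y' \<subseteq> ?G Y" if "Y \<subseteq> Y'" "Y' \<subseteq> ?X" for Y Y'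
        using fresh_antimono[OF that] by blast
      show "?G Y \<subseteq> ?X - Y" if "Y \<subseteq> ?X" for Y using fresh_disjoint[OF that] by blast
      show "0 \<le> ?g" using drop_const_nonneg[OF \<kappa>] by simp
      show "(3 / 2) ^ drops ?G ys \<le> ?K ^ ?y" if "ys \<in> prefix ?X m" for ys
        using that d by (intro drops_Union_fresh_le) (auto simp: prefix_def)
    qed
    also have "?K ^ ?y * exp (- (?g * real m / (3 * real (card ?X)))) \<le> exp (- (real ?y * B))"
    proof -
      have "?K ^ ?y = exp (real ?y * ln ?K)" by (simp add: exp_of_nat_mult)
      then have "?K ^ ?y * exp (- (?g * real m / (3 * real (card ?X))))
         = exp (- (real ?y * (drop_const \<kappa> d * real n * (real m / (3 * real (card ?X))) - ln ?K)))"
        by (simp flip: exp_add) (simp add: algebra_simps)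
      also have "\<dots> \<le> exp (- (real ?y * B))" using mult_left_mono[OF B, of "real ?y"] by simp
      finally show ?thesis .
    qed
    finally show ?thesis by (simp add: mult_right_mono)
  qed
  have "(1 - \<theta>) * (real ?s * A) + \<theta> * (real ?y * B) \<le> max (real ?s * A) (real ?y * B)"
  proof -
    have "(1 - \<theta>) * (real ?s * A) \<le> (1 - \<theta>) * max (real ?s * A) (real ?y * B)"
      "\<theta> * (real ?y * B) \<le> \<theta> * max (real ?s * A) (real ?y * B)"
      using \<theta> by (intro mult_left_mono; simp)+
    then show ?thesis by (simp add: algebra_simps)
  qed
  then have "exp (- max (real ?s * A) (real ?y * B)) * ?L
      \<le> exp (- ((1 - \<theta>) * (real ?s * A) + \<theta> * (real ?y * B))) * ?L"
    by (intro mult_right_mono) auto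
  moreover have "real (card ?E) \<le> exp (- max (real ?s * A) (real ?y * B)) * ?L"
    using 1 2 by (auto simp: max_def)
  ultimately have "real (card ?E) \<le> exp (- ((1 - \<theta>) * (real ?s * A) + \<theta> * (real ?y * B))) * ?L"
    by linarith
  also have "exp (- ((1 - \<theta>) * (real ?s * A) + \<theta> * (real ?y * B)))
    = exp (- ((1 - \<theta>) * A)) ^ ?s * exp (- (\<theta> * B)) ^ ?y"
    by (simp add: algebra_simps flip: exp_of_nat_mult exp_add)
  finally show ?thesis .
qed

section \<open>Generating functions for the sum over supports\<close>

lemma sum_Pow_power:
  fixes x :: real
  assumes "finite A"
  shows "(\<Sum>L\<in>Pow A. x ^ card L) = (1 + x) ^ card A"
proof -
  have "(\<Sum>L\<in>Pow A. x ^ card L) = (\<Sum>L\<in>Pow A. (\<Prod>a\<in>L. x) * (\<Prod>a\<in>A - L. 1))" by simp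
  also have "\<dots> = (\<Prod>a\<in>A. x + 1)" using assms by (rule prod_add[symmetric])
  finally show ?thesis by (simp add: add.commute)
qed

lemma power_le_exp: "0 \<le> x \<Longrightarrow> (1 + x) ^ k \<le> exp (x * real k)" for x :: real
proof -
  assume "0 \<le> x"
  then have "(1 + x) ^ k \<le> exp x ^ k" by (intro power_mono exp_ge_add_one_self) auto
  then show ?thesis by (simp add: exp_of_nat_mult[symmetric] mult.commute)
qed

text \<open>Exponential tilting: the factor exp (card L - r) is at least 1 on the sets that count,
  and with it the sum may run over all subsets.\<close>

lemma sum_large_subsets_le:
  fixes x :: real
  assumes "finite A" and x: "0 \<le> x"
  shows "(\<Sum>L | L \<subseteq> A \<and> r \<le> card L. x ^ card L) \<le> exp (exp 1 * x * real (card A) - real r)"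
proof -
  have "(\<Sum>L | L \<subseteq> A \<and> r \<le> card L. x ^ card L)
     \<le> (\<Sum>L | L \<subseteq> A \<and> r \<le> card L. exp (- real r) * (exp 1 * x) ^ card L)"
  proof (rule sum_mono)
    fix L assume "L \<in> {L. L \<subseteq> A \<and> r \<le> card L}"
    then have "1 \<le> exp (- real r) * exp 1 ^ card L" by (simp flip: exp_of_nat_mult exp_add)
    then have "1 * x ^ card L \<le> (exp (- real r) * exp 1 ^ card L) * x ^ card L"
      using x by (intro mult_right_mono) auto
    then show "x ^ card L \<le> exp (- real r) * (exp 1 * x) ^ card L"
      by (simp add: power_mult_distrib mult.assoc)
  qed
  also have "\<dots> \<le> (\<Sum>L\<in>Pow A. exp (- real r) * (exp 1 * x) ^ card L)"
    using assms by (intro sum_mono2) auto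
  also have "\<dots> = exp (- real r) * (1 + exp 1 * x) ^ card A"
    using assms by (simp add: sum_distrib_left[symmetric] sum_Pow_power)
  also have "\<dots> \<le> exp (- real r) * exp (exp 1 * x * real (card A))"
    using x by (intro mult_left_mono power_le_exp) auto
  finally show ?thesis by (simp add: algebra_simps flip: exp_add)
qed

text \<open>The sum over all families factors over the sets \<alpha>, and each costar has at least
  \<open>n - d\<close> elements; the final 1 is the share of the empty family.\<close>

lemma sum_nonempty_min_heavy_le:
  fixes w :: real
  assumes d: "d \<ge> 1" and n: "n \<ge> d" and w: "0 \<le> w" "w \<le> 1"
  shows "(\<Sum>A\<in>Pow (small_sets n d) - {{}}. w ^ weight n d A)
    \<le> exp (real (card (small_sets n d)) * w ^ (n - d)) - 1"
proof -
  let ?P = "small_sets n d"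
  have f: "finite ?P" by (rule finite_small_sets)
  have "(\<Sum>A\<in>Pow ?P. w ^ weight n d A) = (\<Sum>A\<in>Pow ?P. (\<Prod>\<alpha>\<in>A. w ^ card (costar n d \<alpha>)) * (\<Prod>\<alpha>\<in>?P - A. 1))"
    by (simp add: weight_def power_sum)
  also have "\<dots> = (\<Prod>\<alpha>\<in>?P. w ^ card (costar n d \<alpha>) + 1)" using f by (rule prod_add[symmetric])
  also have "\<dots> \<le> (\<Prod>\<alpha>\<in>?P. 1 + w ^ (n - d))"
  proof (rule prod_mono)
    fix \<alpha> assume "\<alpha> \<in> ?P"
    then have "n - d \<le> card (costar n d \<alpha>)" using card_costar_ge[of d \<alpha> n] d n by auto
    then have "w ^ card (costar n d \<alpha>) \<le> w ^ (n - d)" using w by (intro power_decreasing) auto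
    then show "0 \<le> w ^ card (costar n d \<alpha>) + 1 \<and> w ^ card (costar n d \<alpha>) + 1 \<le> 1 + w ^ (n - d)"
      using w by simp
  qed
  also have "\<dots> \<le> exp (w ^ (n - d) * real (card ?P))" using w power_le_exp[of "w ^ (n - d)"] by simp
  finally have "(\<Sum>A\<in>Pow ?P. w ^ weight n d A) \<le> exp (real (card ?P) * w ^ (n - d))" by (simp add: mult.commute)
  moreover have "(\<Sum>A\<in>Pow ?P. w ^ weight n d A) = 1 + (\<Sum>A\<in>Pow ?P - {{}}. w ^ weight n d A)"
    using f by (subst sum.remove[of _ "{}"]) (auto simp: weight_def)
  ultimately show ?thesis by simp
qed

text \<open>A support is encoded by its minimal heavy sets, its light part, and the rest, which is a subset of the union
  of the costars of the minimal heavy sets.\<close>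

lemma sum_supports_le:
  fixes x z :: real
  assumes d: "d \<ge> 2" and n: "n \<ge> d" and x: "0 \<le> x" and z: "0 \<le> z" "2 * z \<le> 1"
  shows "(\<Sum>S | S \<subseteq> faces n (d - 1) \<and> r \<le> card S. x ^ card (light \<kappa> n d S) * z ^ weight n d (min_heavy \<kappa> n d S))
    \<le> exp (exp 1 * x * real (n choose d) - real r)
      + (exp (real (card (small_sets n d)) * (2 * z) ^ (n - d)) - 1) * exp (x * real (n choose d))"
proof -
  let ?F = "faces n (d - 1)" and ?P = "small_sets n d"
  let ?w = "\<lambda>S. x ^ card (light \<kappa> n d S) * z ^ weight n d (min_heavy \<kappa> n d S)"
  have cF: "card ?F = n choose d" using card_faces[of n "d - 1"] d by simp
  let ?Q = "{S. S \<subseteq> ?F \<and> r \<le> card S}"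
  have fQ: "finite ?Q" by simp
  let ?Qa = "{S \<in> ?Q. min_heavy \<kappa> n d S = {}}" and ?Qb = "{S \<in> ?Q. min_heavy \<kappa> n d S \<noteq> {}}"
  have "?Q = ?Qa \<union> ?Qb" by blast
  then have "(\<Sum>S\<in>?Q. ?w S) = (\<Sum>S\<in>?Qa \<union> ?Qb. ?w S)" by (rule sum.cong) (rule refl)
  also have "\<dots> = (\<Sum>S\<in>?Qa. ?w S) + (\<Sum>S\<in>?Qb. ?w S)"
    using fQ by (intro sum.union_disjoint) auto
  also have "(\<Sum>S\<in>?Qa. ?w S) \<le> (\<Sum>L | L \<subseteq> ?F \<and> r \<le> card L. x ^ card L)"
  proof -
    \<comment> \<open>Without a minimal heavy set the whole support is light. Only here the lower
      bound \<open>r\<close> on its size is exploited; supports with heavy sets are paid for by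
      their weight.\<close>
    have "light \<kappa> n d S = S" if "S \<in> ?Qa" for S
      using that subset_light_Un_costars[of S n d \<kappa>] light_subset[of \<kappa> n d S] by auto
    then have "(\<Sum>S\<in>?Qa. ?w S) = (\<Sum>S\<in>?Qa. x ^ card S)" by (intro sum.cong) (auto simp: weight_def)
    also have "\<dots> \<le> (\<Sum>L\<in>?Q. x ^ card L)" using x fQ by (intro sum_mono2) auto
    finally show ?thesis .
  qed
  also have "\<dots> \<le> exp (exp 1 * x * real (n choose d) - real r)"
    using sum_large_subsets_le[of ?F x r] x cF by simp
  also have "(\<Sum>S\<in>?Qb. ?w S) \<le> (exp (real (card ?P) * (2 * z) ^ (n - d)) - 1) * exp (x * real (n choose d))"
  proof -
    let ?U = "\<lambda>A. \<Union>\<alpha>\<in>A. costar n d \<alpha>"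
    let ?T = "SIGMA A:Pow ?P - {{}}. Pow ?F \<times> Pow (?U A)"
    let ?e = "\<lambda>S. (min_heavy \<kappa> n d S, light \<kappa> n d S, S - light \<kappa> n d S)"
    have fU: "finite (?U A)" if "A \<subseteq> ?P" for A
      using that finite_subset[OF _ finite_small_sets] by auto
    have fT: "finite ?T" using fU finite_small_sets by (intro finite_SigmaI) auto
    have inj: "inj_on ?e ?Qb" using light_subset by (auto simp: inj_on_def) blast+
    have sub: "?e ` ?Qb \<subseteq> ?T"
    proof (rule image_subsetI)
      fix S assume S: "S \<in> ?Qb"
      have "light \<kappa> n d S \<subseteq> ?F" using S light_subset[of \<kappa> n d S] by blast
      moreover have "S - light \<kappa> n d S \<subseteq> ?U (min_heavy \<kappa> n d S)" using S by (intro subset_light_Un_costars) auto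
      moreover have "min_heavy \<kappa> n d S \<in> Pow ?P - {{}}" using S min_heavy_subset[of \<kappa> n d S] by blast
      ultimately show "?e S \<in> ?T" by (intro SigmaI PowI)
    qed
    have "(\<Sum>S\<in>?Qb. ?w S) = (\<Sum>(A, L, R)\<in>?e ` ?Qb. x ^ card L * z ^ weight n d A)"
      by (subst sum.reindex[OF inj]) simp
    also have "\<dots> \<le> (\<Sum>(A, L, R)\<in>?T. x ^ card L * z ^ weight n d A)"
      using x z by (intro sum_mono2 fT sub) auto
    also have "\<dots> = (\<Sum>A\<in>Pow ?P - {{}}. \<Sum>(L, R)\<in>Pow ?F \<times> Pow (?U A). x ^ card L * z ^ weight n d A)"
      using fU finite_small_sets by (intro sum.Sigma[symmetric]) auto
    also have "\<dots> = (\<Sum>A\<in>Pow ?P - {{}}. \<Sum>L\<in>Pow ?F. \<Sum>R\<in>Pow (?U A). x ^ card L * z ^ weight n d A)"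
      by (intro sum.cong refl sum.cartesian_product[symmetric])
    also have "\<dots> = (\<Sum>A\<in>Pow ?P - {{}}. \<Sum>L\<in>Pow ?F. x ^ card L * (2 ^ card (?U A) * z ^ weight n d A))"
      using fU by (intro sum.cong refl) (simp add: card_Pow)
    also have "\<dots> = (\<Sum>A\<in>Pow ?P - {{}}. (1 + x) ^ card ?F * (2 ^ card (?U A) * z ^ weight n d A))"
      by (simp add: sum_distrib_right[symmetric] sum_Pow_power)
    \<comment> \<open>The choices for the rest of the support, a subset of the union of costars, are
      absorbed by doubling \<open>z\<close>.\<close>
    also have "\<dots> \<le> (\<Sum>A\<in>Pow ?P - {{}}. (1 + x) ^ card ?F * (2 * z) ^ weight n d A)"
    proof (intro sum_mono mult_left_mono)
      fix A assume "A \<in> Pow ?P - {{}}"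
      then have "finite A" using finite_subset[OF _ finite_small_sets] by auto
      then have "card (?U A) \<le> weight n d A" unfolding weight_def by (rule card_UN_le)
      then have "(2::real) ^ card (?U A) \<le> 2 ^ weight n d A" by simp
      then have "2 ^ card (?U A) * z ^ weight n d A \<le> 2 ^ weight n d A * z ^ weight n d A"
        using z by (intro mult_right_mono) auto
      then show "2 ^ card (?U A) * z ^ weight n d A \<le> (2 * z) ^ weight n d A" by (simp add: power_mult_distrib)
    qed (use x in auto)
    also have "\<dots> = (1 + x) ^ card ?F * (\<Sum>A\<in>Pow ?P - {{}}. (2 * z) ^ weight n d A)"
      by (simp add: sum_distrib_left)
    also have "\<dots> \<le> exp (x * real (n choose d)) * (exp (real (card ?P) * (2 * z) ^ (n - d)) - 1)"
    proof (rule mult_mono)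
      show "(1 + x) ^ card ?F \<le> exp (x * real (n choose d))" using power_le_exp[OF x] cF by simp
      show "(\<Sum>A\<in>Pow ?P - {{}}. (2 * z) ^ weight n d A) \<le> exp (real (card ?P) * (2 * z) ^ (n - d)) - 1"
        using sum_nonempty_min_heavy_le[of d n "2 * z"] d n z by simp
    qed (use z in \<open>auto intro!: sum_nonneg\<close>)
    finally show ?thesis by (simp add: mult.commute)
  qed
  finally show ?thesis by simp
qed

lemma card_exists_large_bad_le:
  assumes d: "d \<ge> 2" and n: "n > d" and \<kappa>: "\<kappa> \<ge> 0" and \<theta>: "0 \<le> \<theta>" "\<theta> \<le> 1"
    and A: "A \<le> (real n - real d - real d * (\<kappa> * real n)) * (real m / real (card (faces n d)))"
    and B: "B \<le> drop_const \<kappa> d * real n * (real m / (3 * real (card (faces n d)))) - ln (8 * (real d + 1))"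
    and z: "2 * exp (- (\<theta> * B)) \<le> 1"
  shows "real (card {ys \<in> prefix (faces n d) m. \<exists>S. S \<subseteq> faces n (d - 1) \<and> r \<le> card S \<and> large_bad \<kappa> n d S (set ys)})
    \<le> (exp (exp 1 * exp (- ((1 - \<theta>) * A)) * real (n choose d) - real r)
      + (exp (real (card (small_sets n d)) * (2 * exp (- (\<theta> * B))) ^ (n - d)) - 1)
        * exp (exp (- ((1 - \<theta>) * A)) * real (n choose d))) * real (card (prefix (faces n d) m))"
proof -
  let ?Q = "{S. S \<subseteq> faces n (d - 1) \<and> r \<le> card S}"
  let ?E = "\<lambda>S. {ys \<in> prefix (faces n d) m. large_bad \<kappa> n d S (set ys)}"
  let ?all = "{ys \<in> prefix (faces n d) m. \<exists>S. S \<subseteq> faces n (d - 1) \<and> r \<le> card S \<and> large_bad \<kappa> n d S (set ys)}"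
  let ?x = "exp (- ((1 - \<theta>) * A))" and ?z = "exp (- (\<theta> * B))" and ?L = "real (card (prefix (faces n d) m))"
  have fQ: "finite ?Q" by simp
  have "?all = (\<Union>S\<in>?Q. ?E S)" by auto
  then have "real (card ?all) \<le> (\<Sum>S\<in>?Q. real (card (?E S)))"
    using card_UN_le[OF fQ, of ?E] by (simp flip: of_nat_sum)
  also have "\<dots> \<le> (\<Sum>S\<in>?Q. ?x ^ card (light \<kappa> n d S) * ?z ^ weight n d (min_heavy \<kappa> n d S) * ?L)"
    by (intro sum_mono card_large_bad_le[OF d n \<kappa> _ \<theta> A B]) auto
  also have "\<dots> = (\<Sum>S\<in>?Q. ?x ^ card (light \<kappa> n d S) * ?z ^ weight n d (min_heavy \<kappa> n d S)) * ?L" by (simp add: sum_distrib_right)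
  also have "\<dots> \<le> (exp (exp 1 * ?x * real (n choose d) - real r)
      + (exp (real (card (small_sets n d)) * (2 * ?z) ^ (n - d)) - 1) * exp (?x * real (n choose d))) * ?L"
    using d n z by (intro mult_right_mono sum_supports_le) auto
  finally show ?thesis .
qed

text \<open>In a set of at most \<open>r\<close> faces all codegrees are at most
  \<open>\<kappa> * n\<close>, so every element exposes almost n faces. The union bound starts at
  two elements; a single face would be an isolated one.\<close>

lemma card_exists_small_bad_le:
  assumes d: "d \<ge> 2" and \<kappa>: "real r \<le> \<kappa> * real n"
    and A: "A \<le> (real n - real d - real d * (\<kappa> * real n)) * (real m / real (card (faces n d)))"
  shows "real (card {ys \<in> prefix (faces n d) m. \<exists>k\<in>{1..<r}. \<exists>S\<in>conn_sets n d k. set ys \<inter> exposed n d S = {}})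
    \<le> (\<Sum>k\<in>{1..<r}. real (n choose d) * (real r * real d * real n) ^ k * exp (- A) ^ Suc k)
       * real (card (prefix (faces n d) m))"
proof -
  let ?L = "real (card (prefix (faces n d) m))"
  let ?E = "\<lambda>S. {ys \<in> prefix (faces n d) m. set ys \<inter> exposed n d S = {}}"
  let ?all = "{ys \<in> prefix (faces n d) m. \<exists>k\<in>{1..<r}. \<exists>S\<in>conn_sets n d k. set ys \<inter> exposed n d S = {}}"
  have fc: "finite (conn_sets n d k)" if "k < r" for k using card_conn_sets_le[of d k r n] that d by auto
  have one: "real (card (?E S)) \<le> exp (- A) ^ Suc k * ?L" if S: "S \<in> conn_sets n d k" and k: "k < r" for k S
  proof -
    note p = conn_sets_props[OF S]
    have "real (Suc k) * A \<le> real (Suc k) * ((real n - real d - real d * (\<kappa> * real n)) * (real m / real (card (faces n d))))"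
      using A by (intro mult_left_mono) auto
    also have "\<dots> = (real (card S) * (real n - real d - real d * (\<kappa> * real n))) * (real m / real (card (faces n d)))"
      using p by simp
    also have "\<dots> \<le> real (card (exposed n d S)) * (real m / real (card (faces n d)))"
    proof (intro mult_right_mono card_exposed_ge d)
      show "real (codeg S \<rho>) \<le> \<kappa> * real n" for \<rho>
      proof -
        have "codeg S \<rho> \<le> card S" unfolding codeg_def using p by (intro card_mono) auto
        then have "codeg S \<rho> \<le> r" using p k by simp
        then show ?thesis using \<kappa> by linarith
      qed
    qed (use p in auto)
    finally have le: "real (Suc k) * A \<le> real (card (exposed n d S)) * real m / real (card (faces n d))" by simp
    have "real (card (?E S)) \<le> exp (- (real (card (exposed n d S)) * real m / real (card (faces n d)))) * ?L"
      by (rule card_avoid_le) (auto simp: exposed_def)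
    also have "\<dots> \<le> exp (- (real (Suc k) * A)) * ?L" using le by (intro mult_right_mono) auto
    also have "exp (- (real (Suc k) * A)) = exp (- A) ^ Suc k"
      by (simp only: exp_of_nat_mult[symmetric] mult_minus_right)
    finally show ?thesis .
  qed
  have "?all = (\<Union>k\<in>{1..<r}. \<Union>S\<in>conn_sets n d k. ?E S)" by auto
  then have "card ?all \<le> (\<Sum>k\<in>{1..<r}. card (\<Union>S\<in>conn_sets n d k. ?E S))"
    using card_UN_le[of "{1..<r}" "\<lambda>k. \<Union>S\<in>conn_sets n d k. ?E S"] by simp
  also have "\<dots> \<le> (\<Sum>k\<in>{1..<r}. \<Sum>S\<in>conn_sets n d k. card (?E S))"
    using fc by (intro sum_mono card_UN_le) auto
  finally have "real (card ?all) \<le> (\<Sum>k\<in>{1..<r}. \<Sum>S\<in>conn_sets n d k. real (card (?E S)))"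
    by (simp flip: of_nat_sum)
  also have "\<dots> \<le> (\<Sum>k\<in>{1..<r}. \<Sum>S\<in>conn_sets n d k. exp (- A) ^ Suc k * ?L)"
    by (intro sum_mono one) auto
  also have "\<dots> = (\<Sum>k\<in>{1..<r}. real (card (conn_sets n d k)) * (exp (- A) ^ Suc k * ?L))" by simp
  also have "\<dots> \<le> (\<Sum>k\<in>{1..<r}. (real (n choose d) * (real r * real d * real n) ^ k) * (exp (- A) ^ Suc k * ?L))"
  proof (intro sum_mono mult_right_mono)
    fix k assume "k \<in> {1..<r}"
    then have "card (conn_sets n d k) \<le> (n choose d) * (r * d * n) ^ k" using card_conn_sets_le[of d k r n] d by auto
    then have "real (card (conn_sets n d k)) \<le> real ((n choose d) * (r * d * n) ^ k)" by (rule of_nat_mono)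
    then show "real (card (conn_sets n d k)) \<le> real (n choose d) * (real r * real d * real n) ^ k" by simp
  qed auto
  finally show ?thesis by (simp add: sum_distrib_right mult.assoc)
qed

text \<open>A large support of an obstruction in \<open>F'\<close> gives \<open>large_bad\<close>, a
  small one is replaced by a component. The component is not a single face, as \<open>F'\<close>
  covers every face; all other conditions pass from \<open>F'\<close> down to
  \<open>F\<close>.\<close>

lemma nonvanishing_imp_bad:
  assumes d: "d \<ge> 2" and n: "n \<ge> 2 * d" and \<kappa>: "0 < \<kappa>" "\<kappa> \<le> 1 / (4 * (real d + 1)\<^sup>2)"
    and F: "F \<subseteq> F'" "F' \<subseteq> faces n d" and ni: "no_isolated n d F'" and nv: "\<not> homology_vanishes n d F'"
  shows "(\<exists>k\<in>{1..<r}. \<exists>S\<in>conn_sets n d k. F \<inter> exposed n d S = {})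
    \<or> (\<exists>S. S \<subseteq> faces n (d - 1) \<and> r \<le> card S \<and> large_bad \<kappa> n d S F)"
proof -
  have n1: "n \<ge> 1" using n d by simp
  show ?thesis
  proof (rule nonvanishing_support[OF d n1 F(2) nv])
    fix S assume S: "S \<subseteq> faces n (d - 1)" "S \<noteq> {}" "F' \<inter> exposed n d S = {}"
      and ex: "\<And>\<alpha>. \<alpha> \<subseteq> {0..<n} \<Longrightarrow> (n - card \<alpha>) * card {\<tau> \<in> S. \<alpha> \<subseteq> \<tau>}
         \<le> (d + 1 - card \<alpha>) * (card (fresh n d \<alpha> S F') + card (mixed n d \<alpha> S))"
    show ?thesis
    proof (cases "r \<le> card S")
      case True
      have "drop_const \<kappa> d * real n * real (weight n d (min_heavy \<kappa> n d S)) \<le> real (card (\<Union>\<alpha>\<in>min_heavy \<kappa> n d S. fresh n d \<alpha> S F'))"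
        by (rule card_Union_fresh_ge[OF d n \<kappa> S(1) ex])
      also have "card (\<Union>\<alpha>\<in>min_heavy \<kappa> n d S. fresh n d \<alpha> S F') \<le> card (\<Union>\<alpha>\<in>min_heavy \<kappa> n d S. fresh n d \<alpha> S F)"
        using fresh_antimono[OF F] by (intro card_mono) (auto simp: fresh_def clean_def)
      finally have "large_bad \<kappa> n d S F" using S F by (auto simp: large_bad_def)
      then show ?thesis using S True by blast
    next
      case False
      obtain k S' where S': "S' \<in> conn_sets n d k" "S' \<subseteq> S" "exposed n d S' \<subseteq> exposed n d S"
        by (rule exists_conn_sets_component[OF d S(1,2)])
      note p = conn_sets_props[OF S'(1)]
      have fS: "finite S" using S(1) by (rule finite_subset) simp
      have disj: "F' \<inter> exposed n d S' = {}" using S S' by blast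
      have kr: "k < r" using p card_mono[OF fS S'(2)] False by simp
      have "k \<noteq> 0"
      proof
        assume "k = 0"
        then obtain \<tau> where t: "S' = {\<tau>}" "\<tau> \<in> faces n (d - 1)" using S' by auto
        obtain \<sigma> where s: "\<sigma> \<in> F'" "\<tau> \<subseteq> \<sigma>" using ni t by (auto simp: no_isolated_def)
        have "{\<tau>' \<in> S'. \<tau>' \<subseteq> \<sigma>} = {\<tau>}" using t s by auto
        then have "\<sigma> \<in> exposed n d S'" using s F by (auto simp: exposed_def)
        then show False using disj s by blast
      qed
      then have "k \<in> {1..<r}" using kr by simp
      moreover have "F \<inter> exposed n d S' = {}" using disj F by blast
      ultimately show ?thesis using S' by blast
    qed
  qed
qed

section \<open>Isolated faces by the second moment method\<close>

lemma card_star: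
  assumes d: "d \<ge> 1" and t: "\<tau> \<in> faces n (d - 1)"
  shows "card {\<sigma> \<in> faces n d. \<tau> \<subseteq> \<sigma>} = n - d"
proof -
  have t': "\<tau> \<subseteq> {0..<n}" "card \<tau> = d" "finite \<tau>" using t d face_finite[OF t] by (auto simp: faces_def)
  have "bij_betw (\<lambda>v. insert v \<tau>) ({0..<n} - \<tau>) {\<sigma> \<in> faces n d. \<tau> \<subseteq> \<sigma>}"
  proof (intro bij_betw_imageI)
    show "inj_on (\<lambda>v. insert v \<tau>) ({0..<n} - \<tau>)" by (auto simp: inj_on_def)
    show "(\<lambda>v. insert v \<tau>) ` ({0..<n} - \<tau>) = {\<sigma> \<in> faces n d. \<tau> \<subseteq> \<sigma>}"
    proof
      show "(\<lambda>v. insert v \<tau>) ` ({0..<n} - \<tau>) \<subseteq> {\<sigma> \<in> faces n d. \<tau> \<subseteq> \<sigma>}"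
        using t' by (auto simp: faces_def)
      show "{\<sigma> \<in> faces n d. \<tau> \<subseteq> \<sigma>} \<subseteq> (\<lambda>v. insert v \<tau>) ` ({0..<n} - \<tau>)"
      proof
        fix \<sigma> assume s: "\<sigma> \<in> {\<sigma> \<in> faces n d. \<tau> \<subseteq> \<sigma>}"
        then have s': "card \<sigma> = Suc (card \<tau>)" "\<sigma> \<subseteq> {0..<n}" "\<tau> \<subseteq> \<sigma>"
          using t' by (auto simp: faces_def)
        have "finite \<sigma>" using s face_finite[of \<sigma> n d] by simp
        then obtain u where "u \<notin> \<tau>" "\<sigma> = insert u \<tau>" using s'(3,1) by (rule incid_codim1)
        then show "\<sigma> \<in> (\<lambda>v. insert v \<tau>) ` ({0..<n} - \<tau>)" using s' by auto
      qed
    qed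
  qed
  then have "card {\<sigma> \<in> faces n d. \<tau> \<subseteq> \<sigma>} = card ({0..<n} - \<tau>)" by (simp add: bij_betw_same_card)
  then show ?thesis using t' by (simp add: card_Diff_subset)
qed

lemma card_two_stars:
  assumes d: "d \<ge> 1" and t: "\<tau> \<in> faces n (d - 1)" "\<tau>' \<in> faces n (d - 1)" and ne: "\<tau> \<noteq> \<tau>'"
  shows "2 * (n - d) - (if card (\<tau> \<union> \<tau>') = d + 1 then 1 else 0)
    \<le> card ({\<sigma> \<in> faces n d. \<tau> \<subseteq> \<sigma>} \<union> {\<sigma> \<in> faces n d. \<tau>' \<subseteq> \<sigma>})"
proof -
  let ?A = "{\<sigma> \<in> faces n d. \<tau> \<subseteq> \<sigma>}" and ?B = "{\<sigma> \<in> faces n d. \<tau>' \<subseteq> \<sigma>}"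
  have f: "card \<tau> = d" "card \<tau>' = d" "finite \<tau>" "finite \<tau>'" using t d face_finite[OF t(1)] face_finite[OF t(2)] by (auto simp: faces_def)
  have "\<not> \<tau> \<subseteq> \<tau>'" using ne f card_subset_eq[of \<tau>' \<tau>] by auto
  then have "\<tau>' \<subset> \<tau> \<union> \<tau>'" by blast
  then have "card \<tau>' < card (\<tau> \<union> \<tau>')" using f by (intro psubset_card_mono) auto
  then have c: "d + 1 \<le> card (\<tau> \<union> \<tau>')" using f by simp
  have sub: "?A \<inter> ?B \<subseteq> (if card (\<tau> \<union> \<tau>') = d + 1 then {\<tau> \<union> \<tau>'} else {})"
  proof
    fix \<sigma> assume s: "\<sigma> \<in> ?A \<inter> ?B"
    then have s': "\<tau> \<union> \<tau>' \<subseteq> \<sigma>" "card \<sigma> = d + 1" "finite \<sigma>"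
      using face_finite[of \<sigma> n d] by (auto simp: faces_def)
    then have "card (\<tau> \<union> \<tau>') = d + 1" using c card_mono[of \<sigma> "\<tau> \<union> \<tau>'"] by simp
    moreover from this have "\<tau> \<union> \<tau>' = \<sigma>" using s' by (intro card_subset_eq) auto
    ultimately show "\<sigma> \<in> (if card (\<tau> \<union> \<tau>') = d + 1 then {\<tau> \<union> \<tau>'} else {})" by simp
  qed
  have "card (?A \<inter> ?B) \<le> card (if card (\<tau> \<union> \<tau>') = d + 1 then {\<tau> \<union> \<tau>'} else {})"
    by (intro card_mono sub) auto
  also have "\<dots> = (if card (\<tau> \<union> \<tau>') = d + 1 then 1 else 0)" by simp
  finally have "card (?A \<inter> ?B) \<le> (if card (\<tau> \<union> \<tau>') = d + 1 then 1 else 0)" .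
  moreover have "card ?A + card ?B = card (?A \<union> ?B) + card (?A \<inter> ?B)" by (rule card_Un_Int) auto
  ultimately show ?thesis using card_star[OF d t(1)] card_star[OF d t(2)] by simp
qed

text \<open>Chebyshev's inequality in counting form: where no event occurs, the counting variable is
  0 and deviates from its mean by \<open>\<mu>\<close>.\<close>

lemma card_none_le:
  fixes E :: "'t \<Rightarrow> 'w \<Rightarrow> bool"
  assumes W: "finite W" and T: "finite T" and \<mu>: "\<mu> > 0"
    and mean: "(\<Sum>t\<in>T. real (card {w \<in> W. E t w})) = \<mu> * real (card W)"
  shows "real (card {w \<in> W. \<forall>t\<in>T. \<not> E t w}) * \<mu>\<^sup>2
    \<le> (\<Sum>t\<in>T. \<Sum>t'\<in>T. real (card {w \<in> W. E t w \<and> E t' w})) - \<mu>\<^sup>2 * real (card W)"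
proof -
  define X where "X w = (\<Sum>t\<in>T. if E t w then 1 else 0::real)" for w
  have s1: "(\<Sum>w\<in>W. X w) = \<mu> * real (card W)"
    unfolding X_def mean[symmetric] by (subst sum.swap) (use W in \<open>simp add: sum.If_cases Int_def\<close>)
  have s2: "(\<Sum>w\<in>W. (X w)\<^sup>2) = (\<Sum>t\<in>T. \<Sum>t'\<in>T. real (card {w \<in> W. E t w \<and> E t' w}))"
  proof -
    have "(X w)\<^sup>2 = (\<Sum>t\<in>T. \<Sum>t'\<in>T. if E t w \<and> E t' w then 1 else 0)" for w
      unfolding X_def power2_eq_square sum_product by (intro sum.cong) auto
    then have "(\<Sum>w\<in>W. (X w)\<^sup>2) = (\<Sum>w\<in>W. \<Sum>t\<in>T. \<Sum>t'\<in>T. if E t w \<and> E t' w then 1 else 0)" by simp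
    also have "\<dots> = (\<Sum>t\<in>T. \<Sum>w\<in>W. \<Sum>t'\<in>T. if E t w \<and> E t' w then 1 else 0)" by (rule sum.swap)
    also have "\<dots> = (\<Sum>t\<in>T. \<Sum>t'\<in>T. \<Sum>w\<in>W. if E t w \<and> E t' w then 1 else 0)"
      by (intro sum.cong refl sum.swap)
    also have "\<dots> = (\<Sum>t\<in>T. \<Sum>t'\<in>T. real (card {w \<in> W. E t w \<and> E t' w}))"
      using W by (simp add: sum.If_cases Int_def)
    finally show ?thesis .
  qed
  let ?Z = "{w \<in> W. \<forall>t\<in>T. \<not> E t w}"
  have "real (card ?Z) * \<mu>\<^sup>2 = (\<Sum>w\<in>?Z. (X w - \<mu>)\<^sup>2)"
  proof -
    have "X w = 0" if "w \<in> ?Z" for w using that unfolding X_def by (intro sum.neutral) auto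
    then show ?thesis by simp
  qed
  also have "\<dots> \<le> (\<Sum>w\<in>W. (X w - \<mu>)\<^sup>2)" using W by (intro sum_mono2) auto
  also have "\<dots> = (\<Sum>w\<in>W. (X w)\<^sup>2 - 2 * \<mu> * X w + \<mu>\<^sup>2)"
    by (intro sum.cong refl) (simp add: power2_diff)
  also have "\<dots> = (\<Sum>w\<in>W. (X w)\<^sup>2) - 2 * \<mu> * (\<Sum>w\<in>W. X w) + real (card W) * \<mu>\<^sup>2"
    by (simp add: sum.distrib sum_subtractf sum_distrib_left)
  also have "\<dots> = (\<Sum>w\<in>W. (X w)\<^sup>2) - \<mu>\<^sup>2 * real (card W)"
    unfolding s1 by (simp add: power2_eq_square)
  finally show ?thesis unfolding s2 .
qed

text \<open>Avoiding two disjoint stars is negatively correlated: (t - 2b) t \<le> (t - b)^2 for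
  each factor. One shared face adds t \<le> (4 / M) (t - b)^2, and the resulting (1 + 4 / M)^m is at
  most e.\<close>

lemma prod_avoid_ratio:
  fixes M b m :: nat
  assumes m: "4 * m \<le> M" and b: "4 * b \<le> M"
  shows "(\<Prod>i<m. real (M - 2 * b - i)) * (\<Prod>i<m. real (M - i)) \<le> (\<Prod>i<m. real (M - b - i))\<^sup>2"
    and "(\<Prod>i<m. real (M - (2 * b - 1) - i)) * (\<Prod>i<m. real (M - i)) \<le> 3 * (\<Prod>i<m. real (M - b - i))\<^sup>2"
proof -
  show "(\<Prod>i<m. real (M - 2 * b - i)) * (\<Prod>i<m. real (M - i)) \<le> (\<Prod>i<m. real (M - b - i))\<^sup>2"
    unfolding power2_eq_square prod.distrib[symmetric]
  proof (intro prod_mono conjI)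
    fix i assume i: "i \<in> {..<m}"
    define t where "t = real M - real i"
    have e: "real (M - 2 * b - i) = t - 2 * real b" "real (M - i) = t" "real (M - b - i) = t - real b"
      using i m b by (auto simp: t_def)
    show "real (M - 2 * b - i) * real (M - i) \<le> real (M - b - i) * real (M - b - i)"
      unfolding e by (simp add: algebra_simps)
  qed auto
  have "(\<Prod>i<m. real (M - (2 * b - 1) - i)) * (\<Prod>i<m. real (M - i))
      \<le> (\<Prod>i<m. (1 + 4 / real M) * (real (M - b - i) * real (M - b - i)))"
    unfolding prod.distrib[symmetric]
  proof (intro prod_mono conjI)
    fix i assume i: "i \<in> {..<m}"
    define t where "t = real M - real i"
    have M: "real M > 0" using i m by simp
    have e: "real (M - (2 * b - 1) - i) \<le> t - 2 * real b + 1" "real (M - i) = t" "real (M - b - i) = t - real b"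
      using i m b by (auto simp: t_def)
    have t: "0 \<le> t" "t \<le> real M" "real M / 2 \<le> t - real b" using i m b by (auto simp: t_def)
    have "(real M / 2)\<^sup>2 \<le> (t - real b)\<^sup>2" using t by (intro power_mono) auto
    then have "4 / real M * (real M / 2)\<^sup>2 \<le> 4 / real M * (t - real b)\<^sup>2" using M by (intro mult_left_mono) auto
    moreover have "4 / real M * (real M / 2)\<^sup>2 = real M" using M by (simp add: power2_eq_square)
    ultimately have 1: "t \<le> 4 / real M * (t - real b)\<^sup>2" using t by simp
    have "real (M - (2 * b - 1) - i) * real (M - i) \<le> (t - 2 * real b + 1) * t"
      using e t by (simp add: mult_right_mono)
    also have "\<dots> \<le> (t - real b)\<^sup>2 + t" by (simp add: power2_eq_square algebra_simps)
    also have "\<dots> \<le> (1 + 4 / real M) * (t - real b)\<^sup>2" using 1 by (simp add: algebra_simps)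
    finally show "real (M - (2 * b - 1) - i) * real (M - i) \<le> (1 + 4 / real M) * (real (M - b - i) * real (M - b - i))"
      by (simp only: e(3) power2_eq_square)
  qed auto
  also have "\<dots> = (1 + 4 / real M) ^ m * (\<Prod>i<m. real (M - b - i))\<^sup>2"
    by (simp add: prod.distrib power2_eq_square)
  also have "\<dots> \<le> 3 * (\<Prod>i<m. real (M - b - i))\<^sup>2"
  proof (rule mult_right_mono)
    have "(1 + 4 / real M) ^ m \<le> exp (4 / real M) ^ m" by (intro power_mono exp_ge_add_one_self) auto
    also have "\<dots> = exp (real m * (4 / real M))" by (rule exp_of_nat_mult[symmetric])
    also have "\<dots> \<le> exp 1" using m by (cases "M = 0") (auto simp: field_simps)
    also have "\<dots> \<le> 3" by (rule exp_le)
    finally show "(1 + 4 / real M) ^ m \<le> 3" .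
  qed simp
  finally show "(\<Prod>i<m. real (M - (2 * b - 1) - i)) * (\<Prod>i<m. real (M - i)) \<le> 3 * (\<Prod>i<m. real (M - b - i))\<^sup>2" .
qed

text \<open>Each ratio of factors is at least \<open>1 - u\<close>, and ln (1 - u) \<ge> - u - 2
  u^2.\<close>

lemma prod_avoid_lower:
  fixes M b m :: nat
  assumes m: "m < M" and u: "u = real b / (real M - real m)" "u \<le> 1/2"
  shows "exp (- (real m * (u + 2 * u\<^sup>2))) * (\<Prod>i<m. real (M - i)) \<le> (\<Prod>i<m. real (M - b - i))"
proof -
  have u0: "u \<ge> 0" using u m by simp
  have "exp (- (u + 2 * u\<^sup>2)) \<le> exp (ln (1 - u))"
    using ln_one_minus_pos_lower_bound[of u] u u0 by simp
  then have e: "exp (- (u + 2 * u\<^sup>2)) \<le> 1 - u" using u by simp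
  have "exp (- (real m * (u + 2 * u\<^sup>2))) = exp (- (u + 2 * u\<^sup>2)) ^ m"
    by (simp only: exp_of_nat_mult[symmetric] mult_minus_right)
  then have "exp (- (real m * (u + 2 * u\<^sup>2))) * (\<Prod>i<m. real (M - i)) = (\<Prod>i<m. exp (- (u + 2 * u\<^sup>2)) * real (M - i))"
    by (simp add: prod.distrib)
  also have "\<dots> \<le> (\<Prod>i<m. real (M - b - i))"
  proof (intro prod_mono conjI)
    fix i assume i: "i \<in> {..<m}"
    have "real b = u * (real M - real m)" using u m by simp
    also have "\<dots> \<le> u * (real M - real i)" using u0 i by (intro mult_left_mono) auto
    finally have b: "real b \<le> u * (real M - real i)" .
    have "exp (- (u + 2 * u\<^sup>2)) * real (M - i) \<le> (1 - u) * real (M - i)" using e by (intro mult_right_mono) auto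
    also have "\<dots> = (real M - real i) - u * (real M - real i)" using i m by (simp add: of_nat_diff algebra_simps)
    also have "\<dots> \<le> real M - real i - real b" using b by simp
    also have "\<dots> \<le> real (M - b - i)" by linarith
    finally show "exp (- (u + 2 * u\<^sup>2)) * real (M - i) \<le> real (M - b - i)" .
  qed auto
  finally show ?thesis .
qed

text \<open>Pairs of non-adjacent faces contribute at most the squared mean, which cancels. The
  first error term comes from equal pairs; the second from adjacent ones, at most
  \<open>d * n\<close> for each face.\<close>

lemma card_no_isolated_le:
  assumes d: "d \<ge> 2" and n: "n > d" and m: "4 * m \<le> card (faces n d)" and b: "4 * (n - d) \<le> card (faces n d)"
    and u: "u = real (n - d) / (real (card (faces n d)) - real m)" "u \<le> 1/2"
  shows "real (card {ys \<in> prefix (faces n d) m. no_isolated n d (set ys)})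
    \<le> (exp (real m * (u + 2 * u\<^sup>2)) / real (n choose d) + 3 * real d * real n / real (n choose d))
      * real (card (prefix (faces n d) m))"
proof -
  let ?X = "faces n d" and ?T = "faces n (d - 1)"
  define M where "M = card ?X"
  define N where "N = real (n choose d)"
  \<comment> \<open>The number of prefixes that avoid a given set of \<open>k\<close> faces.\<close>
  define f where "f k = (\<Prod>i<m. real (M - k - i))" for k
  let ?star = "\<lambda>\<tau>. {\<sigma> \<in> ?X. \<tau> \<subseteq> \<sigma>}"
  let ?E = "\<lambda>\<tau> ys. set ys \<inter> ?star \<tau> = {}"
  let ?P = "\<lambda>\<tau> \<tau>'. {ys \<in> prefix ?X m. ?E \<tau> ys \<and> ?E \<tau>' ys}"
  have cT: "card ?T = n choose d" using card_faces[of n "d - 1"] d by simp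
  have N: "N > 0" using n by (simp add: N_def)
  have d1: "d \<ge> 1" using d by simp
  have cf: "real (card (prefix (?X - B) m)) = f (card B)" if "B \<subseteq> ?X" for B
    using that finite_subset[OF that finite_faces] by (simp add: card_prefix f_def M_def card_Diff_subset)
  have W: "real (card (prefix ?X m)) = f 0" using cf[of "{}"] by simp
  have anti: "f k \<le> f l" if "l \<le> k" for k l unfolding f_def using that by (intro prod_mono) auto
  have M0: "M > 0" using n b M_def by simp
  have mM: "m < M" using m M0 by (simp add: M_def)
  have f0: "f 0 > 0" unfolding f_def using mM by (intro prod_pos) auto
  have light: "exp (- (real m * (u + 2 * u\<^sup>2))) * f 0 \<le> f (n - d)"
    using prod_avoid_lower[OF mM, of u "n - d"] u by (simp add: f_def M_def)
  have "exp (- (real m * (u + 2 * u\<^sup>2))) * f 0 > 0" using f0 by simp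
  then have fb: "f (n - d) > 0" using light by linarith
  have single: "real (card {ys \<in> prefix ?X m. ?E \<tau> ys}) = f (n - d)" if t: "\<tau> \<in> ?T" for \<tau>
    unfolding prefix_avoid using cf[of "?star \<tau>"] card_star[OF d1 t] by simp
  have pair: "real (card (?P \<tau> \<tau>'))
      \<le> (if \<tau> = \<tau>' then f (n - d) else 0) + (if card (\<tau> \<union> \<tau>') = d + 1 then 3 * (f (n - d))\<^sup>2 / f 0 else 0)
        + (f (n - d))\<^sup>2 / f 0" if t: "\<tau> \<in> ?T" "\<tau>' \<in> ?T" for \<tau> \<tau>'
  proof (cases "\<tau> = \<tau>'")
    case True
    then show ?thesis using single[OF t(1)] f0 by (simp add: add_nonneg_nonneg)
  next
    case False
    let ?B = "?star \<tau> \<union> ?star \<tau>'"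
    have "?P \<tau> \<tau>' = prefix (?X - ?B) m" by (auto simp: prefix_def)
    then have eq: "real (card (?P \<tau> \<tau>')) = f (card ?B)" using cf[of ?B] by simp
    have cB: "2 * (n - d) - (if card (\<tau> \<union> \<tau>') = d + 1 then 1 else 0) \<le> card ?B"
      by (rule card_two_stars[OF d1 t False])
    show ?thesis
    proof (cases "card (\<tau> \<union> \<tau>') = d + 1")
      case True
      then have "f (card ?B) \<le> f (2 * (n - d) - 1)" using cB by (intro anti) simp
      then have "f (card ?B) * f 0 \<le> f (2 * (n - d) - 1) * f 0" using f0 by (intro mult_right_mono) auto
      moreover have "f (2 * (n - d) - 1) * f 0 \<le> 3 * (f (n - d))\<^sup>2"
        using prod_avoid_ratio(2)[of m M "n - d"] m b by (simp add: f_def M_def)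
      ultimately have "f (card ?B) * f 0 \<le> 3 * (f (n - d))\<^sup>2" by linarith
      then have "f (card ?B) \<le> 3 * (f (n - d))\<^sup>2 / f 0" using pos_le_divide_eq[OF f0] by blast
      then show ?thesis using eq True False f0 by (simp add: add_increasing2)
    next
      case nadj: False
      then have "f (card ?B) \<le> f (2 * (n - d))" using cB by (intro anti) simp
      then have "f (card ?B) * f 0 \<le> f (2 * (n - d)) * f 0" using f0 by (intro mult_right_mono) auto
      moreover have "f (2 * (n - d)) * f 0 \<le> (f (n - d))\<^sup>2"
        using prod_avoid_ratio(1)[of m M "n - d"] m b by (simp add: f_def M_def)
      ultimately have "f (card ?B) * f 0 \<le> (f (n - d))\<^sup>2" by linarith
      then have "f (card ?B) \<le> (f (n - d))\<^sup>2 / f 0" using pos_le_divide_eq[OF f0] by blast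
      then show ?thesis using eq nadj False by simp
    qed
  qed
  define \<mu> where "\<mu> = N * f (n - d) / f 0"
  have \<mu>: "\<mu> > 0" using N fb f0 by (simp add: \<mu>_def)
  have "(\<Sum>\<tau>\<in>?T. real (card {ys \<in> prefix ?X m. ?E \<tau> ys})) = (\<Sum>\<tau>\<in>?T. f (n - d))"
    by (rule sum.cong[OF refl single])
  also have "\<dots> = \<mu> * real (card (prefix ?X m))" using cT f0 W by (simp add: \<mu>_def N_def)
  finally have mean: "(\<Sum>\<tau>\<in>?T. real (card {ys \<in> prefix ?X m. ?E \<tau> ys})) = \<mu> * real (card (prefix ?X m))" .
  have "(\<Sum>\<tau>\<in>?T. \<Sum>\<tau>'\<in>?T. real (card (?P \<tau> \<tau>')))
    \<le> (\<Sum>\<tau>\<in>?T. f (n - d) + real (d * n) * (3 * (f (n - d))\<^sup>2 / f 0) + N * ((f (n - d))\<^sup>2 / f 0))"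
  proof (rule sum_mono)
    fix \<tau> assume t: "\<tau> \<in> ?T"
    have "(\<Sum>\<tau>'\<in>?T. real (card (?P \<tau> \<tau>')))
      \<le> (\<Sum>\<tau>'\<in>?T. (if \<tau> = \<tau>' then f (n - d) else 0) + (if card (\<tau>' \<union> \<tau>) = d + 1 then 3 * (f (n - d))\<^sup>2 / f 0 else 0)
        + (f (n - d))\<^sup>2 / f 0)"
      using pair[OF t] by (intro sum_mono) (simp add: Un_commute)
    also have "\<dots> = f (n - d) + real (card {\<tau>' \<in> ?T. card (\<tau>' \<union> \<tau>) = d + 1}) * (3 * (f (n - d))\<^sup>2 / f 0)
        + N * ((f (n - d))\<^sup>2 / f 0)"
      using t cT by (simp add: sum.distrib sum.If_cases Int_def N_def)
    also have "\<dots> \<le> f (n - d) + real (d * n) * (3 * (f (n - d))\<^sup>2 / f 0) + N * ((f (n - d))\<^sup>2 / f 0)"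
      using card_neighbours_le[OF d1 t] f0 by (intro add_mono mult_right_mono of_nat_mono) auto
    finally show "(\<Sum>\<tau>'\<in>?T. real (card (?P \<tau> \<tau>')))
      \<le> f (n - d) + real (d * n) * (3 * (f (n - d))\<^sup>2 / f 0) + N * ((f (n - d))\<^sup>2 / f 0)" .
  qed
  also have "\<dots> = N * f (n - d) + 3 * real (d * n) * N * (f (n - d))\<^sup>2 / f 0 + N\<^sup>2 * (f (n - d))\<^sup>2 / f 0"
    using cT by (simp add: N_def power2_eq_square algebra_simps)
  also have "\<dots> = N * f (n - d) + 3 * real (d * n) * N * (f (n - d))\<^sup>2 / f 0 + \<mu>\<^sup>2 * real (card (prefix ?X m))"
    using f0 W by (simp add: \<mu>_def power_mult_distrib power_divide power2_eq_square)
  finally have var: "real (card {ys \<in> prefix ?X m. \<forall>\<tau>\<in>?T. \<not> ?E \<tau> ys}) * \<mu>\<^sup>2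
      \<le> N * f (n - d) + 3 * real (d * n) * N * (f (n - d))\<^sup>2 / f 0"
    using card_none_le[of "prefix ?X m" ?T \<mu> ?E] \<mu> mean by simp
  have "{ys \<in> prefix ?X m. no_isolated n d (set ys)} \<subseteq> {ys \<in> prefix ?X m. \<forall>\<tau>\<in>?T. \<not> ?E \<tau> ys}"
  proof clarify
    fix ys \<tau> assume ys: "ys \<in> prefix ?X m" "no_isolated n d (set ys)" and t: "\<tau> \<in> ?T" and e: "?E \<tau> ys"
    obtain \<sigma> where "\<sigma> \<in> set ys" "\<tau> \<subseteq> \<sigma>" using ys(2) t unfolding no_isolated_def by blast
    moreover have "set ys \<subseteq> ?X" using ys(1) by (simp add: prefix_def)
    ultimately show False using e by blast
  qed
  then have "card {ys \<in> prefix ?X m. no_isolated n d (set ys)} \<le> card {ys \<in> prefix ?X m. \<forall>\<tau>\<in>?T. \<not> ?E \<tau> ys}"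
    by (intro card_mono) auto
  then have "real (card {ys \<in> prefix ?X m. no_isolated n d (set ys)}) \<le> real (card {ys \<in> prefix ?X m. \<forall>\<tau>\<in>?T. \<not> ?E \<tau> ys})"
    by simp
  also have "\<dots> \<le> (N * f (n - d) + 3 * real (d * n) * N * (f (n - d))\<^sup>2 / f 0) / \<mu>\<^sup>2"
    using var \<mu> by (simp add: pos_le_divide_eq)
  also have "\<dots> = (f 0 / f (n - d) / N + 3 * real d * real n / N) * f 0"
    using f0 fb N by (simp add: \<mu>_def field_simps power2_eq_square)
  also have "\<dots> \<le> (exp (real m * (u + 2 * u\<^sup>2)) / N + 3 * real d * real n / N) * f 0"
  proof -
    have "exp (real m * (u + 2 * u\<^sup>2)) * (exp (- (real m * (u + 2 * u\<^sup>2))) * f 0)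
       \<le> exp (real m * (u + 2 * u\<^sup>2)) * f (n - d)" using light by (intro mult_left_mono) auto
    then have "f 0 \<le> exp (real m * (u + 2 * u\<^sup>2)) * f (n - d)"
      by (simp add: mult.assoc[symmetric] flip: exp_add)
    then have "f 0 / f (n - d) \<le> exp (real m * (u + 2 * u\<^sup>2))" using fb by (simp add: divide_le_eq)
    then show ?thesis using N f0 by (intro mult_right_mono add_mono divide_right_mono) auto
  qed
  finally show ?thesis by (simp add: N_def W)
qed

section \<open>Hitting times\<close>

lemma no_isolated_mono: "F \<subseteq> F' \<Longrightarrow> no_isolated n d F \<Longrightarrow> no_isolated n d F'"
  unfolding no_isolated_def by blast

lemma no_isolated_all:
  assumes d: "d \<ge> 2" and n: "n > d"
  shows "no_isolated n d (faces n d)"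
  unfolding no_isolated_def
proof
  fix \<tau> assume t: "\<tau> \<in> faces n (d - 1)"
  then have "card {\<sigma> \<in> faces n d. \<tau> \<subseteq> \<sigma>} = n - d" using d by (intro card_star) auto
  then have "{\<sigma> \<in> faces n d. \<tau> \<subseteq> \<sigma>} \<noteq> {}" using n by (metis card.empty not_le zero_less_diff order_refl)
  then show "\<exists>\<sigma>\<in>faces n d. \<tau> \<subseteq> \<sigma>" by blast
qed

text \<open>Isolated faces survive time \<open>m\<close>, so the step at which they disappear lies
  beyond it, and homology vanishes there by \<open>hv\<close>. It cannot vanish earlier, because an
  isolated face is an obstruction.\<close>

lemma hitting_times_eq:
  assumes d: "d \<ge> 2" and n: "n > d" and xs: "xs \<in> orderings n d"
    and ni: "\<not> no_isolated n d (set (take m xs))"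
    and hv: "\<And>F'. set (take m xs) \<subseteq> F' \<Longrightarrow> F' \<subseteq> faces n d \<Longrightarrow> no_isolated n d F' \<Longrightarrow> homology_vanishes n d F'"
  shows "hitting_time (no_isolated n d) xs = hitting_time (homology_vanishes n d) xs"
proof -
  have sx: "set xs = faces n d" using xs by (simp add: orderings_def)
  let ?P = "\<lambda>j. j \<le> length xs \<and> no_isolated n d (LM_step xs j)"
  let ?Q = "\<lambda>j. j \<le> length xs \<and> homology_vanishes n d (LM_step xs j)"
  define T where "T = (LEAST j. ?P j)"
  have "?P (length xs)" using no_isolated_all[OF d n] sx by (simp add: LM_step_def)
  then have T: "?P T" unfolding T_def by (rule LeastI)
  have "m \<le> T"
  proof (rule ccontr)
    assume "\<not> m \<le> T"
    then have "set (take T xs) \<subseteq> set (take m xs)" by (intro set_take_subset_set_take) simp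
    then show False using ni T no_isolated_mono unfolding LM_step_def by blast
  qed
  then have "set (take m xs) \<subseteq> LM_step xs T" unfolding LM_step_def by (rule set_take_subset_set_take)
  moreover have "LM_step xs T \<subseteq> faces n d" unfolding LM_step_def using sx set_take_subset[of T xs] by simp
  ultimately have "?Q T" using hv T by blast
  moreover have "T \<le> j" if "?Q j" for j
    unfolding T_def using that homology_vanishes_imp_no_isolated[OF d n] by (intro Least_le) blast
  ultimately have "(LEAST j. ?Q j) = T" by (intro Least_equality)
  then show ?thesis by (simp add: hitting_time_def T_def)
qed

definition bad_prefix :: "real \<Rightarrow> nat \<Rightarrow> nat \<Rightarrow> nat \<Rightarrow> nat set set \<Rightarrow> bool" where
  "bad_prefix \<kappa> r n d F \<longleftrightarrow> no_isolated n d F \<or> (\<exists>k\<in>{1..<r}. \<exists>S\<in>conn_sets n d k. F \<inter> exposed n d S = {})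
     \<or> (\<exists>S. S \<subseteq> faces n (d - 1) \<and> r \<le> card S \<and> large_bad \<kappa> n d S F)"

lemma orderings_eq: "orderings n d = permutations_of_set (faces n d)"
  by (auto simp: orderings_def permutations_of_set_def)

lemma finite_orderings: "finite (orderings n d)"
  by (simp add: orderings_eq)

lemma card_orderings_pos: "card (orderings n d) > 0"
  by (simp add: orderings_eq)

lemma LM_prob_le_1: "LM_prob n d E \<le> 1"
proof -
  have "card {xs \<in> orderings n d. E xs} \<le> card (orderings n d)"
    using finite_orderings by (intro card_mono) auto
  then show ?thesis using card_orderings_pos[of n d] by (simp add: LM_prob_def divide_le_eq)
qed

lemma LM_prob_ge_complement:
  assumes "\<And>xs. xs \<in> orderings n d \<Longrightarrow> \<not> E' xs \<Longrightarrow> E xs"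
  shows "1 - LM_prob n d E' \<le> LM_prob n d E"
proof -
  have "card (orderings n d) \<le> card ({xs \<in> orderings n d. E' xs} \<union> {xs \<in> orderings n d. E xs})"
    using assms finite_orderings by (intro card_mono) auto
  also have "\<dots> \<le> card {xs \<in> orderings n d. E' xs} + card {xs \<in> orderings n d. E xs}" by (rule card_Un_le)
  finally have "real (card (orderings n d)) \<le> real (card {xs \<in> orderings n d. E' xs}) + real (card {xs \<in> orderings n d. E xs})"
    by simp
  then have "1 \<le> (real (card {xs \<in> orderings n d. E' xs}) + real (card {xs \<in> orderings n d. E xs})) / real (card (orderings n d))"
    using card_orderings_pos[of n d] by (simp add: le_divide_eq)
  then show ?thesis by (simp add: LM_prob_def add_divide_distrib)
qed

lemma LM_prob_hitting_ge:
  assumes d: "d \<ge> 2" and n: "n \<ge> 2 * d" and \<kappa>: "0 < \<kappa>" "\<kappa> \<le> 1 / (4 * (real d + 1)\<^sup>2)"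
  shows "1 - LM_prob n d (\<lambda>xs. bad_prefix \<kappa> r n d (set (take m xs)))
    \<le> LM_prob n d (\<lambda>xs. hitting_time (no_isolated n d) xs = hitting_time (homology_vanishes n d) xs)"
proof (rule LM_prob_ge_complement)
  fix xs assume xs: "xs \<in> orderings n d" and good: "\<not> bad_prefix \<kappa> r n d (set (take m xs))"
  show "hitting_time (no_isolated n d) xs = hitting_time (homology_vanishes n d) xs"
  proof (rule hitting_times_eq[OF d _ xs])
    show "d < n" using d n by simp
    show "\<not> no_isolated n d (set (take m xs))" using good by (simp add: bad_prefix_def)
    fix F' assume F': "set (take m xs) \<subseteq> F'" "F' \<subseteq> faces n d" "no_isolated n d F'"
    show "homology_vanishes n d F'"
      using nonvanishing_imp_bad[OF d n \<kappa> F', of r] good unfolding bad_prefix_def by blast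
  qed
qed

lemma LM_prob_bad_prefix_le:
  assumes d: "d \<ge> 2" and n: "n \<ge> 2 * d" and \<kappa>: "\<kappa> \<ge> 0" and \<theta>: "0 \<le> \<theta>" "\<theta> \<le> 1"
    and A: "A \<le> (real n - real d - real d * (\<kappa> * real n)) * (real m / real (card (faces n d)))"
    and B: "B \<le> drop_const \<kappa> d * real n * (real m / (3 * real (card (faces n d)))) - ln (8 * (real d + 1))"
    and z: "2 * exp (- (\<theta> * B)) \<le> 1" and r: "real r \<le> \<kappa> * real n"
    and m: "4 * m \<le> card (faces n d)" and b: "4 * (n - d) \<le> card (faces n d)"
    and u: "u = real (n - d) / (real (card (faces n d)) - real m)" "u \<le> 1/2"
  shows "LM_prob n d (\<lambda>xs. bad_prefix \<kappa> r n d (set (take m xs)))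
    \<le> (exp (real m * (u + 2 * u\<^sup>2)) / real (n choose d) + 3 * real d * real n / real (n choose d))
      + (\<Sum>k\<in>{1..<r}. real (n choose d) * (real r * real d * real n) ^ k * exp (- A) ^ Suc k)
      + (exp (exp 1 * exp (- ((1 - \<theta>) * A)) * real (n choose d) - real r)
        + (exp (real (card (small_sets n d)) * (2 * exp (- (\<theta> * B))) ^ (n - d)) - 1)
          * exp (exp (- ((1 - \<theta>) * A)) * real (n choose d)))"
    (is "_ \<le> ?e1 + ?e2 + ?e3")
proof -
  let ?W = "prefix (faces n d) m"
  have nd: "n > d" using n d by simp
  let ?E1 = "{ys \<in> ?W. no_isolated n d (set ys)}"
  let ?E2 = "{ys \<in> ?W. \<exists>k\<in>{1..<r}. \<exists>S\<in>conn_sets n d k. set ys \<inter> exposed n d S = {}}"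
  let ?E3 = "{ys \<in> ?W. \<exists>S. S \<subseteq> faces n (d - 1) \<and> r \<le> card S \<and> large_bad \<kappa> n d S (set ys)}"
  have "{ys \<in> ?W. bad_prefix \<kappa> r n d (set ys)} = ?E1 \<union> ?E2 \<union> ?E3"
    unfolding bad_prefix_def by blast
  then have "card {ys \<in> ?W. bad_prefix \<kappa> r n d (set ys)} \<le> card ?E1 + card ?E2 + card ?E3"
    by (metis (no_types, lifting) card_Un_le order_trans add_le_mono1)
  then have "real (card {ys \<in> ?W. bad_prefix \<kappa> r n d (set ys)}) \<le> real (card ?E1) + real (card ?E2) + real (card ?E3)"
    by linarith
  also have "\<dots> \<le> ?e1 * real (card ?W) + ?e2 * real (card ?W) + ?e3 * real (card ?W)"
    by (intro add_mono card_no_isolated_le[OF d nd m b u] card_exists_small_bad_le[OF d r A]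
        card_exists_large_bad_le[OF d nd \<kappa> \<theta> A B z])
  also have "\<dots> = (?e1 + ?e2 + ?e3) * real (card ?W)" by (simp only: distrib_right)
  finally have le: "real (card {ys \<in> ?W. bad_prefix \<kappa> r n d (set ys)}) \<le> (?e1 + ?e2 + ?e3) * real (card ?W)" .
  have mX: "m \<le> card (faces n d)" using m by simp
  have "card ?W > 0" using mX by (simp add: card_prefix prod_pos)
  then show ?thesis
    unfolding LM_prob_prefix[OF mX, of "bad_prefix \<kappa> r n d"] using le by (simp add: divide_le_eq)
qed

section \<open>Asymptotics\<close>

lemma exp_minus_one_le: "0 \<le> t \<Longrightarrow> t \<le> 1 \<Longrightarrow> exp t - 1 \<le> 2 * t" for t :: real
  using exp_bound[of t] by (simp add: power2_eq_square) (smt (verit) mult_left_le)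

lemma two_le_exp_1: "2 \<le> exp (1::real)"
  using exp_ge_add_one_self[of 1] by simp

lemma card_small_sets_le: "card (small_sets n d) \<le> 2 ^ n"
proof -
  have "card (small_sets n d) \<le> card (Pow {0..<n})" by (intro card_mono) auto
  then show ?thesis by (simp add: card_Pow)
qed

text \<open>The bound 3 makes 2 exp (- \<beta>) at most exp (- 2); over n - d coordinates this beats
  the at most 2^n \<le> exp n choices of a heavy set.\<close>

lemma heavy_error_le:
  fixes \<beta> :: real
  assumes n: "n \<ge> 2 * d" and b: "3 \<le> \<beta>"
  shows "exp (real (card (small_sets n d)) * (2 * exp (- \<beta>)) ^ (n - d)) - 1 \<le> 2 * exp (2 * real d - real n)"
proof -
  let ?t = "real (card (small_sets n d)) * (2 * exp (- \<beta>)) ^ (n - d)"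
  have "2 * exp (- \<beta>) \<le> exp 1 * exp (- 3)" using two_le_exp_1 b by (intro mult_mono) auto
  also have "\<dots> = exp (- 2)" by (simp flip: exp_add)
  finally have "(2 * exp (- \<beta>)) ^ (n - d) \<le> exp (- 2) ^ (n - d)" by (intro power_mono) auto
  moreover have "real (card (small_sets n d)) \<le> exp 1 ^ n"
  proof -
    have "real (card (small_sets n d)) \<le> 2 ^ n" using card_small_sets_le[of n d]
      by (metis of_nat_le_iff of_nat_numeral of_nat_power)
    also have "\<dots> \<le> exp 1 ^ n" using two_le_exp_1 by (intro power_mono) auto
    finally show ?thesis .
  qed
  ultimately have "?t \<le> exp 1 ^ n * exp (- 2) ^ (n - d)"
    by (intro mult_mono) auto
  also have "\<dots> = exp (real n * 1 + real (n - d) * (- 2))" by (simp only: exp_of_nat_mult exp_add)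
  also have "real n * 1 + real (n - d) * (- 2) = 2 * real d - real n" using n by (simp add: of_nat_diff)
  finally have t: "?t \<le> exp (2 * real d - real n)" .
  have "exp (2 * real d - real n) \<le> 1" using n by simp
  then have "exp (?t) - 1
      \<le> 2 * (?t)"
    by (intro exp_minus_one_le mult_nonneg_nonneg order_trans[OF t]) simp_all
  also have "\<dots> \<le> 2 * exp (2 * real d - real n)" using t by simp
  finally show ?thesis .
qed

lemma sum_geometric_le:
  fixes q :: real
  assumes "0 \<le> q" "q \<le> 1/2"
  shows "(\<Sum>k\<in>{1..<r}. q ^ k) \<le> 2 * q"
proof -
  have "(\<Sum>k\<in>{1..<r}. q ^ k) \<le> (\<Sum>k\<in>{1..r}. q * (1/2) ^ (k - 1))"
  proof (rule order_trans[OF sum_mono])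
    fix k assume "k \<in> {1..<r}"
    then have "q ^ k = q * q ^ (k - 1)" by (cases k) auto
    also have "\<dots> \<le> q * (1/2) ^ (k - 1)" using assms by (intro mult_left_mono power_mono) auto
    finally show "q ^ k \<le> q * (1/2) ^ (k - 1)" .
  next
    show "(\<Sum>k\<in>{1..<r}. q * (1/2) ^ (k - 1)) \<le> (\<Sum>k\<in>{1..r}. q * (1/2) ^ (k - 1))"
      using assms by (intro sum_mono2) auto
  qed
  also have "\<dots> = (\<Sum>k<r. q * (1/2) ^ k)"
    by (rule sum.reindex_bij_witness[of _ Suc "\<lambda>k. k - 1"]) auto
  also have "\<dots> = q * (\<Sum>k<r. (1/2) ^ k)" by (simp add: sum_distrib_left)
  also have "(\<Sum>k<r. (1/2::real) ^ k) = 2 * (1 - (1/2) ^ r)"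
    using sum_gp_strict[of "1/2::real" r] by simp
  also have "q * (2 * (1 - (1/2) ^ r)) \<le> q * 2" using assms by (intro mult_left_mono) auto
  finally show ?thesis by simp
qed

lemma binomial_le_powr: "n \<ge> 1 \<Longrightarrow> real (n choose d) \<le> real n powr real d"
proof -
  assume n: "n \<ge> 1"
  have "n choose d \<le> n ^ d" using binomial_le_pow[of d n] by (cases "d \<le> n") (auto simp: binomial_eq_0)
  then have "real (n choose d) \<le> real (n ^ d)" by (rule of_nat_mono)
  then show ?thesis using n by (simp add: powr_realpow)
qed

text \<open>The first face of a connected set contributes about n^d n^-(d - 1/8) = n^(1/8), every
  further one at most a constant times n^(-3/8). Starting at two faces gives n^(-1/4); for one face
  the bound would diverge.\<close>

lemma small_error_le:
  fixes n d r :: nat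
  assumes d: "d \<ge> 2" and n: "n \<ge> 1" and r: "real r \<le> sqrt (real n)"
    and q: "exp 1 * real d * real n powr (- 3/8) \<le> 1/2"
  shows "(\<Sum>k\<in>{1..<r}. real (n choose d) * (real r * real d * real n) ^ k
      * exp (- ((real d - 1/8) * ln (real n) - 1)) ^ Suc k)
    \<le> 2 * exp 1 * (exp 1 * real d) * real n powr (- 1/4)"
proof -
  let ?n = "real n" and ?q = "exp 1 * real d * real n powr (- 3/8)"
  have n0: "?n > 0" "?n \<ge> 1" using n by auto
  have eA: "exp (- ((real d - 1/8) * ln ?n - 1)) = exp 1 * ?n powr (- (real d - 1/8))"
    using n0 by (simp add: powr_def algebra_simps flip: exp_add)
  have N: "real (n choose d) \<le> ?n powr real d" using n by (rule binomial_le_powr)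
  have R: "real r \<le> ?n powr (1/2)" using r by (simp add: powr_half_sqrt)
  have base: "real r * real d * ?n * (exp 1 * ?n powr (- (real d - 1/8))) \<le> ?q"
  proof -
    have "real r * real d * ?n * (exp 1 * ?n powr (- (real d - 1/8)))
       \<le> ?n powr (1/2) * real d * ?n * (exp 1 * ?n powr (- (real d - 1/8)))"
      using R n0 by (intro mult_right_mono) auto
    also have "\<dots> = exp 1 * real d * (?n powr (1/2) * ?n powr 1 * ?n powr (- (real d - 1/8)))"
      using n0 by simp
    also have "?n powr (1/2) * ?n powr 1 * ?n powr (- (real d - 1/8)) = ?n powr (1/2 + 1 + (- (real d - 1/8)))"
      by (simp only: powr_add)
    also have "\<dots> \<le> ?n powr (- 3/8)" using d n0 by (intro powr_mono) auto
    finally show ?thesis by (simp add: mult_left_mono)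
  qed
  have "(\<Sum>k\<in>{1..<r}. real (n choose d) * (real r * real d * ?n) ^ k * exp (- ((real d - 1/8) * ln ?n - 1)) ^ Suc k)
    \<le> (\<Sum>k\<in>{1..<r}. (exp 1 * ?n powr (1/8)) * ?q ^ k)"
  proof (rule sum_mono)
    fix k
    have "real (n choose d) * (real r * real d * ?n) ^ k * exp (- ((real d - 1/8) * ln ?n - 1)) ^ Suc k
      = (real (n choose d) * (exp 1 * ?n powr (- (real d - 1/8)))) * (real r * real d * ?n * (exp 1 * ?n powr (- (real d - 1/8)))) ^ k"
      unfolding eA by (simp add: power_mult_distrib)
    also have "\<dots> \<le> (exp 1 * ?n powr (1/8)) * ?q ^ k"
    proof (rule mult_mono)
      have "real (n choose d) * (exp 1 * ?n powr (- (real d - 1/8))) \<le> ?n powr real d * (exp 1 * ?n powr (- (real d - 1/8)))"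
        using N by (intro mult_right_mono) auto
      also have "\<dots> = exp 1 * (?n powr real d * ?n powr (- (real d - 1/8)))" by simp
      also have "?n powr real d * ?n powr (- (real d - 1/8)) = ?n powr (1/8)" by (simp flip: powr_add)
      finally show "real (n choose d) * (exp 1 * ?n powr (- (real d - 1/8))) \<le> exp 1 * ?n powr (1/8)" .
      show "(real r * real d * ?n * (exp 1 * ?n powr (- (real d - 1/8)))) ^ k \<le> ?q ^ k"
        using base by (intro power_mono) auto
    qed auto
    finally show "real (n choose d) * (real r * real d * ?n) ^ k * exp (- ((real d - 1/8) * ln ?n - 1)) ^ Suc k
      \<le> (exp 1 * ?n powr (1/8)) * ?q ^ k" .
  qed
  also have "\<dots> = (exp 1 * ?n powr (1/8)) * (\<Sum>k\<in>{1..<r}. ?q ^ k)" by (simp add: sum_distrib_left)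
  also have "\<dots> \<le> (exp 1 * ?n powr (1/8)) * (2 * ?q)"
    using q by (intro mult_left_mono sum_geometric_le) auto
  also have "\<dots> = 2 * exp 1 * (exp 1 * real d) * (?n powr (1/8) * ?n powr (- 3/8))" by simp
  also have "?n powr (1/8) * ?n powr (- 3/8) = ?n powr (- 1/4)" by (simp flip: powr_add)
  finally show ?thesis .
qed

text \<open>The share 1 / (8 d) of the exponent costs at most ln n / 8, which lowers d - 1/8 to d -
  1/4 and leaves n^(1/4), still far below sqrt n.\<close>

lemma light_error_le:
  fixes n d :: nat
  assumes d: "d \<ge> 2" and n: "n \<ge> 1" 
  shows "exp (- ((1 - 1 / (8 * real d)) * ((real d - 1/8) * ln (real n) - 1))) * real (n choose d)
    \<le> exp 1 * real n powr (1/4)"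
proof -
  let ?n = "real n"
  have n0: "?n > 0" "ln ?n \<ge> 0" using n by auto
  have "real (n choose d) \<le> ?n powr real d" using n by (rule binomial_le_powr)
  moreover have "(1 - 1 / (8 * real d)) * ((real d - 1/8) * ln ?n - 1) \<ge> (real d - 1/4) * ln ?n - 1"
  proof -
    have "1 / (8 * real d) * ((real d - 1/8) * ln ?n - 1) \<le> 1 / (8 * real d) * (real d * ln ?n)"
      using n0 by (intro mult_left_mono) (auto simp: algebra_simps)
    also have "\<dots> = ln ?n / 8" using d by simp
    finally show ?thesis by (simp add: algebra_simps)
  qed
  then have "exp (- ((1 - 1 / (8 * real d)) * ((real d - 1/8) * ln ?n - 1))) \<le> exp (1 + (- (real d - 1/4)) * ln ?n)"
    by (simp add: algebra_simps)
  ultimately have "exp (- ((1 - 1 / (8 * real d)) * ((real d - 1/8) * ln ?n - 1))) * real (n choose d)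
     \<le> exp (1 + (- (real d - 1/4)) * ln ?n) * ?n powr real d"
    by (intro mult_mono) auto
  also have "\<dots> = exp 1 * (?n powr (- (real d - 1/4)) * ?n powr real d)"
    using n0 by (simp add: exp_add powr_def)
  also have "?n powr (- (real d - 1/4)) * ?n powr real d = ?n powr (1/4)" by (simp flip: powr_add)
  finally show ?thesis .
qed

text \<open>To first order \<open>m * u\<close> is (d - 1/10) ln n. The corrections for sampling
  without replacement use up at most half of the margin 1/10.\<close>

lemma isolated_error_le:
  fixes n d m :: nat and M u :: real
  assumes d: "d \<ge> 2" and n: "n \<ge> d" and M: "M > 0"
    and m: "real m \<le> (real d - 1/10) * ln (real n) * M / real n"
    and q: "real d * ln (real n) / real n \<le> 1 / (100 * real d)" and nM: "real n / M \<le> 1 / (200 * real d)"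
    and u: "u = real (n - d) / (M - real m)"
  shows "u \<le> 1/2"
    and "exp (real m * (u + 2 * u\<^sup>2)) / real (n choose d) + 3 * real d * real n / real (n choose d)
      \<le> real d ^ d * real n powr (- 1/20) + 3 * real d ^ 3 / real n"
proof -
  let ?n = "real n"
  let ?a = "real d - 1/10"
  have n0: "?n > 0" "ln ?n \<ge> 0" using n d by auto
  define q where "q = ?a * ln ?n / ?n"
  have q0: "q \<ge> 0" using n0 d by (simp add: q_def)
  have "q \<le> real d * ln ?n / ?n" unfolding q_def using n0 by (intro divide_right_mono mult_right_mono) auto
  then have q1: "q \<le> 1 / (100 * real d)" using q by linarith
  have d100: "1 / (100 * real d) \<le> 1 / 200" using d by (intro divide_left_mono) auto
  have mq: "real m \<le> q * M" using m by (simp add: q_def)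
  have Mm: "M - real m \<ge> M * (1 - q)" using mq by (simp add: algebra_simps)
  have Mq: "M * (1 - q) > 0" using M q1 d100 by simp
  have u0: "u \<ge> 0" unfolding u using Mm Mq by simp
  have u1: "u \<le> ?n / (M * (1 - q))"
    unfolding u using Mm Mq n by (intro frac_le) auto
  also have "\<dots> = (?n / M) / (1 - q)" by simp
  also have "\<dots> \<le> (1 / (200 * real d)) / (1 / 2)"
  proof (rule frac_le[OF _ nM])
    show "1 / 2 \<le> 1 - q" using q1 d100 by linarith
  qed simp_all
  finally have u2: "u \<le> 1 / (100 * real d)" by simp
  then show "u \<le> 1/2" using d100 by linarith
  have mu: "real m * u * (1 - q) \<le> ?a * ln ?n"
  proof -
    have "real m * u \<le> (q * M) * (?n / (M * (1 - q)))"
      using mq u1 u0 q0 M by (intro mult_mono) auto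
    also have "\<dots> = ?a * ln ?n / (1 - q)" using M n0 by (simp add: q_def)
    finally show ?thesis using q1 d100 by (simp add: pos_le_divide_eq)
  qed
  have "real m * (u + 2 * u\<^sup>2) \<le> (real d - 1/20) * ln ?n"
  proof -
    have pos: "1 - q > 0" using q1 d100 by simp
    have "real m * (u + 2 * u\<^sup>2) * (1 - q) = (real m * u * (1 - q)) * (1 + 2 * u)"
      by (simp add: power2_eq_square algebra_simps)
    also have "\<dots> \<le> (?a * ln ?n) * (1 + 2 * u)" using mu u0 by (intro mult_right_mono) auto
    also have "\<dots> = (?a * (1 + 2 * u)) * ln ?n" by simp
    also have "\<dots> \<le> ((real d - 1/20) * (1 - q)) * ln ?n"
    proof (intro mult_right_mono n0)
      \<comment> \<open>The two corrections are at most 1/50 and 1/100, together below the gap 1/20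
        between the exponents.\<close>
      have "?a * (2 * u) \<le> real d * (2 * (1 / (100 * real d)))"
        using u2 u0 d by (intro mult_mono) auto
      then have 1: "?a * (1 + 2 * u) \<le> ?a + 1/50" using d by (simp add: distrib_left)
      have "(real d - 1/20) * q \<le> real d * (1 / (100 * real d))"
        using q1 q0 d by (intro mult_mono) auto
      then have 2: "(real d - 1/20) * q \<le> 1/100" using d by simp
      then show "?a * (1 + 2 * u) \<le> (real d - 1/20) * (1 - q)" using 1 by (simp add: right_diff_distrib)
    qed
    finally have "real m * (u + 2 * u\<^sup>2) * (1 - q) \<le> ((real d - 1/20) * ln ?n) * (1 - q)" by (simp add: mult_ac)
    then show ?thesis using pos by (rule mult_right_le_imp_le)
  qed
  then have e: "exp (real m * (u + 2 * u\<^sup>2)) \<le> ?n powr (real d - 1/20)"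
    using n0 by (simp add: powr_def)
  have N: "(?n / real d) ^ d \<le> real (n choose d)"
    using binomial_ge_n_over_k_pow_k[of d n] n by simp
  have N0: "(?n / real d) ^ d > 0" using n0 d by simp
  have "exp (real m * (u + 2 * u\<^sup>2)) / real (n choose d) \<le> ?n powr (real d - 1/20) / (?n / real d) ^ d"
    using e N N0 by (intro frac_le) auto
  also have "\<dots> = real d ^ d * (?n powr (real d - 1/20) / ?n powr real d)"
    using n0 d by (simp add: power_divide powr_realpow)
  also have "?n powr (real d - 1/20) / ?n powr real d = ?n powr (- 1/20)"
    by (simp flip: powr_diff)
  finally have 1: "exp (real m * (u + 2 * u\<^sup>2)) / real (n choose d) \<le> real d ^ d * ?n powr (- 1/20)" .
  have "3 * real d * ?n / real (n choose d) \<le> 3 * real d * ?n / (?n / real d)\<^sup>2"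
  proof (rule divide_left_mono)
    have "(?n / real d)\<^sup>2 \<le> (?n / real d) ^ d" using n d by (intro power_increasing) auto
    then show "(?n / real d)\<^sup>2 \<le> real (n choose d)" using N by linarith
    then show "0 < real (n choose d) * (?n / real d)\<^sup>2" using n0 d
      by (metis N N0 mult_pos_pos divide_pos_pos of_nat_0_less_iff order_less_le_trans zero_less_power less_le_trans pos2)
  qed (use n0 in auto)
  also have "\<dots> = 3 * real d ^ 3 / ?n" using n0 d by (simp add: power2_eq_square power3_eq_cube field_simps)
  finally show "exp (real m * (u + 2 * u\<^sup>2)) / real (n choose d) + 3 * real d * ?n / real (n choose d)
      \<le> real d ^ d * ?n powr (- 1/20) + 3 * real d ^ 3 / ?n"
    using 1 by linarith
qed

text \<open>Small enough for the mixed faces, which need 1 / (4 (d + 1)^2), and for the loss of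
  exposed faces, which lowers the exponent by at most 1/50.\<close>

definition heavy_const :: "nat \<Rightarrow> real" where
  "heavy_const d = 1 / (100 * (real d + 1)\<^sup>2)"

text \<open>In this order: no isolated face left, small connected supports, large supports that are
  entirely light, supports with heavy sets.\<close>

definition error_bound :: "nat \<Rightarrow> real \<Rightarrow> real" where
  "error_bound d x = (real d ^ d * x powr (- 1/20) + 3 * real d ^ 3 / x)
     + 2 * exp 1 * (exp 1 * real d) * x powr (- 1/4)
     + (exp (exp 1 * (exp 1 * x powr (1/4)) - (sqrt x - 1))
        + 2 * exp (2 * real d - x) * exp (exp 1 * x powr (1/4)))"

text \<open>The time is \<open>m \<approx> (d - 1/10) (ln n / n) M\<close>, where \<open>M\<close> is the number of all \<open>d\<close>-faces: early enough for isolated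
  faces to exist, and late enough for the union bounds.\<close>

lemma LM_prob_hitting_lower:
  fixes n d :: nat
  assumes d: "d \<ge> 2" and n: "n \<ge> 2 * d"
    and c1: "1 \<le> heavy_const d * real n" and c2: "sqrt (real n) \<le> heavy_const d * real n"
    and c3: "real d * ln (real n) / real n \<le> 1 / (100 * real d)"
    and c4: "real n / real (card (faces n d)) \<le> 1 / (200 * real d)"
    and c5: "3 \<le> 1 / (8 * real d) * (drop_const (heavy_const d) d / 3 * ((real d - 1/10) * ln (real n) - 1) - ln (8 * (real d + 1)))"
    and c6: "exp 1 * real d * real n powr (- 3/8) \<le> 1/2"
  shows "1 - error_bound d (real n)
    \<le> LM_prob n d (\<lambda>xs. hitting_time (no_isolated n d) xs = hitting_time (homology_vanishes n d) xs)"
proof -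
  let ?n = "real n" and ?L = "ln (real n)" and ?\<kappa> = "heavy_const d" and ?a = "real d - 1/10"
  define M where "M = real (card (faces n d))"
  define m where "m = nat \<lfloor>?a * ?L * M / ?n\<rfloor>"
  \<comment> \<open>Large compared with n^(1/4), small compared with \<kappa> n, and small enough
    for the count of connected sets.\<close>
  define r where "r = nat \<lfloor>sqrt ?n\<rfloor>"
  \<comment> \<open>Replacing 1/10 by 1/8 frees ln n / 40, which covers the loss of at most ln n /
    50 of exposed faces due to codegrees up to \<kappa> n.\<close>
  define A where "A = (real d - 1/8) * ?L - 1"
  define B where "B = drop_const ?\<kappa> d / 3 * (?a * ?L - 1) - ln (8 * (real d + 1))"
  \<comment> \<open>Of order 1/d, so that the cost in the exponent stays below 1/8, whereas
    \<open>\<theta> * B\<close> still grows like ln n.\<close>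
  define \<theta> where "\<theta> = 1 / (8 * real d)"
  define u where "u = real (n - d) / (M - real m)"
  have n0: "?n > 0" "?L \<ge> 0" "n \<ge> 1" "n > d" using n d by auto
  have M: "M > 0" using faces_nonempty[of d n] n0 by (simp add: M_def card_gt_0_iff)
  have \<kappa>: "0 < ?\<kappa>" "?\<kappa> \<le> 1 / (4 * (real d + 1)\<^sup>2)"
  proof -
    have "(real d + 1)\<^sup>2 > 0" by simp
    then show "0 < ?\<kappa>" "?\<kappa> \<le> 1 / (4 * (real d + 1)\<^sup>2)" unfolding heavy_const_def
      by (simp, intro divide_left_mono) auto
  qed
  have d200: "1 / (200 * real d) \<le> 1 / 400" "1 / (100 * real d) \<le> 1/200" using d by (auto intro!: divide_left_mono)
  have "?n / M \<le> 1 / 400" using c4 d200 unfolding M_def by linarith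
  then have nM: "?n \<le> M / 400" using M by (simp add: pos_divide_le_eq)
  have aL: "0 \<le> ?a * ?L * M / ?n" using n0 d M by simp
  have m_le: "real m \<le> ?a * ?L * M / ?n" and m_ge: "?a * ?L * M / ?n - 1 \<le> real m"
    using aL unfolding m_def by linarith+
  \<comment> \<open>Rounding \<open>m\<close> down loses n / M, which is at most 1.\<close>
  have p_ge: "?a * ?L - 1 \<le> ?n * (real m / M)"
  proof -
    have "?n * ((?a * ?L * M / ?n - 1) / M) \<le> ?n * (real m / M)"
      using m_ge M n0 by (intro mult_left_mono divide_right_mono) auto
    moreover have "?n * ((?a * ?L * M / ?n - 1) / M) = ?a * ?L - ?n / M"
      using M n0 by (simp add: field_simps)
    moreover have "?n / M \<le> 1" using nM M by (simp add: divide_le_eq)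
    ultimately show ?thesis by linarith
  qed
  have q: "?a * ?L / ?n \<le> 1/200"
  proof -
    have "?a * ?L / ?n \<le> real d * ?L / ?n" using n0 by (intro divide_right_mono mult_right_mono) auto
    then show ?thesis using c3 d200 by linarith
  qed
  have m4: "real m \<le> M / 200"
  proof -
    have "?a * ?L * M / ?n = (?a * ?L / ?n) * M" by simp
    also have "\<dots> \<le> 1/200 * M" using q M by (intro mult_right_mono) auto
    finally show ?thesis using m_le by linarith
  qed
  have A: "A \<le> (?n - real d - real d * (?\<kappa> * ?n)) * (real m / real (card (faces n d)))"
  proof -
    have dk: "2 * real d * ?\<kappa> * ?a \<le> 1 / 50"
    proof -
      have "2 * real d * ?\<kappa> * ?a \<le> 2 * (real d + 1) * ?\<kappa> * (real d + 1)"
        using \<kappa> d by (intro mult_mono) auto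
      also have "\<dots> = 2 * ((real d + 1)\<^sup>2 * ?\<kappa>)" by (simp add: power2_eq_square)
      also have "(real d + 1)\<^sup>2 * ?\<kappa> = 1 / 100" by (simp add: heavy_const_def)
      finally show ?thesis by simp
    qed
    have "real d \<le> real d * (?\<kappa> * ?n)" using mult_left_mono[OF c1, of "real d"] by simp
    then have b1: "(1 - 2 * real d * ?\<kappa>) * ?n \<le> ?n - real d - real d * (?\<kappa> * ?n)" by (simp add: algebra_simps)
    have k1: "0 \<le> 1 - 2 * real d * ?\<kappa>"
    proof -
      have "2 * real d * ?\<kappa> * 1 \<le> 2 * real d * ?\<kappa> * ?a" using d \<kappa> by (intro mult_left_mono) auto
      then show ?thesis using dk by linarith
    qed
    have "A \<le> (1 - 2 * real d * ?\<kappa>) * (?a * ?L - 1)"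
    proof -
      have "(2 * real d * ?\<kappa> * ?a) * ?L \<le> 1/50 * ?L" using dk n0 by (intro mult_right_mono) auto
      moreover have "0 \<le> 2 * real d * ?\<kappa>" using \<kappa> by simp
      moreover have "(1 - 2 * real d * ?\<kappa>) * (?a * ?L - 1)
          = A + 1/40 * ?L - (2 * real d * ?\<kappa> * ?a) * ?L + 2 * real d * ?\<kappa>"
        by (simp add: A_def algebra_simps)
      ultimately show ?thesis using n0 by linarith
    qed
    also have "\<dots> \<le> (1 - 2 * real d * ?\<kappa>) * (?n * (real m / M))"
      using p_ge k1 by (intro mult_left_mono) auto
    also have "\<dots> = ((1 - 2 * real d * ?\<kappa>) * ?n) * (real m / M)" by simp
    also have "\<dots> \<le> (?n - real d - real d * (?\<kappa> * ?n)) * (real m / M)"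
      using b1 M by (intro mult_right_mono) auto
    finally show ?thesis by (simp add: M_def)
  qed
  have B: "B \<le> drop_const ?\<kappa> d * ?n * (real m / (3 * real (card (faces n d)))) - ln (8 * (real d + 1))"
  proof -
    have "drop_const ?\<kappa> d / 3 * (?a * ?L - 1) \<le> drop_const ?\<kappa> d / 3 * (?n * (real m / M))"
      using p_ge drop_const_nonneg[of ?\<kappa> d] \<kappa> by (intro mult_left_mono) auto
    then show ?thesis by (simp add: B_def M_def)
  qed
  have \<theta>: "0 \<le> \<theta>" "\<theta> \<le> 1" using d by (auto simp: \<theta>_def)
  have \<theta>B: "3 \<le> \<theta> * B" using c5 by (simp add: \<theta>_def B_def)
  have z: "2 * exp (- (\<theta> * B)) \<le> 1"
  proof -
    have "2 * exp (- (\<theta> * B)) \<le> exp 1 * exp (- 3)" using two_le_exp_1 \<theta>B by (intro mult_mono) auto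
    also have "\<dots> = exp (- 2)" by (simp flip: exp_add)
    also have "\<dots> \<le> 1" by simp
    finally show ?thesis .
  qed
  have r_le: "real r \<le> sqrt ?n" and r_ge: "sqrt ?n - 1 \<le> real r"
    using real_sqrt_ge_zero[of ?n] unfolding r_def by linarith+
  have r: "real r \<le> ?\<kappa> * ?n" using r_le c2 by linarith
  have m': "4 * m \<le> card (faces n d)"
  proof -
    have "4 * real m \<le> M" using m4 M by linarith
    then show ?thesis unfolding M_def by linarith
  qed
  have b: "4 * (n - d) \<le> card (faces n d)"
  proof -
    have "4 * real (n - d) \<le> M" using nM n0 M by (simp add: of_nat_diff)
    then show ?thesis unfolding M_def by linarith
  qed
  have u12: "u \<le> 1/2" and e1: "exp (real m * (u + 2 * u\<^sup>2)) / real (n choose d) + 3 * real d * ?n / real (n choose d)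
      \<le> real d ^ d * ?n powr (- 1/20) + 3 * real d ^ 3 / ?n"
    using isolated_error_le[OF d _ M m_le c3 _ u_def] n c4 by (auto simp: M_def)
  have e2: "(\<Sum>k\<in>{1..<r}. real (n choose d) * (real r * real d * ?n) ^ k * exp (- A) ^ Suc k)
    \<le> 2 * exp 1 * (exp 1 * real d) * ?n powr (- 1/4)"
    unfolding A_def by (rule small_error_le[OF d n0(3) r_le c6])
  have xN: "exp (- ((1 - \<theta>) * A)) * real (n choose d) \<le> exp 1 * ?n powr (1/4)"
    unfolding A_def \<theta>_def by (rule light_error_le[OF d n0(3)])
  have e3a: "exp (exp 1 * exp (- ((1 - \<theta>) * A)) * real (n choose d) - real r)
     \<le> exp (exp 1 * (exp 1 * ?n powr (1/4)) - (sqrt ?n - 1))"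
  proof -
    have "exp 1 * (exp (- ((1 - \<theta>) * A)) * real (n choose d)) \<le> exp 1 * (exp 1 * ?n powr (1/4))"
      using xN by (intro mult_left_mono) auto
    then have "exp 1 * exp (- ((1 - \<theta>) * A)) * real (n choose d) - real r
        \<le> exp 1 * (exp 1 * ?n powr (1/4)) - (sqrt ?n - 1)"
      using r_ge unfolding mult.assoc by linarith
    then show ?thesis by (simp only: exp_le_cancel_iff)
  qed
  have e3b: "(exp (real (card (small_sets n d)) * (2 * exp (- (\<theta> * B))) ^ (n - d)) - 1)
        * exp (exp (- ((1 - \<theta>) * A)) * real (n choose d))
     \<le> 2 * exp (2 * real d - ?n) * exp (exp 1 * ?n powr (1/4))"
    using heavy_error_le[OF n \<theta>B] xN by (intro mult_mono) auto
  have "LM_prob n d (\<lambda>xs. bad_prefix ?\<kappa> r n d (set (take m xs))) \<le> error_bound d ?n"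
    using LM_prob_bad_prefix_le[OF d n _ \<theta> A B z r m' b u_def[unfolded M_def] u12] \<kappa> e1 e2 e3a e3b
    unfolding error_bound_def by linarith
  moreover note LM_prob_hitting_ge[OF d n \<kappa>, of r m]
  ultimately show ?thesis by linarith
qed

theorem theorem1:
  fixes d :: nat
  assumes "d \<ge> 2"
  shows "(\<lambda>n. LM_prob n d (\<lambda>xs. hitting_time (no_isolated n d) xs
                                 = hitting_time (homology_vanishes n d) xs))
         \<longlonglongrightarrow> 1"
proof (rule tendsto_sandwich)
  let ?p = "\<lambda>n. LM_prob n d (\<lambda>xs. hitting_time (no_isolated n d) xs = hitting_time (homology_vanishes n d) xs)"
  define D where "D = real d"
  define k where "k = heavy_const d"
  define c where "c = drop_const (heavy_const d) d"
  have D: "D \<ge> 2" using assms by (simp add: D_def)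
  have k: "k > 0"
  proof -
    have "(real d + 1)\<^sup>2 > 0" by simp
    then show ?thesis unfolding k_def heavy_const_def by simp
  qed
  then have c: "c > 0" by (simp add: c_def k_def drop_const_def)
  have E1: "eventually (\<lambda>n. n \<ge> 2 * d) sequentially" by (rule eventually_ge_at_top)
  have E2: "eventually (\<lambda>n. 1 \<le> k * real n) sequentially" using k by real_asymp
  have E3: "eventually (\<lambda>n. sqrt (real n) \<le> k * real n) sequentially" using k by real_asymp
  have E4: "eventually (\<lambda>n. D * ln (real n) / real n \<le> 1 / (100 * D)) sequentially" using D by real_asymp
  have E5: "eventually (\<lambda>n. real n / real (card (faces n d)) \<le> 1 / (200 * D)) sequentially"
  proof -
    have "eventually (\<lambda>n. real n * (D + 1) ^ 2 / real n ^ 2 \<le> 1 / (200 * D)) sequentially" using D by real_asymp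
    moreover have "eventually (\<lambda>n. n \<ge> d + 1) sequentially" by (rule eventually_ge_at_top)
    ultimately show ?thesis
    proof eventually_elim
      case (elim n)
      \<comment> \<open>The number of \<open>d\<close>-faces is at least of order n^2, which
        suffices to make n / M arbitrarily small.\<close>
      have "(real n / real (d + 1))\<^sup>2 \<le> (real n / real (d + 1)) ^ (d + 1)"
        using elim assms by (intro power_increasing) auto
      also have "\<dots> \<le> real (n choose (d + 1))" using binomial_ge_n_over_k_pow_k[of "d + 1" n] elim by simp
      finally have le: "(real n / real (d + 1))\<^sup>2 \<le> real (card (faces n d))" by (simp add: card_faces)
      have pos: "(real n / real (d + 1))\<^sup>2 > 0" using elim by simp
      have "real n / real (card (faces n d)) \<le> real n / (real n / real (d + 1))\<^sup>2"
        by (intro divide_left_mono mult_pos_pos le pos order.strict_trans2[OF pos le]) simp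
      also have "\<dots> = real n * (D + 1) ^ 2 / real n ^ 2" by (simp add: power_divide D_def add.commute)
      finally show ?case using elim by linarith
    qed
  qed
  have E6: "eventually (\<lambda>n. 3 \<le> 1 / (8 * D) * (c / 3 * ((D - 1/10) * ln (real n) - 1) - ln (8 * (D + 1)))) sequentially"
    using D c by real_asymp
  have E7: "eventually (\<lambda>n. exp 1 * D * real n powr (- 3/8) \<le> 1/2) sequentially" by real_asymp
  show "eventually (\<lambda>n. 1 - error_bound d (real n) \<le> ?p n) sequentially"
    using E1 E2 E3 E4 E5 E6 E7
    by eventually_elim (rule LM_prob_hitting_lower[OF assms], simp_all add: D_def k_def c_def)
  show "eventually (\<lambda>n. ?p n \<le> 1) sequentially" using LM_prob_le_1 by simp
  have "(\<lambda>n. (real d ^ d * real n powr (- 1/20) + 3 * real d ^ 3 / real n)) \<longlonglongrightarrow> 0" by real_asymp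
  moreover have "(\<lambda>n. 2 * exp 1 * (exp 1 * real d) * real n powr (- 1/4)) \<longlonglongrightarrow> 0" by real_asymp
  moreover have "(\<lambda>n. exp (exp 1 * (exp 1 * real n powr (1/4)) - (sqrt (real n) - 1))) \<longlonglongrightarrow> 0" by real_asymp
  moreover have "(\<lambda>n. 2 * exp (2 * real d - real n) * exp (exp 1 * real n powr (1/4))) \<longlonglongrightarrow> 0" by real_asymp
  ultimately have "(\<lambda>n. 1 - error_bound d (real n)) \<longlonglongrightarrow> 1 - (0 + 0 + (0 + 0))"
    unfolding error_bound_def by (intro tendsto_intros)
  then show "(\<lambda>n. 1 - error_bound d (real n)) \<longlonglongrightarrow> 1" by simp
  show "(\<lambda>_. 1::real) \<longlonglongrightarrow> 1" by simp
qed

end
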